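(* Let $\bar x\in M$ be a W-stationary point of MPSC satisfying LICQ, with the unique Lagrange multipliers $(\bar\lambda,\bar\mu,\bar\sigma)$. Then $\bar x$ is strongly stable if and only if (i) $\bar\sigma_{1,m}\cdot\bar\sigma_{2,m}\ne 0$ for all $m\in\beta(\bar x)$, and (ii) the matrices $D^2_{xx}L(\bar x,\bar\lambda,\bar\mu,\bar\sigma)\restriction_{T_{\bar x}M_*(\bar x)}$ are nonsingular with the same determinant sign for all index subsets $J_*$ with $J_+(\bar x)\subset J_*\subset J_0(\bar x)$.
   Context: Setting. Let $I,J$ be finite index sets, and let $f\in C^2(\mathbb{R}^n,\mathbb{R})$, $h\in C^2(\mathbb{R}^n,\mathbb{R}^{|I|})$, $g\in C^2(\mathbb{R}^n,\mathbb{R}^{|J|})$, $F_1,F_2\in C^2(\mathbb{R}^n,\mathbb{R}^k)$. The mathematical program with switching constraints MPSC$[f,h,g,F_1,F_2]$ is to minimize $f(x)$ subject to $x\in M$, where $M=\{x\in\mathbb{R}^n \mid h_i(x)=0\ (i\in I),\ g_j(x)\ge 0\ (j\in J),\ F_{1,m}(x)F_{2,m}(x)=0\ (m=1,\dots,k)\}$. Index sets at $\bar x\in M$: $J_0(\bar x)=\{j\in J\mid g_j(\bar x)=0\}$; $\alpha(\bar x)=\{m\mid F_{1,m}(\bar x)=0, F_{2,m}(\bar x)\ne 0\}$; $\beta(\bar x)=\{m\mid F_{1,m}(\bar x)=F_{2,m}(\bar x)=0\}$; $\gamma(\bar x)=\{m\mid F_{1,m}(\bar x)\ne 0, F_{2,m}(\bar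 x)=0\}$. LICQ holds at $\bar x\in M$ if the vectors $Dh_i(\bar x)$ ($i\in I$), $DF_{1,m}(\bar x)$ ($m\in\alpha(\bar x)$), $DF_{2,m}(\bar x)$ ($m\in\gamma(\bar x)$), $Dg_j(\bar x)$ ($j\in J_0(\bar x)$), $DF_{1,m}(\bar x), DF_{2,m}(\bar x)$ ($m\in\beta(\bar x)$) are linearly independent. W-stationarity: $\bar x\in M$ is W-stationary if there are real multipliers $\bar\lambda_i$ ($i\in I$), $\bar\mu_j$ ($j\in J$), $\bar\sigma_{1,m},\bar\sigma_{2,m}$ ($m=1,\dots,k$) such that $Df(\bar x)=\sum_{i\in I}\bar\lambda_i Dh_i(\bar x)+\sum_{j\in J}\bar\mu_j Dg_j(\bar x)+\sum_{m=1}^k(\bar\sigma_{1,m}DF_{1,m}(\bar x)+\bar\sigma_{2,m}DF_{2,m}(\bar x))$, $\bar\mu_j g_j(\bar x)=0$ and $\bar\mu_j\ge 0$ for all $j\in J$, and $\bar\sigma_{l,m}F_{l,m}(\bar x)=0$ for $l=1,2$, $m=1,\dots,k$. Under LICQ the multipliers are unique. Lagrange function: $L(x,\lambda,\mu,\sigma)=f(x)-\sum_{i\in I}\lambda_i h_i(x)-\sum_{j\in J}\mu_j g_j(x)-\sum_{m=1}^k(\sigma_{1,m}F_{1,m}(x)+\sigma_{2,m}F_{2,m}(x))$. Put $J_+(\bar x)=\{j\in J_0(\bar x)\mid\bar\mu_j>0\}$. For $J_+(\bar x)\subset J_*\subset J_0(\bar x)$ put $T_{\bar x}M_*(\bar x)=\{\xi\in\mathbb{R}^n\mid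 Dh_i(\bar x)\xi=0\ (i\in I),\ Dg_j(\bar x)\xi=0\ (j\in J_* ),\ DF_{1,m}(\bar x)\xi=0\ (m\in\alpha(\bar x)),\ DF_{2,m}(\bar x)\xi=0\ (m\in\gamma(\bar x)),\ DF_{1,m}(\bar x)\xi=DF_{2,m}(\bar x)\xi=0\ (m\in\beta(\bar x))\}$. The restriction of $D^2_{xx}L$ to this space means $V^T D^2_{xx}L\,V$, where the columns of $V$ form a basis of the space; nonsingularity and determinant sign do not depend on $V$ (as usual, an empty $0\times 0$ matrix has determinant $1$). Strong stability: let $B(\bar x,r)=\{x\in\mathbb{R}^n\mid\|x-\bar x\|\le r\}$ and let $\|(f,h,g,F_1,F_2)\|^{C^2}_{B(\bar x,r)}$ be the maximum modulus, over $B(\bar x,r)$, of the function values and partial derivatives up to order two of (all components of) $f,h,g,F_1,F_2$. A W-stationary point $\bar x$ for MPSC$[f,h,g,F_1,F_2]$ is called strongly stable if for some $r>0$ and each $\varepsilon\in(0,r]$ there exists $\delta=\delta(\varepsilon)>0$ such that whenever $\widetilde f,\widetilde h,\widetilde g,\widetilde F_1,\widetilde F_2$ are $C^2$ functions (with the same domains and codomains) with $\|(f-\widetilde f,h-\widetilde h,g-\widetilde g,F_1-\widetilde F_1,F_2-\widetilde F_2)\|^{C^2}_{B(\bar x,r)}\le\delta$, the ball $B(\bar x,\varepsilon)$ contains a W-stationary point $\widetilde x$ for MPSC$[\widetilde f,\widetilde h,\widetilde g,\widetilde F_1,\widetilde F_2]$ which is unique in $B(\bar x,r)$ (i.e. the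 only W-stationary point of the perturbed problem in $B(\bar x,r)$). *)

theory Defs
  imports "HOL-Analysis.Analysis" "Jordan_Normal_Form.Determinant"
begin

no_notation Matrix.vec_index (infixl "$" 100)
no_notation Matrix.scalar_prod (infix "\<bullet>" 70)
unbundle inner_syntax

section \<open>Derivatives up to order two\<close>

definition pd :: "'n \<Rightarrow> (real ^ 'n \<Rightarrow> real) \<Rightarrow> real ^ 'n \<Rightarrow> real" where
  "pd i \<phi> x = frechet_derivative \<phi> (at x) (axis i 1)"

text \<open>The derivative \<open>D\<phi>(x)\<close>, a row vector in the paper, is represented by the vector of partial
  derivatives, so that \<open>D\<phi>(x)\<xi>\<close> becomes \<open>grad \<phi> x \<bullet> \<xi>\<close>.\<close>

definition grad :: "(real ^ 'n \<Rightarrow> real) \<Rightarrow> real ^ 'n \<Rightarrow> real ^ 'n" where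
  "grad \<phi> x = (\<chi> i. pd i \<phi> x)"

definition hess :: "(real ^ 'n \<Rightarrow> real) \<Rightarrow> real ^ 'n \<Rightarrow> real ^ 'n ^ 'n" where
  "hess \<phi> x = (\<chi> i j. pd i (pd j \<phi>) x)"

definition C2 :: "(real ^ 'n \<Rightarrow> real) \<Rightarrow> bool" where
  "C2 \<phi> \<longleftrightarrow>
     (\<forall>x. \<phi> differentiable (at x)) \<and>
     (\<forall>i x. pd i \<phi> differentiable (at x)) \<and>
     (\<forall>i j. continuous_on UNIV (pd i (pd j \<phi>)))"

text \<open>For a finite nonempty set \<open>\<Phi>\<close> of \<open>C\<^sup>2\<close> functions and a nonempty compact set \<open>B\<close> the supremum
  below is attained, so it is the maximum modulus of the values and of the partial derivatives up to
  order two.\<close>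

definition C2_moduli :: "(real ^ 'n) set \<Rightarrow> (real ^ 'n \<Rightarrow> real) \<Rightarrow> real set" where
  "C2_moduli B \<phi> =
     {\<bar>\<phi> x\<bar> | x. x \<in> B} \<union>
     {\<bar>pd i \<phi> x\<bar> | i x. x \<in> B} \<union>
     {\<bar>pd i (pd j \<phi>) x\<bar> | i j x. x \<in> B}"

definition C2_norm :: "(real ^ 'n) set \<Rightarrow> (real ^ 'n \<Rightarrow> real) set \<Rightarrow> real" where
  "C2_norm B \<Phi> = Sup (\<Union>\<phi>\<in>\<Phi>. C2_moduli B \<phi>)"

section \<open>Mathematical programs with switching constraints\<close>

text \<open>The index sets \<open>I\<close> and \<open>J\<close> are sets rather than types because they may be empty. Values of
  the component functions at indices outside \<open>I\<close>, \<open>J\<close>, \<open>{1..k}\<close> are irrelevant.\<close>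

record ('i, 'j, 'n) mpsc =
  eq_idx   :: "'i set"
  ineq_idx :: "'j set"
  nsw      :: nat
  obj      :: "real ^ 'n \<Rightarrow> real"
  eqf      :: "'i \<Rightarrow> real ^ 'n \<Rightarrow> real"
  ineqf    :: "'j \<Rightarrow> real ^ 'n \<Rightarrow> real"
  sw1      :: "nat \<Rightarrow> real ^ 'n \<Rightarrow> real"
  sw2      :: "nat \<Rightarrow> real ^ 'n \<Rightarrow> real"

text \<open>Names for the scalar constraint functions, so that they can be treated as one family.\<close>

datatype ('i, 'j) constr = Eq 'i | Ineq 'j | Sw1 nat | Sw2 nat

fun constr_fun :: "('i, 'j, 'n::finite) mpsc \<Rightarrow> ('i, 'j) constr \<Rightarrow> real ^ 'n \<Rightarrow> real" where
  "constr_fun P (Eq i) = eqf P i"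
| "constr_fun P (Ineq j) = ineqf P j"
| "constr_fun P (Sw1 m) = sw1 P m"
| "constr_fun P (Sw2 m) = sw2 P m"

definition constrs :: "('i, 'j, 'n::finite) mpsc \<Rightarrow> ('i, 'j) constr set" where
  "constrs P = Eq ` eq_idx P \<union> Ineq ` ineq_idx P \<union> Sw1 ` {1..nsw P} \<union> Sw2 ` {1..nsw P}"

definition C2_data :: "('i, 'j, 'n::finite) mpsc \<Rightarrow> bool" where
  "C2_data P \<longleftrightarrow> C2 (obj P) \<and> (\<forall>c\<in>constrs P. C2 (constr_fun P c))"

definition feasible :: "('i, 'j, 'n::finite) mpsc \<Rightarrow> (real ^ 'n) set" where
  "feasible P = {x. (\<forall>i\<in>eq_idx P. eqf P i x = 0) \<and> (\<forall>j\<in>ineq_idx P. ineqf P j x \<ge> 0) \<and>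
                    (\<forall>m\<in>{1..nsw P}. sw1 P m x * sw2 P m x = 0)}"

definition J0 :: "('i, 'j, 'n::finite) mpsc \<Rightarrow> real ^ 'n \<Rightarrow> 'j set" where
  "J0 P x = {j\<in>ineq_idx P. ineqf P j x = 0}"

definition alpha :: "('i, 'j, 'n::finite) mpsc \<Rightarrow> real ^ 'n \<Rightarrow> nat set" where
  "alpha P x = {m\<in>{1..nsw P}. sw1 P m x = 0 \<and> sw2 P m x \<noteq> 0}"

definition beta :: "('i, 'j, 'n::finite) mpsc \<Rightarrow> real ^ 'n \<Rightarrow> nat set" where
  "beta P x = {m\<in>{1..nsw P}. sw1 P m x = 0 \<and> sw2 P m x = 0}"

definition gamma :: "('i, 'j, 'n::finite) mpsc \<Rightarrow> real ^ 'n \<Rightarrow> nat set" where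
  "gamma P x = {m\<in>{1..nsw P}. sw1 P m x \<noteq> 0 \<and> sw2 P m x = 0}"

text \<open>Linear independence of an indexed family: injectivity excludes repeated vectors, which the
  independence of the set of values does not detect.\<close>

definition LICQ :: "('i, 'j, 'n::finite) mpsc \<Rightarrow> real ^ 'n \<Rightarrow> bool" where
  "LICQ P x \<longleftrightarrow>
     (let A = Eq ` eq_idx P \<union> Sw1 ` alpha P x \<union> Sw2 ` gamma P x \<union> Ineq ` J0 P x \<union>
              Sw1 ` beta P x \<union> Sw2 ` beta P x;
          v = (\<lambda>c. grad (constr_fun P c) x)
      in inj_on v A \<and> independent (v ` A))"

definition W_multipliers ::
  "('i, 'j, 'n::finite) mpsc \<Rightarrow> real ^ 'n \<Rightarrow>
   ('i \<Rightarrow> real) \<Rightarrow> ('j \<Rightarrow> real) \<Rightarrow> (nat \<Rightarrow> real) \<Rightarrow> (nat \<Rightarrow> real) \<Rightarrow> bool" where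
  "W_multipliers P x lam mu sig1 sig2 \<longleftrightarrow>
     grad (obj P) x =
       (\<Sum>i\<in>eq_idx P. lam i *\<^sub>R grad (eqf P i) x) +
       (\<Sum>j\<in>ineq_idx P. mu j *\<^sub>R grad (ineqf P j) x) +
       (\<Sum>m=1..nsw P. sig1 m *\<^sub>R grad (sw1 P m) x + sig2 m *\<^sub>R grad (sw2 P m) x) \<and>
     (\<forall>j\<in>ineq_idx P. mu j * ineqf P j x = 0 \<and> mu j \<ge> 0) \<and>
     (\<forall>m\<in>{1..nsw P}. sig1 m * sw1 P m x = 0 \<and> sig2 m * sw2 P m x = 0)"

definition W_stationary :: "('i, 'j, 'n::finite) mpsc \<Rightarrow> real ^ 'n \<Rightarrow> bool" where
  "W_stationary P x \<longleftrightarrow> x \<in> feasible P \<and> (\<exists>lam mu sig1 sig2. W_multipliers P x lam mu sig1 sig2)"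

definition Lagrangian ::
  "('i, 'j, 'n::finite) mpsc \<Rightarrow>
   ('i \<Rightarrow> real) \<Rightarrow> ('j \<Rightarrow> real) \<Rightarrow> (nat \<Rightarrow> real) \<Rightarrow> (nat \<Rightarrow> real) \<Rightarrow> real ^ 'n \<Rightarrow> real" where
  "Lagrangian P lam mu sig1 sig2 x =
     obj P x - (\<Sum>i\<in>eq_idx P. lam i * eqf P i x) - (\<Sum>j\<in>ineq_idx P. mu j * ineqf P j x) -
     (\<Sum>m=1..nsw P. sig1 m * sw1 P m x + sig2 m * sw2 P m x)"

section \<open>Strong stability\<close>

definition diff_components ::
  "('i, 'j, 'n::finite) mpsc \<Rightarrow> ('i, 'j, 'n) mpsc \<Rightarrow> (real ^ 'n \<Rightarrow> real) set" where
  "diff_components P Q =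
     insert (\<lambda>y. obj P y - obj Q y) ((\<lambda>c y. constr_fun P c y - constr_fun Q c y) ` constrs P)"

definition same_format :: "('i, 'j, 'n::finite) mpsc \<Rightarrow> ('i, 'j, 'n) mpsc \<Rightarrow> bool" where
  "same_format P Q \<longleftrightarrow> eq_idx Q = eq_idx P \<and> ineq_idx Q = ineq_idx P \<and> nsw Q = nsw P"

definition strongly_stable :: "('i, 'j, 'n::finite) mpsc \<Rightarrow> real ^ 'n \<Rightarrow> bool" where
  "strongly_stable P x \<longleftrightarrow> W_stationary P x \<and>
     (\<exists>r>0. \<forall>\<epsilon>. 0 < \<epsilon> \<and> \<epsilon> \<le> r \<longrightarrow>
       (\<exists>\<delta>>0. \<forall>Q. same_format P Q \<and> C2_data Q \<and> C2_norm (cball x r) (diff_components P Q) \<le> \<delta> \<longrightarrow>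
         (\<exists>x'\<in>cball x \<epsilon>. W_stationary Q x' \<and> (\<forall>y\<in>cball x r. W_stationary Q y \<longrightarrow> y = x'))))"

section \<open>Restricted Hessians\<close>

definition J_plus :: "('i, 'j, 'n::finite) mpsc \<Rightarrow> real ^ 'n \<Rightarrow> ('j \<Rightarrow> real) \<Rightarrow> 'j set" where
  "J_plus P x mu = {j\<in>J0 P x. mu j > 0}"

definition tangent_space ::
  "('i, 'j, 'n::finite) mpsc \<Rightarrow> real ^ 'n \<Rightarrow> 'j set \<Rightarrow> (real ^ 'n) set" where
  "tangent_space P x Js =
     {\<xi>. (\<forall>i\<in>eq_idx P. grad (eqf P i) x \<bullet> \<xi> = 0) \<and>
         (\<forall>j\<in>Js. grad (ineqf P j) x \<bullet> \<xi> = 0) \<and>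
         (\<forall>m\<in>alpha P x. grad (sw1 P m) x \<bullet> \<xi> = 0) \<and>
         (\<forall>m\<in>gamma P x. grad (sw2 P m) x \<bullet> \<xi> = 0) \<and>
         (\<forall>m\<in>beta P x. grad (sw1 P m) x \<bullet> \<xi> = 0 \<and> grad (sw2 P m) x \<bullet> \<xi> = 0)}"

definition basis_of :: "(real ^ 'n) list \<Rightarrow> (real ^ 'n) set \<Rightarrow> bool" where
  "basis_of vs T \<longleftrightarrow> distinct vs \<and> independent (set vs) \<and> span (set vs) = T"

text \<open>The matrix \<open>V\<^sup>T H V\<close>, where the list \<open>vs\<close> holds the columns of \<open>V\<close>. Its size varies with
  the subspace (and may be 0, in which case the determinant is 1), hence the matrix type whose
  dimensions are terms.\<close>

definition restr_mat :: "real ^ 'n ^ 'n \<Rightarrow> (real ^ 'n) list \<Rightarrow> real mat" where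
  "restr_mat H vs = Matrix.mat (length vs) (length vs) (\<lambda>(a, b). (vs ! a) \<bullet> (H *v (vs ! b)))"

text \<open>The choice of basis does not matter; quantifying over all bases avoids picking one.\<close>

definition restr_nonsingular_same_sign ::
  "real ^ 'n ^ 'n \<Rightarrow> (real ^ 'n) set set \<Rightarrow> bool" where
  "restr_nonsingular_same_sign H TT \<longleftrightarrow>
     (\<exists>s::real. \<forall>T\<in>TT. \<forall>vs. basis_of vs T \<longrightarrow>
        invertible_mat (restr_mat H vs) \<and> sgn (Determinant.det (restr_mat H vs)) = s)"

end

theory Submission
  imports Defs
begin

text \<open>
  Two things can happen to a stationary point under a small perturbation of the data: it can split into
  several stationary points, or it can disappear. By LICQ the multipliers of a nearby stationary point of
  a perturbed program stay close to the given ones (\<open>stationary_imp_zero\<close>). So every constraint whose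
  multiplier is nonzero remains active, and the only choice left is, for each weakly active inequality
  (active with multiplier 0) and for each biactive switching constraint with a vanishing multiplier,
  between a zero constraint value and a zero multiplier.

  The determinant condition is first restated without determinants: \<open>no_critical_direction\<close> says that
  no \<open>\<xi> \<noteq> 0\<close>, together with increments \<open>\<nu>\<close> of the multipliers, solves the linearized stationarity
  equations with \<open>\<nu>\<^sub>j (Dg\<^sub>j \<xi>) \<le> 0\<close> for all weakly active \<open>j\<close>. In suitable coordinates the restricted
  Hessians are principal submatrices of one matrix, and the equivalence generalizes the classical fact that
  all principal minors of a matrix are positive if and only if it reverses the sign of no nonzero vector. It
  rests on the identity
  \<open>det\<^sub>T (H + s g g\<^sup>T) = det\<^sub>T H + s c\<^sup>2 det\<^sub>K H\<close> with \<open>K\<close> the hyperplane \<open>{v \<in> T. g v = 0}\<close> of \<open>T\<close>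
  (\<open>det_restr_mat_rank_one\<close>): for some \<open>s \<ge> 0\<close> the left-hand side vanishes if the two
  determinants on the right have opposite signs, and for none if they have the same nonzero sign.

  Necessity. A pair \<open>(\<xi>, \<nu>)\<close> that solves this system is the difference of two solutions of the linearized
  complementarity system. Affine corrections of the constraints and a quadratic correction of the
  objective, all with coefficients that tend to 0 with \<open>\<tau>\<close>, turn both \<open>x\<close> and \<open>x + \<tau> \<xi>\<close> into exact
  stationary points of one perturbed program (\<open>two_stationary_points_imp_not_strongly_stable\<close>), which
  contradicts uniqueness. If a biactive switching constraint has a zero multiplier, its value and its
  multiplier only need a zero product, without sign conditions, so every increment is admissible; dropping
  one linear constraint on \<open>\<xi>\<close> then leaves more unknowns than equations, and a critical direction always
  exists (\<open>ex_free_critical_direction\<close>).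

  Sufficiency. If the multipliers of all biactive constraints are nonzero, the stationary points near \<open>x\<close> are the zeros of Kojima's piecewise smooth map,
  in which one real variable \<open>z\<close> encodes a multiplier \<open>max z 0\<close> and a constraint value \<open>max z 0 - z\<close>. A
  difference of values of this map is, up to a small error, the image of the difference of the arguments
  under a matrix that depends on slopes in \<open>[0, 1]\<close>. Absence of critical directions makes all these
  matrices invertible; compactness of the set of slopes gives a uniform lower bound, which survives small
  \<open>C\<^sup>2\<close> perturbations (\<open>kojima_expansive\<close>). This yields uniqueness at once, and existence by invariance
  of domain (\<open>expansive_map_has_zero\<close>).
\<close>

section \<open>Determinants of bilinear forms on subspaces\<close>

lemmas cart_eq_iff = Finite_Cartesian_Product.vec_eq_iff

abbreviation restr_det :: "real ^ 'n ^ 'n \<Rightarrow> (real ^ 'n) list \<Rightarrow> real" where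
  "restr_det H vs \<equiv> Determinant.det (restr_mat H vs)"

lemma restr_mat_carrier: "restr_mat H vs \<in> carrier_mat (length vs) (length vs)"
  by (simp add: restr_mat_def)

lemma invertible_mat_iff_det:
  fixes A :: "real mat"
  assumes A: "A \<in> carrier_mat n n"
  shows "invertible_mat A \<longleftrightarrow> Determinant.det A \<noteq> 0"
proof
  assume "invertible_mat A"
  then obtain B where AB: "A * B = 1\<^sub>m (dim_row A)" and BA: "B * A = 1\<^sub>m (dim_row B)"
    unfolding invertible_mat_def inverts_mat_def by auto
  have "dim_col B = n" using arg_cong[OF AB, of dim_col] A by simp
  moreover have "dim_row B = n" using arg_cong[OF BA, of dim_col] A by simp
  ultimately have B: "B \<in> carrier_mat n n" by auto
  have "Determinant.det A * Determinant.det B = 1"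
    using det_mult[OF A B] AB A by simp
  then show "Determinant.det A \<noteq> 0" by auto
next
  assume "Determinant.det A \<noteq> 0"
  from det_non_zero_imp_unit[OF A this, of "()"]
  obtain B where "B \<in> carrier_mat n n" "A * B = 1\<^sub>m n" "B * A = 1\<^sub>m n"
    unfolding Units_def ring_mat_def by auto
  then show "invertible_mat A"
    using A unfolding invertible_mat_def inverts_mat_def by auto
qed

definition comb :: "(real ^ 'n) list \<Rightarrow> real Matrix.vec \<Rightarrow> real ^ 'n" where
  "comb vs y = (\<Sum>a<length vs. Matrix.vec_index y a *\<^sub>R vs ! a)"

lemma comb_in_span: "comb vs y \<in> span (set vs)"
  unfolding comb_def by (intro span_sum span_scale span_base) simp

lemma span_comb:
  assumes d: "distinct vs" and v: "v \<in> span (set vs)"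
  obtains y where "y \<in> carrier_vec (length vs)" "v = comb vs y"
proof -
  from v obtain u where u: "v = (\<Sum>w\<in>set vs. u w *\<^sub>R w)"
    using span_finite[of "set vs"] by auto
  have "v = (\<Sum>a<length vs. u (vs ! a) *\<^sub>R vs ! a)"
    unfolding u using d by (intro sum.reindex_bij_betw[symmetric] bij_betw_nth) auto
  then have "v = comb vs (Matrix.vec (length vs) (\<lambda>a. u (vs ! a)))"
    unfolding comb_def by (auto intro!: sum.cong)
  then show thesis by (intro that) auto
qed

lemma comb_eq_0:
  assumes d: "distinct vs" and i: "independent (set vs)"
    and y: "y \<in> carrier_vec (length vs)" and 0: "comb vs y = 0"
  shows "y = 0\<^sub>v (length vs)"
proof
  show "dim_vec y = dim_vec (0\<^sub>v (length vs) :: real Matrix.vec)" using y by simp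
next
  fix a assume "a < dim_vec (0\<^sub>v (length vs) :: real Matrix.vec)"
  then have a: "a < length vs" by simp
  define u where "u w = Matrix.vec_index y (the_inv_into {..<length vs} ((!) vs) w)" for w
  have inj: "inj_on ((!) vs) {..<length vs}" using d by (auto simp: inj_on_nth)
  have uv: "u (vs ! b) = Matrix.vec_index y b" if "b < length vs" for b
    unfolding u_def using the_inv_into_f_f[OF inj, of b] that by simp
  have "comb vs y = (\<Sum>b<length vs. u (vs ! b) *\<^sub>R vs ! b)"
    unfolding comb_def by (intro sum.cong) (auto simp: uv)
  also have "\<dots> = (\<Sum>w\<in>set vs. u w *\<^sub>R w)"
    using d by (intro sum.reindex_bij_betw bij_betw_nth) auto
  finally have "(\<Sum>w\<in>set vs. u w *\<^sub>R w) = 0" using 0 by simp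
  then have "u (vs ! a) = 0"
    using i a unfolding independent_explicit_finite_subsets by (meson List.finite_set nth_mem order_refl)
  then show "Matrix.vec_index y a = Matrix.vec_index (0\<^sub>v (length vs)) a" using uv[OF a] a by simp
qed

lemma restr_mat_mult_vec:
  assumes "y \<in> carrier_vec (length vs)" "a < length vs"
  shows "Matrix.vec_index (restr_mat H vs *\<^sub>v y) a = vs ! a \<bullet> (H *v comb vs y)"
  using assms unfolding comb_def restr_mat_def
  by (auto simp: Matrix.scalar_prod_def matrix_vector_right_distrib lessThan_atLeast0 inner_sum_right
     linear_sum[OF matrix_vector_mul_linear] linear_scale[OF matrix_vector_mul_linear]
     intro!: sum.cong mult.commute)

text \<open>A criterion that mentions only the subspace: whether the determinant vanishes does not depend on the
  basis.\<close>
lemma det_restr_mat_0_iff: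
  assumes b: "basis_of vs T"
  shows "restr_det H vs = 0 \<longleftrightarrow> (\<exists>\<xi>\<in>T. \<xi> \<noteq> 0 \<and> (\<forall>v\<in>T. v \<bullet> (H *v \<xi>) = 0))"
proof -
  from b have d: "distinct vs" and i: "independent (set vs)" and T: "span (set vs) = T"
    by (auto simp: basis_of_def)
  have orth: "(\<forall>v\<in>T. v \<bullet> w = 0) \<longleftrightarrow> (\<forall>a<length vs. vs ! a \<bullet> w = 0)" for w
  proof
    assume *: "\<forall>a<length vs. vs ! a \<bullet> w = 0"
    show "\<forall>v\<in>T. v \<bullet> w = 0"
    proof
      fix v assume "v \<in> T"
      then obtain y where "v = comb vs y" using span_comb[OF d, of v] T by auto
      then show "v \<bullet> w = 0" using * by (simp add: comb_def inner_sum_left)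
    qed
  qed (use T span_base nth_mem in blast)
  have "restr_det H vs = 0 \<longleftrightarrow> (\<exists>y. y \<in> carrier_vec (length vs) \<and>
      y \<noteq> 0\<^sub>v (length vs) \<and> restr_mat H vs *\<^sub>v y = 0\<^sub>v (length vs))"
    by (rule det_0_iff_vec_prod_zero[OF restr_mat_carrier])
  also have "\<dots> \<longleftrightarrow> (\<exists>y. y \<in> carrier_vec (length vs) \<and> y \<noteq> 0\<^sub>v (length vs) \<and>
      (\<forall>v\<in>T. v \<bullet> (H *v comb vs y) = 0))"
  proof (intro ex_cong1 conj_cong refl)
    fix y :: "real Matrix.vec" assume y: "y \<in> carrier_vec (length vs)"
    have "restr_mat H vs *\<^sub>v y = 0\<^sub>v (length vs) \<longleftrightarrow>
      (\<forall>a<length vs. Matrix.vec_index (restr_mat H vs *\<^sub>v y) a = 0)"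
      by (auto simp: Matrix.vec_eq_iff restr_mat_def)
    then show "restr_mat H vs *\<^sub>v y = 0\<^sub>v (length vs) \<longleftrightarrow> (\<forall>v\<in>T. v \<bullet> (H *v comb vs y) = 0)"
      using restr_mat_mult_vec[OF y, of _ H] orth by simp
  qed
  also have "\<dots> \<longleftrightarrow> (\<exists>\<xi>\<in>T. \<xi> \<noteq> 0 \<and> (\<forall>v\<in>T. v \<bullet> (H *v \<xi>) = 0))" (is "?A \<longleftrightarrow> ?B")
  proof
    assume ?A
    then show ?B using comb_in_span[of vs] T comb_eq_0[OF d i] by blast
  next
    assume ?B
    then obtain \<xi> where \<xi>: "\<xi> \<in> T" "\<xi> \<noteq> 0" "\<forall>v\<in>T. v \<bullet> (H *v \<xi>) = 0" by auto
    obtain y where y: "y \<in> carrier_vec (length vs)" "\<xi> = comb vs y"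
      using span_comb[OF d] \<xi>(1) T by metis
    moreover have "y \<noteq> 0\<^sub>v (length vs)"
      using \<xi>(2) y(2) by (auto simp: comb_def)
    ultimately show ?A using \<xi> by auto
  qed
  finally show ?thesis .
qed

lemma basis_of_length:
  assumes "basis_of vs T" shows "length vs = dim T"
  using assms unfolding basis_of_def
  by (metis dim_eq_card_independent dim_span distinct_card)

text \<open>A change of basis \<open>C\<close> multiplies the determinant by \<open>(det C)\<^sup>2\<close>. Here \<open>det C \<noteq> 0\<close>
  because one determinant vanishes only if the other does.\<close>
lemma det_restr_mat_sgn_unique:
  assumes b: "basis_of vs T" and b': "basis_of ws T"
  shows "sgn (restr_det H vs) = sgn (restr_det H ws)"
proof (cases "restr_det H vs = 0")
  case True
  then show ?thesis using det_restr_mat_0_iff[OF b] det_restr_mat_0_iff[OF b'] by metis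
next
  case nz: False
  then have nz': "restr_det H ws \<noteq> 0"
    using det_restr_mat_0_iff[OF b] det_restr_mat_0_iff[OF b'] by metis
  define n where "n = length vs"
  have n': "length ws = n" using basis_of_length[OF b] basis_of_length[OF b'] n_def by simp
  have "\<forall>b<n. \<exists>y. y \<in> carrier_vec n \<and> ws ! b = comb vs y"
    using b b' span_comb[of vs] unfolding basis_of_def n_def n'[symmetric]
    by (metis (no_types, lifting) b b' basis_of_length nth_mem span_base)
  then obtain y where y: "\<And>b. b < n \<Longrightarrow> y b \<in> carrier_vec n \<and> ws ! b = comb vs (y b)" by metis
  define C where "C = Matrix.mat n n (\<lambda>(a,b). Matrix.vec_index (y b) a)"
  have C: "C \<in> carrier_mat n n" by (simp add: C_def)
  have R: "restr_mat H vs \<in> carrier_mat n n" using restr_mat_carrier n_def by blast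
  have "restr_mat H ws = transpose_mat C * (restr_mat H vs * C)"
  proof (rule Matrix.eq_matI)
    fix a b assume "a < dim_row (transpose_mat C * (restr_mat H vs * C))"
      and "b < dim_col (transpose_mat C * (restr_mat H vs * C))"
    then have a: "a < n" and bb: "b < n" using C by auto
    have col: "Matrix.col C b = y b" using y[OF bb] bb unfolding C_def by (intro Matrix.eq_vecI) auto
    have cola: "Matrix.col C a = y a" using y[OF a] a unfolding C_def by (intro Matrix.eq_vecI) auto
    have "Matrix.index_mat (transpose_mat C * (restr_mat H vs * C)) (a, b)
        = Matrix.scalar_prod (y a) (restr_mat H vs *\<^sub>v y b)"
      using a bb C R col cola by (simp add: col_mult2[OF R C bb])
    also have "\<dots> = (\<Sum>c<n. Matrix.vec_index (y a) c * (vs ! c \<bullet> (H *v comb vs (y b))))"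
      using restr_mat_mult_vec[of "y b" vs _ H] y[OF bb] R
      by (auto simp: Matrix.scalar_prod_def n_def lessThan_atLeast0 intro!: sum.cong)
    also have "\<dots> = ws ! a \<bullet> (H *v (ws ! b))"
      using y[OF a] y[OF bb] by (simp add: comb_def[of vs "y a"] n_def inner_sum_left)
    finally show "Matrix.index_mat (restr_mat H ws) (a, b) = Matrix.index_mat (transpose_mat C * (restr_mat H vs * C)) (a, b)"
      using a bb n' by (simp add: restr_mat_def)
  qed (use C n' in \<open>auto simp: restr_mat_def\<close>)
  then have eq: "restr_det H ws =
      Determinant.det C * Determinant.det C * restr_det H vs"
    using C R by (simp add: det_mult[of _ n] Determinant.det_transpose[OF C])
  then have "Determinant.det C \<noteq> 0" using nz' by auto
  then have "sgn (Determinant.det C * Determinant.det C) = 1"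
    using not_real_square_gt_zero[of "Determinant.det C"] by (simp only: sgn_1_pos) blast
  then show ?thesis unfolding eq by (simp only: sgn_mult mult_1)
qed

lemma restr_mat_transpose: "restr_mat (Finite_Cartesian_Product.transpose H) vs = transpose_mat (restr_mat H vs)"
  unfolding restr_mat_def
  by (rule Matrix.eq_matI) (auto simp: transpose_matrix_vector inner_commute[of _ "_ v* _"] dot_lmul_matrix)

text \<open>The entries of the Hessian are indexed so that the derivative of the gradient is its transpose, and it
  is this derivative that appears in all expansions.\<close>
lemma restr_nonsingular_same_sign_transpose:
  "restr_nonsingular_same_sign (Finite_Cartesian_Product.transpose H) TT = restr_nonsingular_same_sign H TT"
proof -
  have "invertible_mat (restr_mat (Finite_Cartesian_Product.transpose H) vs) = invertible_mat (restr_mat H vs)" for vs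
    unfolding invertible_mat_iff_det[OF restr_mat_carrier] unfolding restr_mat_transpose
    by (simp add: Determinant.det_transpose[OF restr_mat_carrier])
  moreover have "restr_det (Finite_Cartesian_Product.transpose H) vs = restr_det H vs" for vs
    by (simp add: restr_mat_transpose Determinant.det_transpose[OF restr_mat_carrier])
  ultimately show ?thesis by (simp add: restr_nonsingular_same_sign_def)
qed

definition outer :: "real ^ 'n \<Rightarrow> real ^ 'n ^ 'n" where
  "outer g = (\<chi> i j. g $ i * g $ j)"

lemma outer_mult: "outer g *v x = (g \<bullet> x) *\<^sub>R g"
  by (simp add: outer_def cart_eq_iff matrix_vector_mult_def inner_vec_def sum_distrib_left mult_ac)

text \<open>In a basis whose remaining vectors are orthogonal to \<open>g\<close> the rank-one term changes a single diagonal
  entry; its cofactor is the determinant on the hyperplane orthogonal to \<open>g\<close>. Expansion along the first row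
  therefore shows that the determinant is affine in \<open>s\<close>, with that cofactor as the slope.\<close>
lemma det_restr_mat_rank_one:
  assumes "\<And>v. v \<in> set vs \<Longrightarrow> g \<bullet> v = 0"
  shows "restr_det (H + s *\<^sub>R outer g) (w # vs) =
    restr_det H (w # vs) + s * (g \<bullet> w)\<^sup>2 * restr_det H vs"
proof -
  let ?A = "restr_mat (H + s *\<^sub>R outer g) (w # vs)" and ?B = "restr_mat H (w # vs)"
  define n where "n = Suc (length vs)"
  have A: "?A \<in> carrier_mat n n" and B: "?B \<in> carrier_mat n n"
    using restr_mat_carrier[of _ "w # vs"] by (auto simp: n_def)
  have g0: "g \<bullet> vs ! i = 0" if "i < length vs" for i using assms that by auto
  have app: "(H + s *\<^sub>R outer g) *v x = H *v x + (s * (g \<bullet> x)) *\<^sub>R g" for x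
    by (simp add: matrix_vector_mult_add_rdistrib scaleR_matrix_vector_assoc[symmetric] outer_mult)
  have ent: "Matrix.index_mat ?A (i, j) = Matrix.index_mat ?B (i, j) + (if i = 0 \<and> j = 0 then s * (g \<bullet> w)\<^sup>2 else 0)"
    if "i < n" "j < n" for i j
    using that g0 unfolding restr_mat_def n_def app
    by (cases i; cases j) (auto simp: inner_right_distrib inner_commute power2_eq_square)
  have del: "mat_delete ?A 0 j = mat_delete ?B 0 j" if "j < n" for j
    unfolding mat_delete_def using A B ent that n_def by (intro Matrix.eq_matI) auto
  have cof: "cofactor ?A 0 j = cofactor ?B 0 j" if "j < n" for j
    using del[OF that] by (simp add: cofactor_def)
  have "mat_delete ?B 0 0 = restr_mat H vs"
    by (rule Matrix.eq_matI) (auto simp: mat_delete_def restr_mat_def)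
  then have c0: "cofactor ?B 0 0 = restr_det H vs" by (simp add: cofactor_def)
  have n0: "0 < n" by (simp add: n_def)
  have "Determinant.det ?A = (\<Sum>j<n. Matrix.index_mat ?A (0, j) * cofactor ?A 0 j)"
    by (rule laplace_expansion_row[OF A n0])
  also have "\<dots> = (\<Sum>j<n. Matrix.index_mat ?B (0, j) * cofactor ?B 0 j +
      (if j = 0 then s * (g \<bullet> w)\<^sup>2 * cofactor ?B 0 0 else 0))"
    by (intro sum.cong refl) (auto simp: ent cof n0 algebra_simps)
  also have "\<dots> = Determinant.det ?B + s * (g \<bullet> w)\<^sup>2 * cofactor ?B 0 0"
    using n0 by (simp add: sum.distrib laplace_expansion_row[OF B n0])
  finally show ?thesis using c0 by simp
qed

section \<open>Constant determinant sign and critical directions\<close>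

lemma ex_basis_of:
  fixes T :: "(real ^ 'n) set"
  assumes "subspace T" shows "\<exists>vs. basis_of vs T"
proof -
  obtain B where B: "B \<subseteq> T" "independent B" "span B = T"
    using basis_subspace_exists[OF assms] by metis
  obtain vs where "distinct vs" "set vs = B"
    using finite_distinct_list[OF independent_imp_finite[OF B(2)]] by auto
  then show ?thesis using B unfolding basis_of_def by blast
qed

text \<open>The sign of the determinant on \<open>T\<close>; by
  \<open>det_restr_mat_sgn_unique\<close> it is the same for every basis.\<close>
definition restr_det_sgn :: "real ^ 'n ^ 'n \<Rightarrow> (real ^ 'n) set \<Rightarrow> real" where
  "restr_det_sgn H T = sgn (restr_det H (SOME vs. basis_of vs T))"

lemma restr_det_sgn_basis:
  assumes "basis_of vs T" shows "sgn (restr_det H vs) = restr_det_sgn H T"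
  unfolding restr_det_sgn_def by (rule det_restr_mat_sgn_unique[OF assms someI[of "\<lambda>vs. basis_of vs T", OF assms]])

lemma restr_nonsingular_same_sign_iff:
  assumes "\<And>T. T \<in> TT \<Longrightarrow> subspace T"
  shows "restr_nonsingular_same_sign H TT \<longleftrightarrow> (\<exists>s. s \<noteq> 0 \<and> (\<forall>T\<in>TT. restr_det_sgn H T = s))"
    (is "?l \<longleftrightarrow> ?r")
proof
  assume ?l
  then obtain s where s: "\<And>T vs. T \<in> TT \<Longrightarrow> basis_of vs T \<Longrightarrow>
      restr_det H vs \<noteq> 0 \<and> sgn (restr_det H vs) = s"
    unfolding restr_nonsingular_same_sign_def invertible_mat_iff_det[OF restr_mat_carrier] by metis
  then have "restr_det_sgn H T = s \<and> s \<noteq> 0" if "T \<in> TT" for T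
    using ex_basis_of[OF assms[OF that]] that restr_det_sgn_basis[of _ T H] by (metis sgn_0_0)
  then show ?r by (metis zero_neq_one)
next
  assume ?r
  then obtain s where s: "s \<noteq> 0" "\<And>T. T \<in> TT \<Longrightarrow> restr_det_sgn H T = s" by auto
  then show ?l
    unfolding restr_nonsingular_same_sign_def invertible_mat_iff_det[OF restr_mat_carrier]
    using restr_det_sgn_basis[of _ _ H] sgn_0 by (metis (no_types, lifting))
qed

lemma restr_det_sgn_eq_0_iff:
  assumes "subspace T"
  shows "restr_det_sgn H T = 0 \<longleftrightarrow> (\<exists>\<xi>\<in>T. \<xi> \<noteq> 0 \<and> (\<forall>v\<in>T. v \<bullet> (H *v \<xi>) = 0))"
proof -
  obtain vs where "basis_of vs T" using ex_basis_of[OF assms] by auto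
  then show ?thesis
    using det_restr_mat_0_iff[of vs T H] sgn_0_0[of "restr_det H vs"]
    by (simp only: restr_det_sgn_basis)
qed

lemma indep_family_coeffs:
  assumes fin: "finite A" and inj: "inj_on G A" and ind: "independent (G ` A)"
    and 0: "(\<Sum>a\<in>A. \<nu> a *\<^sub>R G a) = (0 :: real ^ 'n)" and a: "a \<in> A"
  shows "\<nu> a = 0"
proof -
  have "(\<Sum>v\<in>G ` A. \<nu> (the_inv_into A G v) *\<^sub>R v) = 0"
    using 0 by (simp add: sum.reindex[OF inj] the_inv_into_f_f[OF inj])
  then have "\<nu> (the_inv_into A G (G a)) = 0"
    using ind a fin unfolding independent_explicit_finite_subsets
    by (meson finite_imageI imageI order_refl)
  then show ?thesis by (simp add: the_inv_into_f_f[OF inj a])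
qed

definition annihilator :: "('c \<Rightarrow> real ^ 'n) \<Rightarrow> 'c set \<Rightarrow> (real ^ 'n) set" where
  "annihilator G A = {\<xi>. \<forall>a\<in>A. G a \<bullet> \<xi> = 0}"

lemma subspace_annihilator: "subspace (annihilator G A)"
  unfolding subspace_def annihilator_def by (auto simp: inner_right_distrib)

text \<open>Duality: a vector orthogonal to the solution space of a linear system is a combination of its rows.
  This is how multipliers arise from orthogonality throughout.\<close>
lemma orthogonal_annihilator:
  assumes fin: "finite A" and inj: "inj_on G A" and w: "\<forall>v\<in>annihilator G A. v \<bullet> w = 0"
  shows "\<exists>\<nu>. w = (\<Sum>a\<in>A. \<nu> a *\<^sub>R G a)"
proof -
  have "annihilator G A = (span (G ` A))\<^sup>\<bottom>"
  proof -
    have "(\<forall>a\<in>A. G a \<bullet> \<xi> = 0) \<longleftrightarrow> (\<forall>y\<in>span (G ` A). y \<bullet> \<xi> = 0)" for \<xi>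
    proof
      assume *: "\<forall>a\<in>A. G a \<bullet> \<xi> = 0"
      show "\<forall>y\<in>span (G ` A). y \<bullet> \<xi> = 0"
      proof
        fix y assume "y \<in> span (G ` A)"
        then show "y \<bullet> \<xi> = 0"
          by (induction rule: span_induct_alt) (use * in \<open>auto simp: inner_left_distrib\<close>)
      qed
    qed (simp add: span_base)
    then show ?thesis by (simp add: annihilator_def orthogonal_comp_def real_inner_class.orthogonal_def)
  qed
  then have "w \<in> (span (G ` A))\<^sup>\<bottom>\<^sup>\<bottom>"
    using w by (simp add: orthogonal_comp_def[of "orthogonal_comp _"] real_inner_class.orthogonal_def)
  then have "w \<in> span (G ` A)" by (simp add: orthogonal_comp_self subspace_span)
  then obtain u where "w = (\<Sum>v\<in>G ` A. u v *\<^sub>R v)"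
    using span_finite[of "G ` A"] fin by auto
  then show ?thesis by (auto simp: sum.reindex[OF inj] intro!: exI[of _ "\<lambda>a. u (G a)"])
qed

text \<open>By independence, \<open>G j\<close> does not vanish on the annihilator of \<open>A\<close>, so adding the equation for \<open>j\<close> cuts
  out a hyperplane and a single vector completes a basis of it.\<close>
lemma annihilator_insert_basis:
  assumes fin: "finite A" and inj: "inj_on G (insert j A)" and ind: "independent (G ` insert j A)" and j: "j \<notin> A"
    and vs: "basis_of vs (annihilator G (insert j A))"
  obtains w where "G j \<bullet> w \<noteq> 0" "basis_of (w # vs) (annihilator G A)"
proof -
  have "\<exists>w\<in>annihilator G A. G j \<bullet> w \<noteq> 0"
  proof (rule ccontr)
    assume "\<not> ?thesis"
    then have "\<forall>v\<in>annihilator G A. v \<bullet> G j = 0" by (auto simp: inner_commute)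
    then obtain \<nu> where \<nu>: "G j = (\<Sum>a\<in>A. \<nu> a *\<^sub>R G a)"
      using orthogonal_annihilator[OF fin] inj by (metis inj_on_insert)
    have "(\<Sum>a\<in>insert j A. (if a = j then - 1 else \<nu> a) *\<^sub>R G a) = - G j + (\<Sum>a\<in>A. (if a = j then - 1 else \<nu> a) *\<^sub>R G a)"
      using fin j by simp
    also have "(\<Sum>a\<in>A. (if a = j then - 1 else \<nu> a) *\<^sub>R G a) = G j"
      unfolding \<nu> using j by (intro sum.cong) auto
    finally have "(\<Sum>a\<in>insert j A. (if a = j then - 1 else \<nu> a) *\<^sub>R G a) = 0" by simp
    from indep_family_coeffs[OF _ inj ind this, of j] fin show False by simp
  qed
  then obtain w where w: "w \<in> annihilator G A" "G j \<bullet> w \<noteq> 0" by auto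
  have sp: "span (set vs) = annihilator G (insert j A)" and i: "independent (set vs)" and d: "distinct vs"
    using vs by (auto simp: basis_of_def)
  have "w \<notin> span (set vs)" using w unfolding sp annihilator_def by auto
  then have "distinct (w # vs)" "independent (set (w # vs))"
    using d i span_base by (auto simp: independent_insert)
  moreover have "span (set (w # vs)) = annihilator G A"
  proof
    have "set vs \<subseteq> annihilator G (insert j A)" using sp span_superset by blast
    then have "set (w # vs) \<subseteq> annihilator G A" using w by (auto simp: annihilator_def)
    then show "span (set (w # vs)) \<subseteq> annihilator G A" by (rule span_minimal[OF _ subspace_annihilator])
    show "annihilator G A \<subseteq> span (set (w # vs))"
    proof
      fix v assume v: "v \<in> annihilator G A"
      have "v - (G j \<bullet> v / (G j \<bullet> w)) *\<^sub>R w \<in> annihilator G (insert j A)"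
        using v w by (auto simp: annihilator_def inner_diff_right)
      then show "v \<in> span (set (w # vs))" unfolding list.set span_insert sp by blast
    qed
  qed
  ultimately show thesis using w that by (simp add: basis_of_def)
qed

lemma det_rank_one_annihilator:
  assumes fin: "finite A" and inj: "inj_on G (insert j A)" and ind: "independent (G ` insert j A)" and j: "j \<notin> A"
  shows "\<exists>d d'. (\<forall>s. sgn (d + s * d') = restr_det_sgn (H + s *\<^sub>R outer (G j)) (annihilator G A)) \<and>
    sgn d' = restr_det_sgn H (annihilator G (insert j A))"
proof -
  obtain vs where vs: "basis_of vs (annihilator G (insert j A))"
    using ex_basis_of[OF subspace_annihilator] by blast
  obtain w where w: "G j \<bullet> w \<noteq> 0" "basis_of (w # vs) (annihilator G A)"
    by (rule annihilator_insert_basis[OF fin inj ind j vs])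
  have "set vs \<subseteq> annihilator G (insert j A)" using vs span_superset unfolding basis_of_def by blast
  then have 0: "v \<in> set vs \<Longrightarrow> G j \<bullet> v = 0" for v by (auto simp: annihilator_def)
  show ?thesis
  proof (intro exI conjI allI)
    show "sgn (restr_det H (w # vs) + s * ((G j \<bullet> w)\<^sup>2 * restr_det H vs))
       = restr_det_sgn (H + s *\<^sub>R outer (G j)) (annihilator G A)" for s
      using det_restr_mat_rank_one[of vs "G j" H s w] 0 restr_det_sgn_basis[OF w(2), of "H + s *\<^sub>R outer (G j)"]
      by (simp add: mult.assoc)
    show "sgn ((G j \<bullet> w)\<^sup>2 * restr_det H vs) = restr_det_sgn H (annihilator G (insert j A))"
    proof -
      have "(G j \<bullet> w)\<^sup>2 > 0" using w(1) by simp
      then have "sgn ((G j \<bullet> w)\<^sup>2) = 1" by (simp only: sgn_1_pos)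
      then show ?thesis by (simp only: sgn_mult restr_det_sgn_basis[OF vs] mult_1)
    qed
  qed
qed

lemma sgn_add_same:
  fixes a b s :: real
  assumes "sgn a = \<sigma>" "sgn b = \<sigma>" "s \<ge> 0" shows "sgn (a + s * b) = \<sigma>"
proof (cases "a = 0")
  case True
  then have "\<sigma> = 0" using assms(1) by simp
  then have "b = 0" using assms(2) by (simp only: sgn_0_0)
  then show ?thesis using True \<open>\<sigma> = 0\<close> by simp
next
  case False
  then consider "a > 0" "b > 0" | "a < 0" "b < 0" using assms by (metis linorder_neqE_linordered_idom sgn_0_0 sgn_less sgn_greater)
  then show ?thesis
  proof cases
    case 1 then have "a + s * b > 0" using assms(3) by (simp add: add_pos_nonneg)
    then show ?thesis using 1 assms by simp
  next
    case 2 then have "a + s * b < 0" using assms(3) by (simp add: add_neg_nonpos mult_nonneg_nonpos)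
    then show ?thesis using 2 assms by simp
  qed
qed

text \<open>Nonnegative multiples of \<open>G j G j\<^sup>T\<close> are added one at a time. Each step mixes the determinants on a
  space and on its hyperplane with nonnegative weights, so a common sign is preserved.\<close>
lemma restr_det_sgn_add_rank_ones:
  fixes G :: "'c \<Rightarrow> real ^ 'n"
  assumes fin: "finite (E \<union> U)" and inj: "inj_on G (E \<union> U)" and ind: "independent (G ` (E \<union> U))"
    and dj: "E \<inter> U = {}" and sgn: "\<And>X. X \<subseteq> U \<Longrightarrow> restr_det_sgn H (annihilator G (E \<union> X)) = \<sigma>"
    and s: "\<And>j. s j \<ge> 0" and S: "S \<subseteq> U" and X: "X \<subseteq> U - S"
  shows "restr_det_sgn (H + (\<Sum>j\<in>S. s j *\<^sub>R outer (G j))) (annihilator G (E \<union> X)) = \<sigma>"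
proof -
  have "finite S" using S fin by (auto intro: finite_subset)
  then show ?thesis using S X
  proof (induction S arbitrary: X)
    case empty then show ?case using sgn by simp
  next
    case (insert j S)
    let ?H = "H + (\<Sum>j\<in>S. s j *\<^sub>R outer (G j))"
    have sub: "insert j (E \<union> X) \<subseteq> E \<union> U" using insert.prems by auto
    have "\<exists>d d'. (\<forall>s. sgn (d + s * d') = restr_det_sgn (?H + s *\<^sub>R outer (G j)) (annihilator G (E \<union> X))) \<and>
        sgn d' = restr_det_sgn ?H (annihilator G (insert j (E \<union> X)))"
    proof (rule det_rank_one_annihilator)
      show "finite (E \<union> X)" using sub fin by (auto intro: finite_subset)
      show "inj_on G (insert j (E \<union> X))" by (rule inj_on_subset[OF inj sub])
      show "independent (G ` insert j (E \<union> X))" by (rule independent_mono[OF ind image_mono[OF sub]])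
      show "j \<notin> E \<union> X" using insert.prems dj by auto
    qed
    then obtain d d' where d: "\<And>s. sgn (d + s * d') = restr_det_sgn (?H + s *\<^sub>R outer (G j)) (annihilator G (E \<union> X))"
      and d': "sgn d' = restr_det_sgn ?H (annihilator G (insert j (E \<union> X)))" by blast
    have "sgn d = \<sigma>" using d[of 0] insert.IH[of X] insert.prems by auto
    moreover have "sgn d' = \<sigma>" using d' insert.IH[of "insert j X"] insert.prems insert.hyps by auto
    ultimately have "sgn (d + s j * d') = \<sigma>" using s by (rule sgn_add_same)
    moreover have "H + (\<Sum>j\<in>insert j S. s j *\<^sub>R outer (G j)) = ?H + s j *\<^sub>R outer (G j)"
      using insert.hyps by simp
    ultimately show ?case using d[of "s j"] by (simp only:)
  qed
qed

text \<open>\<open>E\<close> collects the constraints that behave as equations, \<open>U\<close> those for which multiplier and constraint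
  value are complementary. Along a segment between two points of the complementarity set
  \<open>{(\<mu>, s). \<mu> \<ge> 0, s \<ge> 0, \<mu> s = 0}\<close> the increments have a nonpositive product, which explains the
  sign condition on \<open>U\<close>.\<close>
definition no_critical_direction :: "real ^ 'n ^ 'n \<Rightarrow> ('c \<Rightarrow> real ^ 'n) \<Rightarrow> 'c set \<Rightarrow> 'c set \<Rightarrow> bool" where
  "no_critical_direction H G E U \<longleftrightarrow>
     (\<forall>\<xi> \<nu>. H *v \<xi> = (\<Sum>a\<in>E \<union> U. \<nu> a *\<^sub>R G a) \<longrightarrow> (\<forall>a\<in>E. G a \<bullet> \<xi> = 0) \<longrightarrow>
        (\<forall>a\<in>U. \<nu> a * (G a \<bullet> \<xi>) \<le> 0) \<longrightarrow> \<xi> = 0)"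

lemma sum_matrix_vector_mult:
  "(\<Sum>j\<in>S. f j) *v x = (\<Sum>j\<in>S. f j *v (x :: real ^ 'n))"
  by (induction S rule: infinite_finite_induct) (auto simp: matrix_vector_mult_add_rdistrib)

text \<open>For a critical direction \<open>\<xi>\<close> each increment can be absorbed into the matrix: where
  \<open>G j \<bullet> \<xi> \<noteq> 0\<close>, \<open>\<nu> j G j\<close> equals \<open>- s j (G j \<bullet> \<xi>) G j\<close> with \<open>s j \<ge> 0\<close>. So \<open>\<xi>\<close> lies in the kernel of
  a restricted form whose determinant keeps the common sign.\<close>
lemma no_critical_directionI:
  fixes G :: "'c \<Rightarrow> real ^ 'n"
  assumes fin: "finite (E \<union> U)" and inj: "inj_on G (E \<union> U)" and ind: "independent (G ` (E \<union> U))"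
    and dj: "E \<inter> U = {}" and \<sigma>: "\<sigma> \<noteq> 0"
    and sgn: "\<And>X. X \<subseteq> U \<Longrightarrow> restr_det_sgn H (annihilator G (E \<union> X)) = \<sigma>"
  shows "no_critical_direction H G E U"
  unfolding no_critical_direction_def
proof (intro allI impI, rule ccontr)
  fix \<xi> \<nu>
  assume H: "H *v \<xi> = (\<Sum>a\<in>E \<union> U. \<nu> a *\<^sub>R G a)" and E: "\<forall>a\<in>E. G a \<bullet> \<xi> = 0"
    and U: "\<forall>a\<in>U. \<nu> a * (G a \<bullet> \<xi>) \<le> 0" and nz: "\<xi> \<noteq> 0"
  define S where "S = {j\<in>U. G j \<bullet> \<xi> \<noteq> 0}"
  define s where "s j = (if j \<in> S then - \<nu> j / (G j \<bullet> \<xi>) else 0)" for j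
  let ?H = "H + (\<Sum>j\<in>S. s j *\<^sub>R outer (G j))"
  let ?T = "annihilator G (E \<union> (U - S))"
  have s: "s j \<ge> 0" for j
  proof (cases "j \<in> S")
    case True
    then have "\<nu> j * (G j \<bullet> \<xi>) \<le> 0" using U S_def by auto
    then show ?thesis using True by (auto simp: s_def divide_le_0_iff mult_le_0_iff)
  qed (simp add: s_def)
  have "S \<subseteq> U" by (auto simp: S_def)
  have nonsing: "restr_det_sgn ?H ?T = \<sigma>"
    by (rule restr_det_sgn_add_rank_ones[OF fin inj ind dj sgn s]) (auto simp: S_def)
  have \<xi>T: "\<xi> \<in> ?T" using E by (auto simp: annihilator_def S_def)
  have "v \<bullet> (?H *v \<xi>) = 0" if v: "v \<in> ?T" for v
  proof -
    have "?H *v \<xi> = (\<Sum>a\<in>E \<union> U. \<nu> a *\<^sub>R G a) + (\<Sum>j\<in>S. (s j * (G j \<bullet> \<xi>)) *\<^sub>R G j)"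
      by (simp add: matrix_vector_mult_add_rdistrib sum_matrix_vector_mult H
          scaleR_matrix_vector_assoc[symmetric] outer_mult)
    also have "(\<Sum>j\<in>S. (s j * (G j \<bullet> \<xi>)) *\<^sub>R G j) = - (\<Sum>j\<in>S. \<nu> j *\<^sub>R G j)"
      unfolding sum_negf[symmetric] by (intro sum.cong refl) (auto simp: s_def S_def)
    also have "(\<Sum>a\<in>E \<union> U. \<nu> a *\<^sub>R G a) = (\<Sum>a\<in>E \<union> (U - S). \<nu> a *\<^sub>R G a) + (\<Sum>j\<in>S. \<nu> j *\<^sub>R G j)"
    proof -
      have "E \<union> U = (E \<union> (U - S)) \<union> S" using \<open>S \<subseteq> U\<close> by auto
      moreover have "(E \<union> (U - S)) \<inter> S = {}" using dj \<open>S \<subseteq> U\<close> by auto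
      moreover have "finite (E \<union> (U - S))" "finite S" using fin \<open>S \<subseteq> U\<close> by (auto intro: finite_subset)
      ultimately show ?thesis by (simp only: sum.union_disjoint)
    qed
    finally have "?H *v \<xi> = (\<Sum>a\<in>E \<union> (U - S). \<nu> a *\<^sub>R G a)" by simp
    then show ?thesis using v by (simp add: inner_sum_right annihilator_def inner_commute)
  qed
  then have "restr_det_sgn ?H ?T = 0"
    using \<xi>T nz restr_det_sgn_eq_0_iff[OF subspace_annihilator] by blast
  then show False using nonsing \<sigma> by simp
qed

text \<open>A vanishing determinant gives a critical direction immediately. If two index sets that differ by \<open>j\<close> have
  opposite signs, the affine function of \<open>s\<close> from the rank-one identity vanishes for some \<open>s \<ge> 0\<close>, and the
  kernel vector is again critical. Hence the sign cannot change when indices are added one by one.\<close>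
lemma no_critical_directionD:
  fixes G :: "'c \<Rightarrow> real ^ 'n"
  assumes fin: "finite (E \<union> U)" and inj: "inj_on G (E \<union> U)" and ind: "independent (G ` (E \<union> U))"
    and dj: "E \<inter> U = {}" and ncd: "no_critical_direction H G E U"
  shows "\<exists>\<sigma>. \<sigma> \<noteq> 0 \<and> (\<forall>X\<subseteq>U. restr_det_sgn H (annihilator G (E \<union> X)) = \<sigma>)"
proof -
  have singular: False
    if X: "X \<subseteq> U" and sg: "restr_det_sgn (H + (\<Sum>j\<in>S. s j *\<^sub>R outer (G j))) (annihilator G (E \<union> X)) = 0"
      and s: "\<And>j. s j \<ge> 0" and S: "S \<subseteq> U - X" for X S s
  proof -
    let ?T = "annihilator G (E \<union> X)"
    obtain \<xi> where \<xi>: "\<xi> \<in> ?T" "\<xi> \<noteq> 0" "\<forall>v\<in>?T. v \<bullet> ((H + (\<Sum>j\<in>S. s j *\<^sub>R outer (G j))) *v \<xi>) = 0"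
      using sg restr_det_sgn_eq_0_iff[OF subspace_annihilator] by blast
    have EX: "E \<union> X \<subseteq> E \<union> U" using X by auto
    from orthogonal_annihilator[OF finite_subset[OF EX fin] inj_on_subset[OF inj EX] \<xi>(3)] obtain \<nu>
      where "(H + (\<Sum>j\<in>S. s j *\<^sub>R outer (G j))) *v \<xi> = (\<Sum>a\<in>E \<union> X. \<nu> a *\<^sub>R G a)" by auto
    then have 1: "H *v \<xi> = (\<Sum>a\<in>E \<union> X. \<nu> a *\<^sub>R G a) - (\<Sum>j\<in>S. (s j * (G j \<bullet> \<xi>)) *\<^sub>R G j)"
      by (simp add: matrix_vector_mult_add_rdistrib sum_matrix_vector_mult
          scaleR_matrix_vector_assoc[symmetric] outer_mult algebra_simps)
    define \<nu>' where "\<nu>' a = (if a \<in> E \<union> X then \<nu> a else if a \<in> S then - s a * (G a \<bullet> \<xi>) else 0)" for a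
    have "H *v \<xi> = (\<Sum>a\<in>E \<union> X. \<nu>' a *\<^sub>R G a) + (\<Sum>a\<in>S. \<nu>' a *\<^sub>R G a)"
      unfolding 1 diff_conv_add_uminus sum_negf[symmetric]
      using S dj by (intro arg_cong2[of _ _ _ _ "(+)"] sum.cong) (auto simp: \<nu>'_def)
    also have "\<dots> = (\<Sum>a\<in>E \<union> X \<union> S. \<nu>' a *\<^sub>R G a)"
      using S dj finite_subset[OF EX fin] finite_subset[OF S] fin by (intro sum.union_disjoint[symmetric]) auto
    also have "\<dots> = (\<Sum>a\<in>E \<union> U. \<nu>' a *\<^sub>R G a)"
      using fin X S by (intro sum.mono_neutral_left) (auto simp: \<nu>'_def)
    finally have "H *v \<xi> = (\<Sum>a\<in>E \<union> U. \<nu>' a *\<^sub>R G a)" .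
    moreover have "\<forall>a\<in>E. G a \<bullet> \<xi> = 0" using \<xi>(1) by (auto simp: annihilator_def)
    moreover have "\<forall>a\<in>U. \<nu>' a * (G a \<bullet> \<xi>) \<le> 0"
    proof
      fix a assume "a \<in> U"
      have "0 \<le> s a * (G a \<bullet> \<xi>)\<^sup>2" using s by simp
      then show "\<nu>' a * (G a \<bullet> \<xi>) \<le> 0"
        using \<xi>(1) by (auto simp: \<nu>'_def annihilator_def power2_eq_square mult.assoc)
    qed
    ultimately show False using ncd \<xi>(2) unfolding no_critical_direction_def by blast
  qed
  have nz: "restr_det_sgn H (annihilator G (E \<union> X)) \<noteq> 0" if "X \<subseteq> U" for X
    using singular[OF that, where S = "{}" and s = "\<lambda>_. 0"] by auto
  have step: "restr_det_sgn H (annihilator G (E \<union> X)) = restr_det_sgn H (annihilator G (E \<union> insert j X))"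
    if X: "insert j X \<subseteq> U" and j: "j \<notin> X" for X j
  proof (rule ccontr)
    assume ne: "\<not> ?thesis"
    have sub: "insert j (E \<union> X) \<subseteq> E \<union> U" using X by auto
    have "\<exists>d d'. (\<forall>s. sgn (d + s * d') = restr_det_sgn (H + s *\<^sub>R outer (G j)) (annihilator G (E \<union> X))) \<and>
        sgn d' = restr_det_sgn H (annihilator G (insert j (E \<union> X)))"
    proof (rule det_rank_one_annihilator)
      show "finite (E \<union> X)" using sub fin by (auto intro: finite_subset)
      show "inj_on G (insert j (E \<union> X))" by (rule inj_on_subset[OF inj sub])
      show "independent (G ` insert j (E \<union> X))" by (rule independent_mono[OF ind image_mono[OF sub]])
      show "j \<notin> E \<union> X" using X j dj by auto
    qed
    then obtain d d' where d: "\<And>s. sgn (d + s * d') = restr_det_sgn (H + s *\<^sub>R outer (G j)) (annihilator G (E \<union> X))"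
      and d': "sgn d' = restr_det_sgn H (annihilator G (insert j (E \<union> X)))" by blast
    have nz1: "d \<noteq> 0" using d[of 0] nz[of X] X by auto
    have nz2: "d' \<noteq> 0" using d' nz[of "insert j X"] X by auto
    have "sgn d \<noteq> sgn d'" using d[of 0] d' ne by simp
    then have s: "- d / d' \<ge> 0" using nz1 nz2 by (auto simp: sgn_if divide_le_0_iff split: if_splits)
    have "restr_det_sgn (H + (- d / d') *\<^sub>R outer (G j)) (annihilator G (E \<union> X)) = 0"
      using d[of "- d / d'"] nz2 by simp
    then have "restr_det_sgn (H + (\<Sum>a\<in>{j}. (- d / d') *\<^sub>R outer (G a))) (annihilator G (E \<union> X)) = 0" by simp
    from singular[OF _ this] show False using s X j by auto
  qed
  have "restr_det_sgn H (annihilator G (E \<union> X)) = restr_det_sgn H (annihilator G E)" if "X \<subseteq> U" for X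
  proof -
    have "finite X" using that fin by (auto intro: finite_subset)
    then show ?thesis using that
    proof (induction X)
      case (insert j X) then show ?case using step[of j X] by simp
    qed simp
  qed
  then show ?thesis using nz[of "{}"] by auto
qed

theorem restr_nonsingular_same_sign_iff_no_critical_direction:
  fixes G :: "'c \<Rightarrow> real ^ 'n"
  assumes fin: "finite (E \<union> U)" and inj: "inj_on G (E \<union> U)" and ind: "independent (G ` (E \<union> U))"
    and dj: "E \<inter> U = {}"
  shows "restr_nonsingular_same_sign H {annihilator G (E \<union> X) | X. X \<subseteq> U} \<longleftrightarrow> no_critical_direction H G E U"
proof -
  have "restr_nonsingular_same_sign H {annihilator G (E \<union> X) | X. X \<subseteq> U} \<longleftrightarrow>
    (\<exists>\<sigma>. \<sigma> \<noteq> 0 \<and> (\<forall>X\<subseteq>U. restr_det_sgn H (annihilator G (E \<union> X)) = \<sigma>))"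
    by (subst restr_nonsingular_same_sign_iff) (auto simp: subspace_annihilator)
  then show ?thesis
    using no_critical_directionI[OF fin inj ind dj, of _ H] no_critical_directionD[OF fin inj ind dj, of H] by blast
qed

section \<open>Perturbations of twice differentiable functions\<close>

lemma pd_eqI:
  assumes "(\<phi> has_derivative f') (at x)" shows "pd i \<phi> x = f' (axis i 1)"
  unfolding pd_def using frechet_derivative_at[OF assms] by simp

lemma has_derivative_grad:
  fixes \<phi> :: "real ^ 'n \<Rightarrow> real"
  assumes "\<phi> differentiable (at x)"
  shows "(\<phi> has_derivative (\<lambda>h. grad \<phi> x \<bullet> h)) (at x)"
proof -
  let ?D = "frechet_derivative \<phi> (at x)"
  have D: "(\<phi> has_derivative ?D) (at x)" using assms by (simp add: frechet_derivative_works)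
  have lin: "linear ?D" using D has_derivative_linear by blast
  have "?D h = grad \<phi> x \<bullet> h" for h
  proof -
    have "?D h = ?D (\<Sum>i\<in>UNIV. h $ i *\<^sub>R axis i 1)" using basis_expansion[of h] by (simp add: scalar_mult_eq_scaleR)
    also have "\<dots> = (\<Sum>i\<in>UNIV. h $ i * pd i \<phi> x)"
      by (simp add: linear_sum[OF lin] linear_scale[OF lin] pd_def)
    finally show ?thesis by (simp add: grad_def inner_vec_def mult.commute)
  qed
  then have "?D = (\<lambda>h. grad \<phi> x \<bullet> h)" by auto
  then show ?thesis using D by simp
qed

lemma pd_inner: "pd i \<phi> x = grad \<phi> x $ i"
  by (simp add: grad_def)

lemma
  assumes "C2 \<phi>"
  shows C2_differentiable: "\<phi> differentiable (at x)"
    and C2_pd_differentiable: "pd i \<phi> differentiable (at x)"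
    and C2_continuous_pd_pd: "continuous_on S (pd i (pd j \<phi>))"
  using assms continuous_on_subset unfolding C2_def by blast+

text \<open>The derivative of \<open>grad \<phi>\<close> at \<open>x\<close>.\<close>
definition jac :: "(real ^ 'n \<Rightarrow> real) \<Rightarrow> real ^ 'n \<Rightarrow> real ^ 'n ^ 'n" where
  "jac \<phi> x = Finite_Cartesian_Product.transpose (hess \<phi> x)"

lemma jac_component: "jac \<phi> x $ i $ j = pd j (pd i \<phi>) x"
  by (simp add: jac_def hess_def Finite_Cartesian_Product.transpose_def)

lemma has_derivative_grad_jac:
  assumes "C2 \<phi>"
  shows "(grad \<phi> has_derivative (\<lambda>h. jac \<phi> x *v h)) (at x)"
proof -
  have "((\<lambda>y. grad \<phi> y $ i) has_derivative (\<lambda>h. (jac \<phi> x *v h) $ i)) (at x)" for i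
  proof -
    have "(pd i \<phi> has_derivative (\<lambda>h. grad (pd i \<phi>) x \<bullet> h)) (at x)"
      using assms by (intro has_derivative_grad C2_pd_differentiable)
    then show ?thesis
      by (simp add: jac_component matrix_vector_mult_def grad_def inner_vec_def)
  qed
  then show ?thesis
    unfolding has_derivative_componentwise_within[of "grad \<phi>"]
    by (auto simp: Basis_vec_def inner_axis)
qed

text \<open>Recognizes a \<open>C\<^sup>2\<close> function, together with its first two derivatives, from coordinate-free
  derivatives.\<close>
lemma jac_eqI:
  assumes "\<And>x. (\<phi> has_derivative (\<lambda>h. G x \<bullet> h)) (at x)" and "\<And>x. (G has_derivative (\<lambda>h. M x *v h)) (at x)"
    and "continuous_on UNIV M"
  shows "C2 \<phi>" and "grad \<phi> = G" and "jac \<phi> x = M x"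
proof -
  have pd: "pd i \<phi> = (\<lambda>x. G x $ i)" for i
    by (rule ext) (simp add: pd_eqI[OF assms(1)] inner_axis)
  have d: "((\<lambda>x. G x $ i) has_derivative (\<lambda>h. (M x *v h) $ i)) (at x)" for i x
    using bounded_linear.has_derivative[OF bounded_linear_vec_nth assms(2)] .
  have pdpd: "pd j (pd i \<phi>) = (\<lambda>x. M x $ i $ j)" for i j
    by (rule ext) (simp add: pd pd_eqI[OF d] matrix_vector_mult_basis column_def)
  show "C2 \<phi>"
    unfolding C2_def pdpd
  proof (intro conjI allI)
    show "\<phi> differentiable (at x)" for x using assms(1) by (auto simp: differentiable_def)
    show "pd i \<phi> differentiable (at x)" for i x unfolding pd using d by (auto simp: differentiable_def)
    show "continuous_on UNIV (\<lambda>x. M x $ j $ i)" for i j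
      using assms(3) by (intro continuous_intros)
  qed
  show "grad \<phi> = G" by (rule ext) (simp add: grad_def pd)
  show "jac \<phi> x = M x" by (simp add: cart_eq_iff jac_component pdpd)
qed

lemma continuous_on_jac: "C2 \<phi> \<Longrightarrow> continuous_on S (jac \<phi>)"
  unfolding jac_def[abs_def] hess_def[abs_def] Finite_Cartesian_Product.transpose_def
  by (intro continuous_on_vec_lambda) (auto intro: C2_continuous_pd_pd)

lemma
  assumes f: "C2 f" and g: "C2 g"
  shows C2_add_cmult: "C2 (\<lambda>x. f x + s * g x)"
    and grad_add_cmult: "grad (\<lambda>x. f x + s * g x) x = grad f x + s *\<^sub>R grad g x"
    and jac_add_cmult: "jac (\<lambda>x. f x + s * g x) x = jac f x + s *\<^sub>R jac g x"
proof -
  have 1: "((\<lambda>x. f x + s * g x) has_derivative (\<lambda>h. (grad f x + s *\<^sub>R grad g x) \<bullet> h)) (at x)" for x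
    using C2_differentiable[OF f] C2_differentiable[OF g]
    by (auto intro!: derivative_eq_intros has_derivative_grad simp: inner_left_distrib)
  have 2: "((\<lambda>x. grad f x + s *\<^sub>R grad g x) has_derivative (\<lambda>h. (jac f x + s *\<^sub>R jac g x) *v h)) (at x)" for x
    by (auto intro!: derivative_eq_intros has_derivative_grad_jac f g
        simp: matrix_vector_mult_add_rdistrib scaleR_matrix_vector_assoc)
  have 3: "continuous_on UNIV (\<lambda>x. jac f x + s *\<^sub>R jac g x)"
    by (intro continuous_intros continuous_on_jac f g)
  note * = jac_eqI[OF 1 2 3]
  show "C2 (\<lambda>x. f x + s * g x)" "grad (\<lambda>x. f x + s * g x) x = grad f x + s *\<^sub>R grad g x"
    "jac (\<lambda>x. f x + s * g x) x = jac f x + s *\<^sub>R jac g x" using * by simp_all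
qed

lemma
  assumes f: "C2 f" and g: "C2 g"
  shows C2_diff: "C2 (\<lambda>x. f x - g x)" and grad_diff: "grad (\<lambda>x. f x - g x) x = grad f x - grad g x"
    and jac_diff: "jac (\<lambda>x. f x - g x) x = jac f x - jac g x"
  using C2_add_cmult[OF f g, of "-1"] grad_add_cmult[OF f g, of "-1"] jac_add_cmult[OF f g, of "-1"] by simp_all

lemma C2_jac_diff_sum:
  assumes fin: "finite A" and f: "C2 f" and g: "\<And>a. a \<in> A \<Longrightarrow> C2 (g a)"
  shows "C2 (\<lambda>x. f x - (\<Sum>a\<in>A. m a * g a x)) \<and>
    jac (\<lambda>x. f x - (\<Sum>a\<in>A. m a * g a x)) x = jac f x - (\<Sum>a\<in>A. m a *\<^sub>R jac (g a) x)"
  using fin g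
proof (induction A)
  case empty then show ?case using f by simp
next
  case (insert a A)
  let ?h = "\<lambda>x. f x - (\<Sum>a\<in>A. m a * g a x)"
  have h: "C2 ?h" "jac ?h x = jac f x - (\<Sum>a\<in>A. m a *\<^sub>R jac (g a) x)" using insert by auto
  have g: "C2 (g a)" using insert by auto
  have eq: "(\<lambda>x. f x - (\<Sum>a\<in>insert a A. m a * g a x)) = (\<lambda>x. ?h x + (- m a) * g a x)"
    using insert.hyps by (auto simp: algebra_simps)
  show ?case unfolding eq
    using C2_add_cmult[OF h(1) g, of "- m a"] jac_add_cmult[OF h(1) g, of "- m a" x] h(2) insert.hyps by simp
qed

definition C2_close :: "(real ^ 'n) set \<Rightarrow> real \<Rightarrow> (real ^ 'n \<Rightarrow> real) \<Rightarrow> (real ^ 'n \<Rightarrow> real) \<Rightarrow> bool" where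
  "C2_close B d \<phi> \<psi> \<longleftrightarrow> (\<forall>y\<in>B. \<bar>\<phi> y - \<psi> y\<bar> \<le> d \<and> (\<forall>i. \<bar>pd i \<phi> y - pd i \<psi> y\<bar> \<le> d) \<and>
     (\<forall>i j. \<bar>pd i (pd j \<phi>) y - pd i (pd j \<psi>) y\<bar> \<le> d))"

lemma C2_moduli_diff:
  assumes "C2 \<phi>" "C2 \<psi>"
  shows "(\<forall>u\<in>C2_moduli B (\<lambda>y. \<phi> y - \<psi> y). u \<le> d) \<longleftrightarrow> C2_close B d \<phi> \<psi>"
proof -
  have 1: "pd i (\<lambda>y. \<phi> y - \<psi> y) x = pd i \<phi> x - pd i \<psi> x" for i x
    using grad_diff[OF assms, of x] by (simp add: pd_inner)
  have 2: "pd i (pd j (\<lambda>y. \<phi> y - \<psi> y)) x = pd i (pd j \<phi>) x - pd i (pd j \<psi>) x" for i j x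
    using jac_diff[OF assms, of x] by (simp flip: jac_component)
  show ?thesis unfolding C2_moduli_def C2_close_def 1 2 by blast
qed

lemma bdd_above_C2_moduli:
  assumes \<phi>: "C2 (\<phi> :: real ^ 'n \<Rightarrow> real)" and B: "compact B" shows "bdd_above (C2_moduli B \<phi>)"
proof -
  have bdd: "bdd_above ((\<lambda>x. \<bar>f x\<bar>) ` B)" if "continuous_on B f" for f :: "real ^ 'n \<Rightarrow> real"
    using compact_continuous_image[OF continuous_on_rabs[OF that] B]
    by (simp add: compact_imp_bounded bounded_imp_bdd_above)
  have c0: "continuous_on B \<phi>" using C2_differentiable[OF \<phi>]
    by (meson continuous_at_imp_continuous_on differentiable_imp_continuous_within)
  have c1: "continuous_on B (pd i \<phi>)" for i using C2_pd_differentiable[OF \<phi>]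
    by (meson continuous_at_imp_continuous_on differentiable_imp_continuous_within)
  have "C2_moduli B \<phi> = (\<lambda>x. \<bar>\<phi> x\<bar>) ` B \<union> (\<Union>i. (\<lambda>x. \<bar>pd i \<phi> x\<bar>) ` B) \<union> (\<Union>i. \<Union>j. (\<lambda>x. \<bar>pd i (pd j \<phi>) x\<bar>) ` B)"
    unfolding C2_moduli_def by blast
  then show ?thesis
    using bdd[OF c0] bdd[OF c1] bdd[OF C2_continuous_pd_pd[OF \<phi>]] by (simp add: bdd_above_Un)
qed

text \<open>The first-order expansions of \<open>\<psi>\<close> and of its gradient use the derivatives of \<open>\<phi>\<close> at the centre and hold
  for arbitrary pairs of points. These expansions are what the expansiveness estimate requires of
  perturbed data.\<close>
definition C2_strictly_near :: "real ^ 'n \<Rightarrow> real \<Rightarrow> real \<Rightarrow> (real ^ 'n \<Rightarrow> real) \<Rightarrow> (real ^ 'n \<Rightarrow> real) \<Rightarrow> bool" where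
  "C2_strictly_near a \<rho> \<kappa> \<phi> \<psi> \<longleftrightarrow> (\<forall>x\<in>cball a \<rho>. \<forall>y\<in>cball a \<rho>.
     \<bar>\<psi> x - \<phi> a\<bar> \<le> \<kappa> \<and> norm (grad \<psi> x - grad \<phi> a) \<le> \<kappa> \<and>
     \<bar>\<psi> x - \<psi> y - grad \<phi> a \<bullet> (x - y)\<bar> \<le> \<kappa> * norm (x - y) \<and>
     norm (grad \<psi> x - grad \<psi> y - jac \<phi> a *v (x - y)) \<le> \<kappa> * norm (x - y))"

lemma norm_le_CARD:
  fixes v :: "real ^ 'n"
  assumes "\<And>i. \<bar>v $ i\<bar> \<le> B" shows "norm v \<le> real CARD('n) * B"
proof -
  have "norm v \<le> (\<Sum>i\<in>UNIV. \<bar>v $ i\<bar>)" by (rule norm_le_l1_cart)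
  also have "\<dots> \<le> (\<Sum>i\<in>(UNIV :: 'n set). B)" using assms by (intro sum_mono)
  finally show ?thesis by simp
qed

text \<open>By continuity of the second derivatives, those of \<open>\<psi>\<close> differ little from those of \<open>\<phi>\<close> at \<open>a\<close> on the
  whole ball; the mean value inequality on the convex ball does the rest. One number \<open>d\<close> bounds both the
  radius and the perturbation, so a single choice provides the radius and the tolerance.\<close>
lemma C2_close_imp_strictly_near:
  fixes \<phi> :: "real ^ 'n \<Rightarrow> real"
  assumes \<phi>: "C2 \<phi>" and \<kappa>: "\<kappa> > 0"
  shows "eventually (\<lambda>d. \<forall>\<rho> \<psi>. 0 < \<rho> \<and> \<rho> \<le> d \<and> C2 \<psi> \<and> C2_close (cball a \<rho>) d \<phi> \<psi> \<longrightarrow>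
     C2_strictly_near a \<rho> \<kappa> \<phi> \<psi>) (at_right 0)"
proof -
  define N where "N = real CARD('n)"
  have N: "N \<ge> 1" unfolding N_def by (simp add: Suc_leI)
  define e where "e = \<kappa> / (2 * N * N)"
  have e: "e > 0" using \<kappa> N by (simp add: e_def)
  have ev: "eventually (\<lambda>x. dist (\<phi> x) (\<phi> a) < e \<and> (\<forall>i. dist (pd i \<phi> x) (pd i \<phi> a) < e) \<and>
      (\<forall>i j. dist (pd i (pd j \<phi>) x) (pd i (pd j \<phi>) a) < e)) (nhds a)"
  proof (intro eventually_conj eventually_all_finite)
    have ev1: "eventually (\<lambda>x. dist (f x) (f a) < e) (nhds a)" if "isCont f a" for f :: "real ^ 'n \<Rightarrow> real"
      using that e unfolding continuous_at_eps_delta eventually_nhds_metric by blast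
    show "eventually (\<lambda>x. dist (\<phi> x) (\<phi> a) < e) (nhds a)"
      by (intro ev1 differentiable_imp_continuous_within C2_differentiable \<phi>)
    show "eventually (\<lambda>x. dist (pd i \<phi> x) (pd i \<phi> a) < e) (nhds a)" for i
      by (intro ev1 differentiable_imp_continuous_within C2_pd_differentiable \<phi>)
    show "eventually (\<lambda>x. dist (pd i (pd j \<phi>) x) (pd i (pd j \<phi>) a) < e) (nhds a)" for i j
      using C2_continuous_pd_pd[OF \<phi>, of UNIV i j] by (intro ev1) (simp add: continuous_on_eq_continuous_at)
  qed
  then obtain d0 where d0: "d0 > 0" and near: "\<And>x. dist x a < d0 \<Longrightarrow> dist (\<phi> x) (\<phi> a) < e"
    "\<And>x i. dist x a < d0 \<Longrightarrow> dist (pd i \<phi> x) (pd i \<phi> a) < e"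
    "\<And>x i j. dist x a < d0 \<Longrightarrow> dist (pd i (pd j \<phi>) x) (pd i (pd j \<phi>) a) < e"
    unfolding eventually_nhds_metric by blast
  have main: "C2_strictly_near a \<rho> \<kappa> \<phi> \<psi>"
    if d: "0 < d" "d < d0" "d < e" and \<rho>: "0 < \<rho>" "\<rho> \<le> d" and \<psi>: "C2 \<psi>"
      and close: "C2_close (cball a \<rho>) d \<phi> \<psi>" for d \<rho> \<psi>
  proof -
    have b0: "\<bar>\<psi> x - \<phi> a\<bar> \<le> 2 * e" and b1: "\<bar>pd i \<psi> x - pd i \<phi> a\<bar> \<le> 2 * e"
      and b2: "\<bar>pd i (pd j \<psi>) x - pd i (pd j \<phi>) a\<bar> \<le> 2 * e" if x: "x \<in> cball a \<rho>" for x i j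
    proof -
      have xa: "dist x a < d0" using x d \<rho> by (simp add: dist_commute)
      have "\<bar>\<phi> x - \<psi> x\<bar> \<le> d" "\<bar>pd i \<phi> x - pd i \<psi> x\<bar> \<le> d"
        "\<bar>pd i (pd j \<phi>) x - pd i (pd j \<psi>) x\<bar> \<le> d"
        using close x unfolding C2_close_def by blast+
      then show "\<bar>\<psi> x - \<phi> a\<bar> \<le> 2 * e" "\<bar>pd i \<psi> x - pd i \<phi> a\<bar> \<le> 2 * e"
        "\<bar>pd i (pd j \<psi>) x - pd i (pd j \<phi>) a\<bar> \<le> 2 * e"
        using near(1)[OF xa] near(2)[OF xa, of i] near(3)[OF xa, of i j] d
        unfolding dist_real_def by linarith+
    qed
    have Ne: "N * N * (2 * e) = \<kappa>" using N by (simp add: e_def field_simps)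
    have e\<kappa>: "N * (2 * e) \<le> \<kappa>" "2 * e \<le> \<kappa>"
    proof -
      show "N * (2 * e) \<le> \<kappa>" unfolding Ne[symmetric] using N e by (simp add: mult_right_mono)
      have "1 * (2 * e) \<le> N * (2 * e)" using N e by (intro mult_right_mono) auto
      then show "2 * e \<le> \<kappa>" using \<open>N * (2 * e) \<le> \<kappa>\<close> by simp
    qed
    have g: "norm (grad \<psi> x - grad \<phi> a) \<le> \<kappa>" if x: "x \<in> cball a \<rho>" for x
    proof -
      have "norm (grad \<psi> x - grad \<phi> a) \<le> N * (2 * e)" unfolding N_def
        by (rule norm_le_CARD) (use b1[OF x] in \<open>simp add: pd_inner\<close>)
      then show ?thesis using e\<kappa> by simp
    qed
    show ?thesis
      unfolding C2_strictly_near_def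
    proof (intro ballI conjI)
      fix x y assume x: "x \<in> cball a \<rho>" and y: "y \<in> cball a \<rho>"
      show "\<bar>\<psi> x - \<phi> a\<bar> \<le> \<kappa>" using b0[OF x] e\<kappa> by simp
      show "norm (grad \<psi> x - grad \<phi> a) \<le> \<kappa>" by (rule g[OF x])
      have "norm ((\<psi> x - grad \<phi> a \<bullet> x) - (\<psi> y - grad \<phi> a \<bullet> y)) \<le> \<kappa> * norm (x - y)"
      proof (rule differentiable_bound[OF convex_cball[of a \<rho>] _ _ x y])
        fix z assume z: "z \<in> cball a \<rho>"
        show "((\<lambda>x. \<psi> x - grad \<phi> a \<bullet> x) has_derivative (\<lambda>h. (grad \<psi> z - grad \<phi> a) \<bullet> h)) (at z within cball a \<rho>)"
          by (rule has_derivative_at_withinI)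
             (auto intro!: derivative_eq_intros has_derivative_grad C2_differentiable[OF \<psi>] simp: inner_diff_left)
        show "onorm ((\<bullet>) (grad \<psi> z - grad \<phi> a)) \<le> \<kappa>"
        proof (rule onorm_le)
          fix h
          have "norm ((grad \<psi> z - grad \<phi> a) \<bullet> h) \<le> norm (grad \<psi> z - grad \<phi> a) * norm h"
            using Cauchy_Schwarz_ineq2 by simp
          also have "\<dots> \<le> \<kappa> * norm h" using g[OF z] by (rule mult_right_mono) simp
          finally show "norm ((grad \<psi> z - grad \<phi> a) \<bullet> h) \<le> \<kappa> * norm h" .
        qed
      qed
      then show "\<bar>\<psi> x - \<psi> y - grad \<phi> a \<bullet> (x - y)\<bar> \<le> \<kappa> * norm (x - y)"
        by (simp add: inner_diff_right algebra_simps)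
      have "norm ((grad \<psi> x - jac \<phi> a *v x) - (grad \<psi> y - jac \<phi> a *v y)) \<le> \<kappa> * norm (x - y)"
      proof (rule differentiable_bound[OF convex_cball[of a \<rho>] _ _ x y])
        fix z assume z: "z \<in> cball a \<rho>"
        show "((\<lambda>x. grad \<psi> x - jac \<phi> a *v x) has_derivative (*v) (jac \<psi> z - jac \<phi> a)) (at z within cball a \<rho>)"
          by (rule has_derivative_at_withinI)
             (auto intro!: derivative_eq_intros has_derivative_grad_jac[OF \<psi>] matrix_vector_mul_bounded_linear
                bounded_linear_imp_has_derivative simp: matrix_vector_mult_diff_rdistrib)
        have "onorm ((*v) (jac \<psi> z - jac \<phi> a)) \<le> real CARD('n) * real CARD('n) * (2 * e)"
          by (rule onorm_le_matrix_component) (use b2[OF z] in \<open>simp add: jac_component\<close>)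
        then show "onorm ((*v) (jac \<psi> z - jac \<phi> a)) \<le> \<kappa>" using Ne by (simp add: N_def)
      qed
      then show "norm (grad \<psi> x - grad \<psi> y - jac \<phi> a *v (x - y)) \<le> \<kappa> * norm (x - y)"
        by (simp add: matrix_vector_mult_diff_distrib algebra_simps)
    qed
  qed
  have "eventually (\<lambda>d. d < min d0 e) (at_right 0)"
    unfolding eventually_at_right_field using d0 e by (intro exI[of _ "min d0 e"]) auto
  then have "eventually (\<lambda>d. 0 < d \<and> d < d0 \<and> d < e) (at_right 0)"
    using eventually_at_right_less[of "0::real"] by eventually_elim auto
  then show ?thesis by eventually_elim (use main in blast)
qed

lemma grad_C2_close:
  fixes \<phi> :: "real ^ 'n \<Rightarrow> real"
  assumes "C2_close B d \<phi> \<psi>" "y \<in> B" shows "norm (grad \<psi> y - grad \<phi> y) \<le> real CARD('n) * d"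
  by (rule norm_le_CARD) (use assms in \<open>auto simp: C2_close_def pd_inner abs_minus_commute\<close>)

section \<open>Active constraints and multipliers\<close>

definition active :: "('i, 'j, 'n::finite) mpsc \<Rightarrow> real ^ 'n \<Rightarrow> ('i, 'j) constr set" where
  "active P x = {c\<in>constrs P. constr_fun P c x = 0}"

lemma constrs_simps [simp]:
  "Eq i \<in> constrs P \<longleftrightarrow> i \<in> eq_idx P" "Ineq j \<in> constrs P \<longleftrightarrow> j \<in> ineq_idx P"
  "Sw1 m \<in> constrs P \<longleftrightarrow> m \<in> {1..nsw P}" "Sw2 m \<in> constrs P \<longleftrightarrow> m \<in> {1..nsw P}"
  unfolding constrs_def by auto

lemma finite_constrs: "finite (eq_idx P) \<Longrightarrow> finite (ineq_idx P) \<Longrightarrow> finite (constrs P)"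
  unfolding constrs_def by simp

lemma sum_constrs:
  assumes "finite (eq_idx P)" "finite (ineq_idx P)"
  shows "sum F (constrs P) = (\<Sum>i\<in>eq_idx P. F (Eq i)) + (\<Sum>j\<in>ineq_idx P. F (Ineq j)) +
    (\<Sum>m=1..nsw P. F (Sw1 m) + F (Sw2 m))"
proof -
  have 1: "sum F (constrs P) = sum F (Eq ` eq_idx P) + sum F (Ineq ` ineq_idx P) +
      sum F (Sw1 ` {1..nsw P}) + sum F (Sw2 ` {1..nsw P})"
    unfolding constrs_def using assms by (subst sum.union_disjoint; auto)+
  have "inj_on Eq (eq_idx P)" "inj_on Ineq (ineq_idx P)" "inj_on Sw1 {1..nsw P}" "inj_on Sw2 {1..nsw P}"
    by (auto simp: inj_on_def)
  from this[THEN sum.reindex, of F] show ?thesis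
    unfolding 1 sum.distrib by (simp only: o_def add.assoc)
qed

text \<open>At a feasible point the constraints that LICQ enumerates are exactly those with value 0.\<close>
lemma LICQ_active:
  assumes "x \<in> feasible P" and "LICQ P x"
  shows "inj_on (\<lambda>c. grad (constr_fun P c) x) (active P x)"
    and "independent ((\<lambda>c. grad (constr_fun P c) x) ` active P x)"
proof -
  have "Eq ` eq_idx P \<union> Sw1 ` alpha P x \<union> Sw2 ` gamma P x \<union> Ineq ` J0 P x \<union>
      Sw1 ` beta P x \<union> Sw2 ` beta P x = active P x"
    using assms(1) unfolding active_def constrs_def feasible_def alpha_def beta_def gamma_def J0_def by auto
  then show "inj_on (\<lambda>c. grad (constr_fun P c) x) (active P x)"
    and "independent ((\<lambda>c. grad (constr_fun P c) x) ` active P x)"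
    using assms(2) by (auto simp: LICQ_def Let_def)
qed

fun mult_of :: "('i \<Rightarrow> real) \<Rightarrow> ('j \<Rightarrow> real) \<Rightarrow> (nat \<Rightarrow> real) \<Rightarrow> (nat \<Rightarrow> real) \<Rightarrow> ('i, 'j) constr \<Rightarrow> real" where
  "mult_of lam mu sig1 sig2 (Eq i) = lam i"
| "mult_of lam mu sig1 sig2 (Ineq j) = mu j"
| "mult_of lam mu sig1 sig2 (Sw1 m) = sig1 m"
| "mult_of lam mu sig1 sig2 (Sw2 m) = sig2 m"

text \<open>W-stationarity in terms of a single multiplier function on all constraints. At feasible points the
  product condition holds trivially for equality constraints.\<close>
definition is_multiplier :: "('i, 'j, 'n::finite) mpsc \<Rightarrow> real ^ 'n \<Rightarrow> (('i, 'j) constr \<Rightarrow> real) \<Rightarrow> bool" where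
  "is_multiplier P x m \<longleftrightarrow>
     grad (obj P) x = (\<Sum>c\<in>constrs P. m c *\<^sub>R grad (constr_fun P c) x) \<and>
     (\<forall>c\<in>constrs P. m c * constr_fun P c x = 0) \<and> (\<forall>j\<in>ineq_idx P. m (Ineq j) \<ge> 0)"

lemma W_multipliers_iff:
  assumes fin: "finite (eq_idx P)" "finite (ineq_idx P)" and x: "x \<in> feasible P"
  shows "W_multipliers P x lam mu sig1 sig2 \<longleftrightarrow> is_multiplier P x (mult_of lam mu sig1 sig2)"
proof -
  have "(\<forall>c\<in>constrs P. mult_of lam mu sig1 sig2 c * constr_fun P c x = 0) \<longleftrightarrow>
    (\<forall>j\<in>ineq_idx P. mu j * ineqf P j x = 0) \<and>
    (\<forall>m\<in>{1..nsw P}. sig1 m * sw1 P m x = 0 \<and> sig2 m * sw2 P m x = 0)"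
    using x by (simp add: constrs_def feasible_def ball_Un) blast
  then show ?thesis
    unfolding W_multipliers_def is_multiplier_def sum_constrs[OF fin] by auto
qed

lemma W_stationary_iff:
  assumes fin: "finite (eq_idx P)" "finite (ineq_idx P)"
  shows "W_stationary P x \<longleftrightarrow> x \<in> feasible P \<and> (\<exists>m. is_multiplier P x m)"
proof -
  have "m = mult_of (\<lambda>i. m (Eq i)) (\<lambda>j. m (Ineq j)) (\<lambda>k. m (Sw1 k)) (\<lambda>k. m (Sw2 k))" for m :: "('i,'j) constr \<Rightarrow> real"
  proof
    show "m c = mult_of (\<lambda>i. m (Eq i)) (\<lambda>j. m (Ineq j)) (\<lambda>k. m (Sw1 k)) (\<lambda>k. m (Sw2 k)) c" for c
      by (cases c) auto
  qed
  then have "(\<exists>m. is_multiplier P x m) \<longleftrightarrow> (\<exists>l1 l2 l3 l4. is_multiplier P x (mult_of l1 l2 l3 l4))"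
    by metis
  then show ?thesis unfolding W_stationary_def using W_multipliers_iff[OF fin] by blast
qed

lemma is_multiplier_inactive:
  "is_multiplier P x m \<Longrightarrow> c \<in> constrs P \<Longrightarrow> c \<notin> active P x \<Longrightarrow> m c = 0"
  unfolding is_multiplier_def active_def by auto

lemma is_multiplier_sum_active:
  assumes fin: "finite (eq_idx P)" "finite (ineq_idx P)" and m: "is_multiplier P x m"
  shows "(\<Sum>c\<in>constrs P. m c *\<^sub>R f c) = (\<Sum>c\<in>active P x. m c *\<^sub>R (f c :: 'v :: real_vector))"
  by (rule sum.mono_neutral_right)
     (use finite_constrs[OF fin] is_multiplier_inactive[OF m] in \<open>auto simp: active_def\<close>)

lemma jac_Lagrangian:
  assumes fin: "finite (eq_idx P)" "finite (ineq_idx P)" and C2: "C2_data P"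
  shows "jac (Lagrangian P lam mu sig1 sig2) x =
    jac (obj P) x - (\<Sum>c\<in>constrs P. mult_of lam mu sig1 sig2 c *\<^sub>R jac (constr_fun P c) x)"
proof -
  have "Lagrangian P lam mu sig1 sig2 =
      (\<lambda>x. obj P x - (\<Sum>c\<in>constrs P. mult_of lam mu sig1 sig2 c * constr_fun P c x))"
    by (rule ext) (simp add: Lagrangian_def sum_constrs[OF fin] algebra_simps)
  then show ?thesis
    using C2_jac_diff_sum[OF finite_constrs[OF fin], of "obj P" "constr_fun P"] C2
    unfolding C2_data_def by simp
qed

lemma C2_norm_imp_close:
  assumes fin: "finite (eq_idx P)" "finite (ineq_idx P)" and P: "C2_data P" and Q: "C2_data Q"
    and PQ: "same_format P Q" and B: "compact B"
    and le: "C2_norm B (diff_components P Q) \<le> d"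
  shows "C2_close B d (obj P) (obj Q)"
    and "c \<in> constrs P \<Longrightarrow> C2_close B d (constr_fun P c) (constr_fun Q c)"
proof -
  have cQ: "constrs Q = constrs P" using PQ by (simp add: same_format_def constrs_def)
  have C2: "C2 (obj P)" "C2 (obj Q)" "\<And>c. c \<in> constrs P \<Longrightarrow> C2 (constr_fun P c)"
    "\<And>c. c \<in> constrs P \<Longrightarrow> C2 (constr_fun Q c)"
    using P Q cQ by (auto simp: C2_data_def)
  have C2': "C2 \<phi>" if "\<phi> \<in> diff_components P Q" for \<phi>
    using that C2 unfolding diff_components_def by (auto intro: C2_diff)
  have fin': "finite (diff_components P Q)"
    unfolding diff_components_def using finite_constrs[OF fin] by simp
  have bdd: "bdd_above (\<Union>\<phi>\<in>diff_components P Q. C2_moduli B \<phi>)"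
    using fin' bdd_above_C2_moduli[OF C2' B] by simp
  have u: "u \<le> d" if "\<phi> \<in> diff_components P Q" "u \<in> C2_moduli B \<phi>" for \<phi> u
    using cSup_upper[OF _ bdd, of u] that le unfolding C2_norm_def by (meson UN_I order_trans)
  show "C2_close B d (obj P) (obj Q)"
    using u[of "\<lambda>y. obj P y - obj Q y"] C2_moduli_diff[OF C2(1,2)] unfolding diff_components_def by blast
  show "C2_close B d (constr_fun P c) (constr_fun Q c)" if c: "c \<in> constrs P"
    using u[of "\<lambda>y. constr_fun P c y - constr_fun Q c y"] C2_moduli_diff[OF C2(3)[OF c] C2(4)[OF c]] c
    unfolding diff_components_def by blast
qed

lemma C2_close_imp_norm:
  assumes P: "C2_data P" and Q: "C2_data Q" and PQ: "same_format P Q" and B: "B \<noteq> {}"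
    and "C2_close B d (obj P) (obj Q)" "\<And>c. c \<in> constrs P \<Longrightarrow> C2_close B d (constr_fun P c) (constr_fun Q c)"
  shows "C2_norm B (diff_components P Q) \<le> d"
proof -
  have cQ: "constrs Q = constrs P" using PQ by (simp add: same_format_def constrs_def)
  have C2: "C2 (obj P)" "C2 (obj Q)" "\<And>c. c \<in> constrs P \<Longrightarrow> C2 (constr_fun P c)"
    "\<And>c. c \<in> constrs P \<Longrightarrow> C2 (constr_fun Q c)"
    using P Q cQ by (auto simp: C2_data_def)
  have "\<forall>u\<in>C2_moduli B \<phi>. u \<le> d" if "\<phi> \<in> diff_components P Q" for \<phi>
    using that assms(5,6) C2_moduli_diff[OF C2(1,2)] C2_moduli_diff[OF C2(3,4)]
    unfolding diff_components_def by blast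
  moreover have "(\<Union>\<phi>\<in>diff_components P Q. C2_moduli B \<phi>) \<noteq> {}"
    using B unfolding diff_components_def C2_moduli_def by blast
  ultimately show ?thesis unfolding C2_norm_def by (intro cSup_least) auto
qed

text \<open>The inequalities indexed by \<open>J\<^sub>0 - J\<^sub>+\<close>.\<close>
definition weakly_active :: "('i, 'j, 'n::finite) mpsc \<Rightarrow> real ^ 'n \<Rightarrow> (('i, 'j) constr \<Rightarrow> real) \<Rightarrow> ('i, 'j) constr set" where
  "weakly_active P x m = {c\<in>active P x. m c = 0} \<inter> range Ineq"

lemma tangent_space_annihilator:
  assumes "x \<in> feasible P" "is_multiplier P x (mult_of lam mu sig1 sig2)"
    and "J_plus P x mu \<subseteq> Js" "Js \<subseteq> J0 P x"
  shows "tangent_space P x Js = annihilator (\<lambda>c. grad (constr_fun P c) x)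
     ((active P x - weakly_active P x (mult_of lam mu sig1 sig2)) \<union> Ineq ` (Js - J_plus P x mu))"
proof -
  let ?m = "mult_of lam mu sig1 sig2"
  have mu: "\<And>j. j \<in> J0 P x \<Longrightarrow> mu j \<ge> 0" using assms(2) by (auto simp: is_multiplier_def J0_def)
  have eq: "(active P x - weakly_active P x ?m) \<union> Ineq ` (Js - J_plus P x mu) =
    Eq ` eq_idx P \<union> Ineq ` Js \<union> Sw1 ` (alpha P x \<union> beta P x) \<union> Sw2 ` (gamma P x \<union> beta P x)"
    (is "?L = ?R")
  proof (rule Set.set_eqI)
    fix c
    show "c \<in> ?L \<longleftrightarrow> c \<in> ?R"
    proof (cases c)
      case (Ineq j)
      have "j \<in> J0 P x \<and> mu j \<noteq> 0 \<longleftrightarrow> j \<in> J_plus P x mu"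
        using mu[of j] by (auto simp: J_plus_def)
      moreover have "Ineq j \<in> active P x \<longleftrightarrow> j \<in> J0 P x" by (auto simp: active_def J0_def)
      ultimately show ?thesis using Ineq assms(3,4) by (auto simp: weakly_active_def)
    qed (use assms(1) in \<open>auto simp: active_def weakly_active_def feasible_def alpha_def beta_def gamma_def\<close>)
  qed
  show ?thesis unfolding eq tangent_space_def annihilator_def by (auto simp: ball_Un)
qed

text \<open>The sets \<open>J\<^sub>*\<close> between \<open>J\<^sub>+\<close> and \<open>J\<^sub>0\<close> correspond to the sets of weakly active constraints that are
  added to the equations.\<close>
lemma tangent_spaces_annihilators:
  assumes "x \<in> feasible P" "is_multiplier P x (mult_of lam mu sig1 sig2)"
  shows "{tangent_space P x Js | Js. J_plus P x mu \<subseteq> Js \<and> Js \<subseteq> J0 P x} =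
    {annihilator (\<lambda>c. grad (constr_fun P c) x)
       ((active P x - weakly_active P x (mult_of lam mu sig1 sig2)) \<union> X) | X. X \<subseteq> weakly_active P x (mult_of lam mu sig1 sig2)}"
    (is "?L = ?R")
proof
  let ?m = "mult_of lam mu sig1 sig2"
  have deg: "weakly_active P x ?m = Ineq ` (J0 P x - J_plus P x mu)"
    using assms(2) by (auto simp: weakly_active_def active_def J0_def J_plus_def is_multiplier_def order.order_iff_strict)
  show "?L \<subseteq> ?R"
  proof
    fix T assume "T \<in> ?L"
    then obtain Js where Js: "J_plus P x mu \<subseteq> Js" "Js \<subseteq> J0 P x" "T = tangent_space P x Js" by auto
    moreover have "Ineq ` (Js - J_plus P x mu) \<subseteq> weakly_active P x ?m" using Js deg by auto
    ultimately show "T \<in> ?R" using tangent_space_annihilator[OF assms Js(1,2)] by blast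
  qed
  show "?R \<subseteq> ?L"
  proof
    fix T assume "T \<in> ?R"
    then obtain X where X: "X \<subseteq> weakly_active P x ?m"
      "T = annihilator (\<lambda>c. grad (constr_fun P c) x) ((active P x - weakly_active P x ?m) \<union> X)" by auto
    define Js where "Js = J_plus P x mu \<union> {j. Ineq j \<in> X}"
    have Js: "J_plus P x mu \<subseteq> Js" "Js \<subseteq> J0 P x" using X(1) deg by (auto simp: Js_def J_plus_def)
    have "Ineq ` (Js - J_plus P x mu) = X" using X(1) deg by (auto simp: Js_def)
    then show "T \<in> ?L" using tangent_space_annihilator[OF assms Js] X(2) Js by auto
  qed
qed

abbreviation Lagrangian_jac :: "('i, 'j, 'n::finite) mpsc \<Rightarrow> real ^ 'n \<Rightarrow> (('i, 'j) constr \<Rightarrow> real) \<Rightarrow> real ^ 'n ^ 'n" where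
  "Lagrangian_jac P x m \<equiv> jac (obj P) x - (\<Sum>c\<in>active P x. m c *\<^sub>R jac (constr_fun P c) x)"

lemma second_order_condition_iff:
  assumes fin: "finite (eq_idx P)" "finite (ineq_idx P)" and C2: "C2_data P" and x: "x \<in> feasible P"
    and licq: "LICQ P x" and m: "is_multiplier P x (mult_of lam mu sig1 sig2)"
  shows "restr_nonsingular_same_sign (hess (Lagrangian P lam mu sig1 sig2) x)
      {tangent_space P x Js | Js. J_plus P x mu \<subseteq> Js \<and> Js \<subseteq> J0 P x} \<longleftrightarrow>
    no_critical_direction
      (Lagrangian_jac P x (mult_of lam mu sig1 sig2))
      (\<lambda>c. grad (constr_fun P c) x)
      (active P x - weakly_active P x (mult_of lam mu sig1 sig2)) (weakly_active P x (mult_of lam mu sig1 sig2))"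
proof -
  let ?D = "weakly_active P x (mult_of lam mu sig1 sig2)" and ?A = "active P x"
  have A: "?A - ?D \<union> ?D = ?A" by (auto simp: weakly_active_def)
  have jac: "jac (Lagrangian P lam mu sig1 sig2) x =
    jac (obj P) x - (\<Sum>c\<in>active P x. mult_of lam mu sig1 sig2 c *\<^sub>R jac (constr_fun P c) x)"
    unfolding jac_Lagrangian[OF fin C2] is_multiplier_sum_active[OF fin m] ..
  have "finite ?A" using finite_constrs[OF fin] by (simp add: active_def)
  then show ?thesis
    unfolding tangent_spaces_annihilators[OF x m] restr_nonsingular_same_sign_transpose[symmetric, of "hess _ _"]
      jac_def[symmetric] jac
    by (intro restr_nonsingular_same_sign_iff_no_critical_direction)
       (use A LICQ_active[OF x licq] in auto)
qed

section \<open>Necessity: two stationary points of one perturbed program\<close>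

text \<open>The perturbations that prove instability: affine terms for the constraints and, for the objective, a
  linear form plus a product of two linear forms.\<close>
definition quad :: "real ^ 'n \<Rightarrow> real \<Rightarrow> real ^ 'n \<Rightarrow> real ^ 'n \<Rightarrow> real ^ 'n \<Rightarrow> real ^ 'n \<Rightarrow> real" where
  "quad a b \<theta> p q y = b + \<theta> \<bullet> (y - a) + (p \<bullet> (y - a)) * (q \<bullet> (y - a))"

lemma
  shows C2_quad: "C2 (quad a b \<theta> p q)"
    and grad_quad: "grad (quad a b \<theta> p q) y = \<theta> + (q \<bullet> (y - a)) *\<^sub>R p + (p \<bullet> (y - a)) *\<^sub>R q"
    and jac_quad: "jac (quad a b \<theta> p q) y = (\<chi> i j. p $ i * q $ j + q $ i * p $ j)"
proof -
  have 1: "(quad a b \<theta> p q has_derivative (\<lambda>h. (\<theta> + (q \<bullet> (y - a)) *\<^sub>R p + (p \<bullet> (y - a)) *\<^sub>R q) \<bullet> h)) (at y)" for y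
    unfolding quad_def[abs_def]
    by (auto intro!: derivative_eq_intros simp: inner_left_distrib algebra_simps)
  have M: "(q \<bullet> h) *\<^sub>R p + (p \<bullet> h) *\<^sub>R q = (\<chi> i j. p $ i * q $ j + q $ i * p $ j) *v h" for h
    by (simp add: cart_eq_iff matrix_vector_mult_def inner_vec_def
        sum_distrib_left sum.distrib algebra_simps)
  have 2: "((\<lambda>y. \<theta> + (q \<bullet> (y - a)) *\<^sub>R p + (p \<bullet> (y - a)) *\<^sub>R q) has_derivative
      (\<lambda>h. (\<chi> i j. p $ i * q $ j + q $ i * p $ j) *v h)) (at y)" for y
    unfolding M[symmetric] by (auto intro!: derivative_eq_intros)
  note * = jac_eqI[OF 1 2 continuous_on_const]
  show "C2 (quad a b \<theta> p q)" "grad (quad a b \<theta> p q) y = \<theta> + (q \<bullet> (y - a)) *\<^sub>R p + (p \<bullet> (y - a)) *\<^sub>R q"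
    "jac (quad a b \<theta> p q) y = (\<chi> i j. p $ i * q $ j + q $ i * p $ j)" using * by simp_all
qed

lemma C2_close_add_quad:
  assumes f: "C2 f" and r: "0 \<le> r"
  shows "C2_close (cball a r) (2 * (1 + r)\<^sup>2 * (\<bar>b\<bar> + norm \<theta> + norm p * norm q)) f (\<lambda>y. f y + quad a b \<theta> p q y)"
proof -
  let ?K = "2 * (1 + r)\<^sup>2"
  let ?s = "\<bar>b\<bar> + norm \<theta> + norm p * norm q"
  have K: "1 \<le> ?K" "r \<le> ?K" "r * r \<le> ?K" "2 * r \<le> ?K" "2 \<le> ?K"
    using r by (auto simp: power2_eq_square algebra_simps)
  have mono: "u * \<bar>b\<bar> + v * norm \<theta> + w * (norm p * norm q) \<le> ?K * ?s" if "u \<le> ?K" "v \<le> ?K" "w \<le> ?K" for u v w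
    unfolding distrib_left using that by (intro add_mono mult_right_mono) auto
  have g: "grad (\<lambda>y. f y + quad a b \<theta> p q y) y = grad f y + grad (quad a b \<theta> p q) y" for y
    using grad_add_cmult[OF f C2_quad, of 1] by simp
  have j: "jac (\<lambda>y. f y + quad a b \<theta> p q y) y = jac f y + jac (quad a b \<theta> p q) y" for y
    using jac_add_cmult[OF f C2_quad, of 1] by simp
  show ?thesis
    unfolding C2_close_def
  proof (intro ballI conjI allI)
    fix y assume "y \<in> cball a r"
    then have y: "norm (y - a) \<le> r" by (simp add: dist_norm norm_minus_commute)
    have in_le: "\<bar>v \<bullet> (y - a)\<bar> \<le> norm v * r" for v
      using order_trans[OF Cauchy_Schwarz_ineq2 mult_left_mono[OF y norm_ge_zero]] .
    have "\<bar>quad a b \<theta> p q y\<bar> \<le> \<bar>b\<bar> + \<bar>\<theta> \<bullet> (y - a)\<bar> + \<bar>p \<bullet> (y - a)\<bar> * \<bar>q \<bullet> (y - a)\<bar>"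
      unfolding quad_def abs_mult[symmetric] by linarith
    also have "\<dots> \<le> \<bar>b\<bar> + norm \<theta> * r + (norm p * r) * (norm q * r)"
      using r by (intro add_mono mult_mono in_le order_refl) auto
    also have "\<dots> = 1 * \<bar>b\<bar> + r * norm \<theta> + (r * r) * (norm p * norm q)" by (simp add: algebra_simps)
    also have "\<dots> \<le> ?K * ?s" by (intro mono K)
    finally show "\<bar>f y - (f y + quad a b \<theta> p q y)\<bar> \<le> ?K * ?s" by simp
    fix i
    have "\<bar>grad (quad a b \<theta> p q) y $ i\<bar> \<le> norm (grad (quad a b \<theta> p q) y)" by (rule component_le_norm_cart)
    also have "\<dots> \<le> norm \<theta> + \<bar>q \<bullet> (y - a)\<bar> * norm p + \<bar>p \<bullet> (y - a)\<bar> * norm q"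
      unfolding grad_quad by (intro norm_triangle_le add_mono norm_triangle_ineq) auto
    also have "\<dots> \<le> norm \<theta> + (norm q * r) * norm p + (norm p * r) * norm q"
      by (intro add_mono mult_right_mono in_le) auto
    also have "\<dots> = 0 * \<bar>b\<bar> + 1 * norm \<theta> + (2 * r) * (norm p * norm q)" by (simp add: algebra_simps)
    also have "\<dots> \<le> ?K * ?s" using K by (intro mono) auto
    finally show "\<bar>pd i f y - pd i (\<lambda>y. f y + quad a b \<theta> p q y) y\<bar> \<le> ?K * ?s"
      by (simp add: pd_inner g)
    fix j
    have "\<bar>p $ j * q $ i + q $ j * p $ i\<bar> \<le> \<bar>p $ j\<bar> * \<bar>q $ i\<bar> + \<bar>q $ j\<bar> * \<bar>p $ i\<bar>"
      unfolding abs_mult[symmetric] by linarith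
    also have "\<dots> \<le> norm p * norm q + norm q * norm p"
      by (intro add_mono mult_mono component_le_norm_cart) auto
    also have "\<dots> = 0 * \<bar>b\<bar> + 0 * norm \<theta> + 2 * (norm p * norm q)" by simp
    also have "\<dots> \<le> ?K * ?s" using K by (intro mono) auto
    finally show "\<bar>pd i (pd j f) y - pd i (pd j (\<lambda>y. f y + quad a b \<theta> p q y)) y\<bar> \<le> ?K * ?s"
      unfolding jac_component[symmetric] j by (simp add: jac_quad)
  qed
qed

lemma has_derivative_directional_limit:
  fixes f :: "'a :: real_normed_vector \<Rightarrow> 'b :: real_normed_vector"
  assumes f: "(f has_derivative f') (at x)"
  shows "((\<lambda>\<tau>. (1 / \<tau>) *\<^sub>R (f (x + \<tau> *\<^sub>R \<xi>) - f x)) \<longlongrightarrow> f' \<xi>) (at_right 0)"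
proof -
  have "((\<lambda>\<tau>. x + \<tau> *\<^sub>R \<xi>) has_derivative (\<lambda>h. h *\<^sub>R \<xi>)) (at 0)"
    by (auto intro!: derivative_eq_intros)
  from has_derivative_compose[OF this, of f f'] f
  have "((\<lambda>\<tau>. f (x + \<tau> *\<^sub>R \<xi>)) has_derivative (\<lambda>h. f' (h *\<^sub>R \<xi>))) (at 0)" by simp
  then have "((\<lambda>\<tau>. (f (x + \<tau> *\<^sub>R \<xi>) - f x - f' (\<tau> *\<^sub>R \<xi>)) /\<^sub>R norm \<tau>) \<longlongrightarrow> 0) (at 0)"
    by (simp add: has_derivative_at_within Lim_ident_at)
  then have "((\<lambda>\<tau>. (f (x + \<tau> *\<^sub>R \<xi>) - f x - f' (\<tau> *\<^sub>R \<xi>)) /\<^sub>R norm \<tau>) \<longlongrightarrow> 0) (at_right 0)"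
    by (rule filterlim_mono) (auto simp: at_le)
  then have "((\<lambda>\<tau>. (1 / \<tau>) *\<^sub>R (f (x + \<tau> *\<^sub>R \<xi>) - f x) - f' \<xi>) \<longlongrightarrow> 0) (at_right 0)"
  proof (rule Lim_transform_eventually)
    have sc: "f' (\<tau> *\<^sub>R \<xi>) = \<tau> *\<^sub>R f' \<xi>" for \<tau>
      using has_derivative_linear[OF f] by (rule linear_scale)
    show "\<forall>\<^sub>F \<tau> in at_right 0. (f (x + \<tau> *\<^sub>R \<xi>) - f x - f' (\<tau> *\<^sub>R \<xi>)) /\<^sub>R norm \<tau> =
        (1 / \<tau>) *\<^sub>R (f (x + \<tau> *\<^sub>R \<xi>) - f x) - f' \<xi>"
      using eventually_at_right_less[of "0::real"]
      by eventually_elim (simp add: sc scaleR_right_diff_distrib inverse_eq_divide)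
  qed
  then show ?thesis by (rule LIM_zero_cancel)
qed

definition perturb :: "('i, 'j, 'n::finite) mpsc \<Rightarrow> (real ^ 'n \<Rightarrow> real) \<Rightarrow> (('i, 'j) constr \<Rightarrow> real ^ 'n \<Rightarrow> real) \<Rightarrow> ('i, 'j, 'n) mpsc" where
  "perturb P p q = P\<lparr>obj := \<lambda>y. obj P y + p y, eqf := \<lambda>i y. eqf P i y + q (Eq i) y,
     ineqf := \<lambda>j y. ineqf P j y + q (Ineq j) y, sw1 := \<lambda>k y. sw1 P k y + q (Sw1 k) y,
     sw2 := \<lambda>k y. sw2 P k y + q (Sw2 k) y\<rparr>"

lemma perturb_simps [simp]:
  "obj (perturb P p q) = (\<lambda>y. obj P y + p y)"
  "constr_fun (perturb P p q) c = (\<lambda>y. constr_fun P c y + q c y)"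
  "constrs (perturb P p q) = constrs P"
  "same_format P (perturb P p q)"
  "eq_idx (perturb P p q) = eq_idx P" "ineq_idx (perturb P p q) = ineq_idx P" "nsw (perturb P p q) = nsw P"
  by (cases c; auto simp: perturb_def constrs_def same_format_def)+

lemma feasible_iff_constr_fun:
  "x \<in> feasible P \<longleftrightarrow> (\<forall>i\<in>eq_idx P. constr_fun P (Eq i) x = 0) \<and> (\<forall>j\<in>ineq_idx P. constr_fun P (Ineq j) x \<ge> 0) \<and>
     (\<forall>k\<in>{1..nsw P}. constr_fun P (Sw1 k) x * constr_fun P (Sw2 k) x = 0)"
  by (simp add: feasible_def)

text \<open>\<open>\<pi> b c\<close> and \<open>s b c\<close> prescribe, in units of \<open>\<tau>\<close>, the multiplier increment and the constraint value at
  the two points \<open>x\<close> (\<open>b = False\<close>) and \<open>x + \<tau> \<xi>\<close> (\<open>b = True\<close>). Their differences satisfy the linearized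
  stationarity equations, and the affine and quadratic corrections that make both points exactly
  stationary consist of shifts of order \<open>\<tau>\<close> and of terms that compensate for errors of order \<open>o(\<tau>)\<close>. So
  their coefficients tend to 0, the
  perturbed programs approach the given one, and two distinct stationary points remain in the ball.\<close>
lemma two_stationary_points_imp_not_strongly_stable:
  fixes P :: "('i, 'j, 'n::finite) mpsc" and \<pi> s :: "bool \<Rightarrow> ('i, 'j) constr \<Rightarrow> real"
  assumes fin: "finite (eq_idx P)" "finite (ineq_idx P)" and C2: "C2_data P" and x: "x \<in> feasible P"
    and m: "is_multiplier P x m" and \<xi>: "\<xi> \<noteq> 0"
    and H: "(Lagrangian_jac P x m) *v \<xi> =
      (\<Sum>c\<in>active P x. (\<pi> True c - \<pi> False c) *\<^sub>R grad (constr_fun P c) x)"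
    and s: "\<And>c. c \<in> active P x \<Longrightarrow> s True c - s False c = grad (constr_fun P c) x \<bullet> \<xi>"
    and compl: "\<And>c b. c \<in> active P x \<Longrightarrow> \<pi> b c * s b c = 0 \<and> m c * s b c = 0"
    and Eq: "\<And>i b. i \<in> eq_idx P \<Longrightarrow> s b (Eq i) = 0"
    and Ineq: "\<And>j b. Ineq j \<in> active P x \<Longrightarrow> s b (Ineq j) \<ge> 0 \<and> (m (Ineq j) > 0 \<or> \<pi> b (Ineq j) \<ge> 0)"
    and Sw: "\<And>k. k \<in> {1..nsw P} \<Longrightarrow> Sw1 k \<in> active P x \<and> (\<forall>b. s b (Sw1 k) = 0) \<or>
      Sw2 k \<in> active P x \<and> (\<forall>b. s b (Sw2 k) = 0)"
  shows "\<not> strongly_stable P x"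
proof
  assume "strongly_stable P x"
  then obtain r where r: "r > 0" and stab: "\<And>\<epsilon>. 0 < \<epsilon> \<Longrightarrow> \<epsilon> \<le> r \<Longrightarrow>
       (\<exists>\<delta>>0. \<forall>Q. same_format P Q \<and> C2_data Q \<and> C2_norm (cball x r) (diff_components P Q) \<le> \<delta> \<longrightarrow>
         (\<exists>x'\<in>cball x \<epsilon>. W_stationary Q x' \<and> (\<forall>y\<in>cball x r. W_stationary Q y \<longrightarrow> y = x')))"
    unfolding strongly_stable_def by blast
  obtain \<delta> where \<delta>: "\<delta> > 0" and uniq: "\<And>Q. same_format P Q \<Longrightarrow> C2_data Q \<Longrightarrow>
      C2_norm (cball x r) (diff_components P Q) \<le> \<delta> \<Longrightarrow>
      (\<exists>x'\<in>cball x r. W_stationary Q x' \<and> (\<forall>y\<in>cball x r. W_stationary Q y \<longrightarrow> y = x'))"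
    using stab[OF r order_refl] by blast
  let ?A = "active P x"
  define A where "A = ?A"
  have finA: "finite A" using finite_constrs[OF fin] by (simp add: A_def active_def)
  have A_constrs: "A \<subseteq> constrs P" and A0: "\<And>c. c \<in> A \<Longrightarrow> constr_fun P c x = 0"
    by (auto simp: A_def active_def)
  have C2c: "C2 (constr_fun P c)" if "c \<in> constrs P" for c using C2 that by (simp add: C2_data_def)
  have C2o: "C2 (obj P)" using C2 by (simp add: C2_data_def)
  define N where "N = \<xi> \<bullet> \<xi>"
  have N: "N > 0" using \<xi> by (simp add: N_def)
  define G where "G c y = grad (constr_fun P c) y" for c y
  define pt where "pt b \<tau> = x + (if b then \<tau> else 0) *\<^sub>R \<xi>" for b :: bool and \<tau> :: real
  have pt_simps: "pt False \<tau> = x" "pt True \<tau> = x + \<tau> *\<^sub>R \<xi>" for \<tau> by (simp_all add: pt_def)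
  \<comment> \<open>The corrections are multiples of \<open>\<xi>\<close>, the least gradients that adjust the values at \<open>x + \<tau> \<xi>\<close>.\<close>
  define \<theta> where "\<theta> \<tau> c = ((s True c - s False c -
      (1 / \<tau>) *\<^sub>R (constr_fun P c (x + \<tau> *\<^sub>R \<xi>) - constr_fun P c x)) / N) *\<^sub>R \<xi>" for \<tau> c
  define mm where "mm b \<tau> c = (if c \<in> A then m c + \<tau> * \<pi> b c else 0)" for b \<tau> c
  define lin where "lin \<tau> = (\<Sum>c\<in>A. (m c + \<tau> * \<pi> False c) *\<^sub>R (G c x + \<theta> \<tau> c)) - grad (obj P) x" for \<tau>
  define d where "d \<tau> = (1 / \<tau>) *\<^sub>R ((\<Sum>c\<in>A. (m c + \<tau> * \<pi> True c) *\<^sub>R (G c (x + \<tau> *\<^sub>R \<xi>) + \<theta> \<tau> c)) -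
      grad (obj P) (x + \<tau> *\<^sub>R \<xi>) - lin \<tau>)" for \<tau>
  \<comment> \<open>The symmetric form with matrix \<open>(e \<xi>\<^sup>T + \<xi> e\<^sup>T) / N\<close> maps \<open>\<xi>\<close> to \<open>d \<tau>\<close>.\<close>
  define e where "e \<tau> = d \<tau> - ((d \<tau> \<bullet> \<xi>) / (2 * N)) *\<^sub>R \<xi>" for \<tau>
  define pq where "pq \<tau> c = quad x (if c \<in> A then \<tau> * s False c else 0) (if c \<in> A then \<theta> \<tau> c else 0) 0 0" for \<tau> c
  define po where "po \<tau> = quad x 0 (lin \<tau>) (e \<tau>) ((1 / N) *\<^sub>R \<xi>)" for \<tau>
  define Q where "Q \<tau> = perturb P (po \<tau>) (pq \<tau>)" for \<tau>

  have \<theta>_lim: "((\<lambda>\<tau>. \<theta> \<tau> c) \<longlongrightarrow> 0) (at_right 0)" if c: "c \<in> A" for c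
  proof -
    have "((\<lambda>\<tau>. (1 / \<tau>) *\<^sub>R (constr_fun P c (x + \<tau> *\<^sub>R \<xi>) - constr_fun P c x)) \<longlongrightarrow> G c x \<bullet> \<xi>) (at_right 0)"
      unfolding G_def using c A_constrs
      by (intro has_derivative_directional_limit has_derivative_grad C2_differentiable C2c) auto
    then have "((\<lambda>\<tau>. \<theta> \<tau> c) \<longlongrightarrow> ((s True c - s False c - G c x \<bullet> \<xi>) / N) *\<^sub>R \<xi>) (at_right 0)"
      unfolding \<theta>_def using N by (intro tendsto_intros) auto
    then show ?thesis using s[of c] c by (simp add: A_def G_def)
  qed
  have id_lim: "((\<lambda>\<tau>::real. \<tau>) \<longlongrightarrow> 0) (at_right 0)" by (rule tendsto_ident_at)
  have pt_lim: "((\<lambda>\<tau>. f (x + \<tau> *\<^sub>R \<xi>)) \<longlongrightarrow> f x) (at_right 0)" if "isCont f x" for f :: "real ^ 'n \<Rightarrow> 'z::topological_space"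
  proof -
    have "((\<lambda>\<tau>. x + \<tau> *\<^sub>R \<xi>) \<longlongrightarrow> x + 0 *\<^sub>R \<xi>) (at_right 0)" by (intro tendsto_intros id_lim)
    then show ?thesis using isCont_tendsto_compose[OF that] by simp
  qed
  have G_cont: "isCont (G c) x" if "c \<in> A" for c
    unfolding G_def[abs_def] using has_derivative_grad_jac[OF C2c, of c x] that A_constrs
    by (auto intro: has_derivative_continuous)
  have KKT: "grad (obj P) x = (\<Sum>c\<in>A. m c *\<^sub>R G c x)"
    using m is_multiplier_sum_active[OF fin m] by (simp add: is_multiplier_def A_def G_def)
  have lin_lim: "(lin \<longlongrightarrow> 0) (at_right 0)"
  proof -
    have "(lin \<longlongrightarrow> (\<Sum>c\<in>A. (m c + 0 * \<pi> False c) *\<^sub>R (G c x + 0)) - grad (obj P) x) (at_right 0)"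
      unfolding lin_def[abs_def] by (intro tendsto_intros \<theta>_lim id_lim)
    then show ?thesis by (simp add: KKT)
  qed
  have d_lim: "(d \<longlongrightarrow> 0) (at_right 0)"
  proof -
    have d_eq: "d \<tau> = (\<Sum>c\<in>A. m c *\<^sub>R ((1 / \<tau>) *\<^sub>R (G c (x + \<tau> *\<^sub>R \<xi>) - G c x))) -
        (1 / \<tau>) *\<^sub>R (grad (obj P) (x + \<tau> *\<^sub>R \<xi>) - grad (obj P) x) +
        ((\<Sum>c\<in>A. \<pi> True c *\<^sub>R (G c (x + \<tau> *\<^sub>R \<xi>) + \<theta> \<tau> c)) - (\<Sum>c\<in>A. \<pi> False c *\<^sub>R (G c x + \<theta> \<tau> c)))"
      if "\<tau> > 0" for \<tau>
    proof -
      have "(\<Sum>c\<in>A. (m c + \<tau> * \<pi> True c) *\<^sub>R (G c (x + \<tau> *\<^sub>R \<xi>) + \<theta> \<tau> c)) -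
          (\<Sum>c\<in>A. (m c + \<tau> * \<pi> False c) *\<^sub>R (G c x + \<theta> \<tau> c)) =
        (\<Sum>c\<in>A. m c *\<^sub>R (G c (x + \<tau> *\<^sub>R \<xi>) - G c x)) + \<tau> *\<^sub>R
        ((\<Sum>c\<in>A. \<pi> True c *\<^sub>R (G c (x + \<tau> *\<^sub>R \<xi>) + \<theta> \<tau> c)) - (\<Sum>c\<in>A. \<pi> False c *\<^sub>R (G c x + \<theta> \<tau> c)))"
        unfolding sum_subtractf[symmetric] scaleR_sum_right sum.distrib[symmetric]
        by (intro sum.cong refl) (simp add: algebra_simps)
      note key = this
      have regroup: "a - o1 - (b - o2) = S - (o1 - o2)" if "a - b = S" for a b o1 o2 S :: "real ^ 'n"
        unfolding that[symmetric] by simp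
      have "d \<tau> = (1 / \<tau>) *\<^sub>R ((\<Sum>c\<in>A. m c *\<^sub>R (G c (x + \<tau> *\<^sub>R \<xi>) - G c x)) + \<tau> *\<^sub>R
        ((\<Sum>c\<in>A. \<pi> True c *\<^sub>R (G c (x + \<tau> *\<^sub>R \<xi>) + \<theta> \<tau> c)) - (\<Sum>c\<in>A. \<pi> False c *\<^sub>R (G c x + \<theta> \<tau> c)))
         - (grad (obj P) (x + \<tau> *\<^sub>R \<xi>) - grad (obj P) x))"
        unfolding d_def lin_def by (subst regroup[OF key]) (rule refl)
      also have "\<dots> = (1 / \<tau>) *\<^sub>R (\<Sum>c\<in>A. m c *\<^sub>R (G c (x + \<tau> *\<^sub>R \<xi>) - G c x)) -
        (1 / \<tau>) *\<^sub>R (grad (obj P) (x + \<tau> *\<^sub>R \<xi>) - grad (obj P) x) +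
        ((\<Sum>c\<in>A. \<pi> True c *\<^sub>R (G c (x + \<tau> *\<^sub>R \<xi>) + \<theta> \<tau> c)) - (\<Sum>c\<in>A. \<pi> False c *\<^sub>R (G c x + \<theta> \<tau> c)))"
        using that by (simp add: scaleR_add_right scaleR_diff_right)
      finally show ?thesis by (simp add: scaleR_sum_right mult.commute)
    qed
    have "((\<lambda>\<tau>. (\<Sum>c\<in>A. m c *\<^sub>R ((1 / \<tau>) *\<^sub>R (G c (x + \<tau> *\<^sub>R \<xi>) - G c x))) -
        (1 / \<tau>) *\<^sub>R (grad (obj P) (x + \<tau> *\<^sub>R \<xi>) - grad (obj P) x) +
        ((\<Sum>c\<in>A. \<pi> True c *\<^sub>R (G c (x + \<tau> *\<^sub>R \<xi>) + \<theta> \<tau> c)) - (\<Sum>c\<in>A. \<pi> False c *\<^sub>R (G c x + \<theta> \<tau> c))))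
      \<longlongrightarrow> (\<Sum>c\<in>A. m c *\<^sub>R (jac (constr_fun P c) x *v \<xi>)) - jac (obj P) x *v \<xi> +
        ((\<Sum>c\<in>A. \<pi> True c *\<^sub>R (G c x + 0)) - (\<Sum>c\<in>A. \<pi> False c *\<^sub>R (G c x + 0)))) (at_right 0)"
    proof (intro tendsto_add tendsto_diff tendsto_sum tendsto_scaleR tendsto_const \<theta>_lim pt_lim G_cont)
      show "((\<lambda>\<tau>. (1 / \<tau>) *\<^sub>R (G c (x + \<tau> *\<^sub>R \<xi>) - G c x)) \<longlongrightarrow> jac (constr_fun P c) x *v \<xi>) (at_right 0)"
        if "c \<in> A" for c
        unfolding G_def using that A_constrs
        by (intro has_derivative_directional_limit has_derivative_grad_jac C2c) auto
      show "((\<lambda>\<tau>. (1 / \<tau>) *\<^sub>R (grad (obj P) (x + \<tau> *\<^sub>R \<xi>) - grad (obj P) x)) \<longlongrightarrow> jac (obj P) x *v \<xi>) (at_right 0)"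
        by (intro has_derivative_directional_limit has_derivative_grad_jac C2o)
    qed
    moreover have "(\<Sum>c\<in>A. m c *\<^sub>R (jac (constr_fun P c) x *v \<xi>)) - jac (obj P) x *v \<xi> +
        ((\<Sum>c\<in>A. \<pi> True c *\<^sub>R (G c x + 0)) - (\<Sum>c\<in>A. \<pi> False c *\<^sub>R (G c x + 0))) = 0"
      using H by (simp add: A_def[symmetric] G_def matrix_vector_mult_diff_rdistrib sum_matrix_vector_mult
          scaleR_matrix_vector_assoc[symmetric] scaleR_left_diff_distrib sum_subtractf algebra_simps)
    moreover have "\<forall>\<^sub>F \<tau> in at_right 0. (\<Sum>c\<in>A. m c *\<^sub>R ((1 / \<tau>) *\<^sub>R (G c (x + \<tau> *\<^sub>R \<xi>) - G c x))) -
        (1 / \<tau>) *\<^sub>R (grad (obj P) (x + \<tau> *\<^sub>R \<xi>) - grad (obj P) x) +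
        ((\<Sum>c\<in>A. \<pi> True c *\<^sub>R (G c (x + \<tau> *\<^sub>R \<xi>) + \<theta> \<tau> c)) - (\<Sum>c\<in>A. \<pi> False c *\<^sub>R (G c x + \<theta> \<tau> c))) = d \<tau>"
      using eventually_at_right_less[of "0::real"] by eventually_elim (simp only: d_eq)
    ultimately show ?thesis using Lim_transform_eventually by force
  qed
  have e_lim: "(e \<longlongrightarrow> 0) (at_right 0)"
  proof -
    have "(e \<longlongrightarrow> 0 - ((0 \<bullet> \<xi>) / (2 * N)) *\<^sub>R \<xi>) (at_right 0)"
      unfolding e_def[abs_def] using N by (intro tendsto_intros d_lim) auto
    then show ?thesis by simp
  qed

  have ev_close_o: "\<forall>\<^sub>F \<tau> in at_right 0. 2 * (1 + r)\<^sup>2 * (\<bar>0\<bar> + norm (lin \<tau>) + norm (e \<tau>) * norm ((1 / N) *\<^sub>R \<xi>)) < \<delta>"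
  proof -
    have "((\<lambda>\<tau>. 2 * (1 + r)\<^sup>2 * (\<bar>0\<bar> + norm (lin \<tau>) + norm (e \<tau>) * norm ((1 / N) *\<^sub>R \<xi>))) \<longlongrightarrow>
       2 * (1 + r)\<^sup>2 * (\<bar>0\<bar> + norm (0::real^'n) + norm (0::real^'n) * norm ((1 / N) *\<^sub>R \<xi>))) (at_right 0)"
      by (intro tendsto_intros lin_lim e_lim)
    from order_tendstoD(2)[OF this, of \<delta>] \<delta> show ?thesis by simp
  qed
  have ev_close_c: "\<forall>\<^sub>F \<tau> in at_right 0. \<forall>c\<in>A. 2 * (1 + r)\<^sup>2 * (\<bar>\<tau> * s False c\<bar> + norm (\<theta> \<tau> c) + norm (0::real^'n) * norm (0::real^'n)) < \<delta>"
  proof (intro eventually_ball_finite finA ballI)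
    fix c assume c: "c \<in> A"
    have "((\<lambda>\<tau>. 2 * (1 + r)\<^sup>2 * (\<bar>\<tau> * s False c\<bar> + norm (\<theta> \<tau> c) + norm (0::real^'n) * norm (0::real^'n))) \<longlongrightarrow>
      2 * (1 + r)\<^sup>2 * (\<bar>0 * s False c\<bar> + norm (0::real^'n) + norm (0::real^'n) * norm (0::real^'n))) (at_right 0)"
      by (intro tendsto_intros \<theta>_lim c id_lim)
    from order_tendstoD(2)[OF this, of \<delta>] \<delta>
    show "\<forall>\<^sub>F \<tau> in at_right 0. 2 * (1 + r)\<^sup>2 * (\<bar>\<tau> * s False c\<bar> + norm (\<theta> \<tau> c) + norm (0::real^'n) * norm (0::real^'n)) < \<delta>" by simp
  qed
  have ev_ineq: "\<forall>\<^sub>F \<tau> in at_right 0. \<forall>j\<in>ineq_idx P. Ineq j \<notin> A \<longrightarrow> (\<forall>b. constr_fun P (Ineq j) (pt b \<tau>) > 0)"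
  proof (intro eventually_ball_finite fin ballI)
    fix j assume j: "j \<in> ineq_idx P"
    show "\<forall>\<^sub>F \<tau> in at_right 0. Ineq j \<notin> A \<longrightarrow> (\<forall>b. constr_fun P (Ineq j) (pt b \<tau>) > 0)"
    proof (cases "Ineq j \<in> A")
      case False
      then have pos: "constr_fun P (Ineq j) x > 0"
        using x j unfolding feasible_iff_constr_fun A_def active_def by force
      have "isCont (constr_fun P (Ineq j)) x"
        using C2_differentiable[OF C2c[of "Ineq j"], of x] j
        by (intro differentiable_imp_continuous_within) simp
      from order_tendstoD(1)[OF pt_lim[OF this] pos] show ?thesis
        by eventually_elim (use pos in \<open>auto simp: pt_def\<close>)
    qed simp
  qed
  have ev_mult: "\<forall>\<^sub>F \<tau> in at_right 0. \<forall>j\<in>ineq_idx P. Ineq j \<in> A \<longrightarrow> (\<forall>b. m (Ineq j) + \<tau> * \<pi> b (Ineq j) \<ge> 0)"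
  proof (intro eventually_ball_finite fin ballI)
    fix j assume j: "j \<in> ineq_idx P"
    show "\<forall>\<^sub>F \<tau> in at_right 0. Ineq j \<in> A \<longrightarrow> (\<forall>b. m (Ineq j) + \<tau> * \<pi> b (Ineq j) \<ge> 0)"
    proof (cases "Ineq j \<in> A")
      case True
      have m0: "m (Ineq j) \<ge> 0" using m j by (simp add: is_multiplier_def)
      have "\<forall>\<^sub>F \<tau> in at_right 0. \<forall>b. m (Ineq j) + \<tau> * \<pi> b (Ineq j) \<ge> 0"
      proof (rule eventually_all_finite)
        fix b :: bool
        show "\<forall>\<^sub>F \<tau> in at_right 0. m (Ineq j) + \<tau> * \<pi> b (Ineq j) \<ge> 0"
        proof (cases "m (Ineq j) > 0")
          case pos: True
          have "((\<lambda>\<tau>. m (Ineq j) + \<tau> * \<pi> b (Ineq j)) \<longlongrightarrow> m (Ineq j) + 0 * \<pi> b (Ineq j)) (at_right 0)"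
            by (intro tendsto_intros id_lim)
          from order_tendstoD(1)[OF this, of 0] pos show ?thesis
            by (auto elim!: eventually_mono)
        next
          case False
          then have "\<pi> b (Ineq j) \<ge> 0" using Ineq[of j b] True by (auto simp: A_def)
          then show ?thesis using eventually_at_right_less[of "0::real"]
            by (auto elim!: eventually_mono simp: m0)
        qed
      qed
      then show ?thesis by (rule eventually_mono) blast
    qed simp
  qed
  have ev_r: "\<forall>\<^sub>F \<tau> in at_right 0. norm (\<tau> *\<^sub>R \<xi>) < r"
  proof -
    have "((\<lambda>\<tau>. norm (\<tau> *\<^sub>R \<xi>)) \<longlongrightarrow> norm (0 *\<^sub>R \<xi>)) (at_right 0)" by (intro tendsto_intros id_lim)
    from order_tendstoD(2)[OF this, of r] r show ?thesis by simp
  qed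
  have "\<forall>\<^sub>F \<tau>::real in at_right 0. 0 < \<tau>" by (rule eventually_at_right_less)
  from eventually_conj[OF ev_close_o eventually_conj[OF ev_close_c eventually_conj[OF ev_ineq
      eventually_conj[OF ev_mult eventually_conj[OF ev_r this]]]]]
  obtain \<tau> where close_o: "2 * (1 + r)\<^sup>2 * (\<bar>0\<bar> + norm (lin \<tau>) + norm (e \<tau>) * norm ((1 / N) *\<^sub>R \<xi>)) < \<delta>"
    and close_c: "\<And>c. c \<in> A \<Longrightarrow> 2 * (1 + r)\<^sup>2 * (\<bar>\<tau> * s False c\<bar> + norm (\<theta> \<tau> c) + norm (0::real^'n) * norm (0::real^'n)) < \<delta>"
    and ineq_pos: "\<And>j b. j \<in> ineq_idx P \<Longrightarrow> Ineq j \<notin> A \<Longrightarrow> constr_fun P (Ineq j) (pt b \<tau>) > 0"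
    and mult_pos: "\<And>j b. j \<in> ineq_idx P \<Longrightarrow> Ineq j \<in> A \<Longrightarrow> m (Ineq j) + \<tau> * \<pi> b (Ineq j) \<ge> 0"
    and \<tau>r: "norm (\<tau> *\<^sub>R \<xi>) < r" and \<tau>: "\<tau> > 0"
    using eventually_happens'[OF trivial_limit_at_right_real] by (smt (verit, best))

  have C2Q: "C2_data (Q \<tau>)"
    using C2_add_cmult[OF C2o C2_quad, of 1] C2_add_cmult[OF C2c C2_quad, of _ 1]
    by (simp add: C2_data_def Q_def po_def pq_def)
  have close: "C2_norm (cball x r) (diff_components P (Q \<tau>)) \<le> \<delta>"
  proof (rule C2_close_imp_norm[OF C2 C2Q])
    have mono: "C2_close B d1 f g \<Longrightarrow> d1 < \<delta> \<Longrightarrow> C2_close B \<delta> f g" for B d1 and f g :: "real ^ 'n \<Rightarrow> real"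
      unfolding C2_close_def by (meson order_trans less_imp_le)
    show "C2_close (cball x r) \<delta> (obj P) (obj (Q \<tau>))"
      unfolding Q_def perturb_simps po_def
      by (rule mono[OF C2_close_add_quad[OF C2o less_imp_le[OF r]] close_o])
    fix c assume c: "c \<in> constrs P"
    show "C2_close (cball x r) \<delta> (constr_fun P c) (constr_fun (Q \<tau>) c)"
      unfolding Q_def perturb_simps pq_def
      by (rule mono[OF C2_close_add_quad[OF C2c[OF c] less_imp_le[OF r]]]) (use close_c[of c] \<delta> in auto)
  qed (use r in \<open>auto simp: Q_def\<close>)

  have val: "constr_fun (Q \<tau>) c (pt b \<tau>) = \<tau> * s b c" if c: "c \<in> A" for c b
  proof -
    have "\<theta> \<tau> c \<bullet> (\<tau> *\<^sub>R \<xi>) = \<tau> * (s True c - s False c) - constr_fun P c (x + \<tau> *\<^sub>R \<xi>)"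
      using \<tau> N A0[OF c] by (simp add: \<theta>_def N_def[symmetric] field_simps)
    then show ?thesis
      using c A0[OF c] by (cases b) (simp_all add: Q_def pq_def quad_def pt_def algebra_simps)
  qed
  have val_inactive: "constr_fun (Q \<tau>) c y = constr_fun P c y" if c: "c \<notin> A" for c y
    using c by (simp add: Q_def pq_def quad_def)
  have gradQ: "grad (constr_fun (Q \<tau>) c) y = G c y + \<theta> \<tau> c" if c: "c \<in> A" for c y
    using grad_add_cmult[OF C2c C2_quad, of c 1] c A_constrs by (auto simp: Q_def pq_def grad_quad G_def)
  have gradQo: "grad (obj (Q \<tau>)) (pt b \<tau>) = (\<Sum>c\<in>A. (m c + \<tau> * \<pi> b c) *\<^sub>R (G c (pt b \<tau>) + \<theta> \<tau> c))" for b
  proof -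
    have g: "grad (obj (Q \<tau>)) y = grad (obj P) y + grad (po \<tau>) y" for y
      using grad_add_cmult[OF C2o C2_quad, of 1] by (simp add: Q_def po_def)
    have "grad (po \<tau>) (x + \<tau> *\<^sub>R \<xi>) = lin \<tau> + \<tau> *\<^sub>R d \<tau>"
      using N by (simp add: po_def grad_quad e_def inner_diff_left N_def[symmetric] algebra_simps)
    moreover have "grad (po \<tau>) x = lin \<tau>" by (simp add: po_def grad_quad)
    ultimately show ?thesis
      unfolding g using \<tau> by (cases b) (simp_all add: pt_simps, simp_all add: d_def lin_def)
  qed
  have stat: "W_stationary (Q \<tau>) (pt b \<tau>)" for b
  proof -
    have Q_idx: "eq_idx (Q \<tau>) = eq_idx P" "ineq_idx (Q \<tau>) = ineq_idx P" "nsw (Q \<tau>) = nsw P"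
      "constrs (Q \<tau>) = constrs P" by (simp_all add: Q_def)
    have feas: "pt b \<tau> \<in> feasible (Q \<tau>)"
      unfolding feasible_iff_constr_fun Q_idx
    proof (intro conjI ballI)
      fix i assume "i \<in> eq_idx P"
      then have "Eq i \<in> A" using x by (auto simp: A_def active_def feasible_def)
      then show "constr_fun (Q \<tau>) (Eq i) (pt b \<tau>) = 0" using val Eq[OF \<open>i \<in> eq_idx P\<close>] by (simp del: constr_fun.simps)
    next
      fix j assume "j \<in> ineq_idx P"
      then show "0 \<le> constr_fun (Q \<tau>) (Ineq j) (pt b \<tau>)"
        using val[of "Ineq j" b] val_inactive[of "Ineq j"] Ineq[of j b] ineq_pos[of j b] \<tau>
        by (cases "Ineq j \<in> A") (auto simp: A_def[symmetric] less_imp_le simp del: constr_fun.simps)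
    next
      fix k assume "k \<in> {1..nsw P}"
      then show "constr_fun (Q \<tau>) (Sw1 k) (pt b \<tau>) * constr_fun (Q \<tau>) (Sw2 k) (pt b \<tau>) = 0"
        using Sw[of k] val[of "Sw1 k" b] val[of "Sw2 k" b] by (auto simp: A_def[symmetric] simp del: constr_fun.simps)
    qed
    have "is_multiplier (Q \<tau>) (pt b \<tau>) (mm b \<tau>)"
      unfolding is_multiplier_def Q_idx
    proof (intro conjI ballI)
      have "(\<Sum>c\<in>constrs P. mm b \<tau> c *\<^sub>R grad (constr_fun (Q \<tau>) c) (pt b \<tau>)) =
          (\<Sum>c\<in>A. mm b \<tau> c *\<^sub>R grad (constr_fun (Q \<tau>) c) (pt b \<tau>))"
        using finite_constrs[OF fin] A_constrs by (intro sum.mono_neutral_right) (auto simp: mm_def)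
      also have "\<dots> = (\<Sum>c\<in>A. (m c + \<tau> * \<pi> b c) *\<^sub>R (G c (pt b \<tau>) + \<theta> \<tau> c))"
        by (intro sum.cong refl) (simp add: gradQ mm_def)
      finally show "grad (obj (Q \<tau>)) (pt b \<tau>) =
        (\<Sum>c\<in>constrs P. mm b \<tau> c *\<^sub>R grad (constr_fun (Q \<tau>) c) (pt b \<tau>))" using gradQo by simp
      show "mm b \<tau> c * constr_fun (Q \<tau>) c (pt b \<tau>) = 0" for c
        using val[of c b] compl[of c b] by (cases "c \<in> A") (auto simp: mm_def A_def[symmetric])
      show "mm b \<tau> (Ineq j) \<ge> 0" if "j \<in> ineq_idx P" for j
        using mult_pos[of j b] that by (simp add: mm_def)
    qed
    then show ?thesis using feas W_stationary_iff[of "Q \<tau>"] fin Q_idx by auto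
  qed
  have "pt b \<tau> \<in> cball x r" for b
    using \<tau>r r by (auto simp: pt_def dist_norm)
  then have "pt True \<tau> = pt False \<tau>"
    using uniq[OF _ C2Q close] stat by (metis Q_def perturb_simps(4))
  then show False using \<tau> \<xi> by (simp add: pt_def)
qed

text \<open>Without the equation for \<open>c0\<close> there is one unknown more than there are equations. The direction comes
  from the determinant of \<open>H + s g g\<^sup>T\<close>, with \<open>g = G c0\<close>, on the larger space: this is affine in \<open>s\<close> and
  has a root unless its slope is 0, and in that case the form is already singular on the smaller space.\<close>
lemma ex_free_critical_direction:
  fixes G :: "'c \<Rightarrow> real ^ 'n"
  assumes fin: "finite A" and inj: "inj_on G A" and ind: "independent (G ` A)" and c0: "c0 \<in> A"
  shows "\<exists>\<xi> \<nu>. \<xi> \<noteq> 0 \<and> H *v \<xi> = (\<Sum>c\<in>A. \<nu> c *\<^sub>R G c) \<and> (\<forall>c\<in>A - {c0}. G c \<bullet> \<xi> = 0)"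
proof -
  define B where "B = A - {c0}"
  have A: "A = insert c0 B" "c0 \<notin> B" using c0 by (auto simp: B_def)
  have finB: "finite B" and injB: "inj_on G B" using fin inj by (auto simp: B_def inj_on_def)
  obtain d d' where d: "\<And>s. sgn (d + s * d') = restr_det_sgn (H + s *\<^sub>R outer (G c0)) (annihilator G B)"
    and d': "sgn d' = restr_det_sgn H (annihilator G A)"
    using det_rank_one_annihilator[OF finB, of G c0 H] inj ind unfolding A(1) using A(2) by blast
  show ?thesis
  proof (cases "d' = 0")
    case True
    then have "restr_det_sgn H (annihilator G A) = 0" using d' by simp
    then obtain \<xi> where \<xi>: "\<xi> \<in> annihilator G A" "\<xi> \<noteq> 0" "\<forall>v\<in>annihilator G A. v \<bullet> (H *v \<xi>) = 0"
      using restr_det_sgn_eq_0_iff[OF subspace_annihilator] by blast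
    then show ?thesis using orthogonal_annihilator[OF fin inj \<xi>(3)] by (auto simp: annihilator_def)
  next
    case False
    define s where "s = - d / d'"
    have "restr_det_sgn (H + s *\<^sub>R outer (G c0)) (annihilator G B) = 0"
      using d[of s] False by (simp add: s_def)
    then obtain \<xi> where \<xi>: "\<xi> \<in> annihilator G B" "\<xi> \<noteq> 0" "\<forall>v\<in>annihilator G B. v \<bullet> ((H + s *\<^sub>R outer (G c0)) *v \<xi>) = 0"
      using restr_det_sgn_eq_0_iff[OF subspace_annihilator] by blast
    from orthogonal_annihilator[OF finB injB \<xi>(3)]
    obtain \<nu> where \<nu>: "(H + s *\<^sub>R outer (G c0)) *v \<xi> = (\<Sum>c\<in>B. \<nu> c *\<^sub>R G c)" by auto
    define \<nu>' where "\<nu>' = \<nu>(c0 := - s * (G c0 \<bullet> \<xi>))"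
    have "H *v \<xi> = (\<Sum>c\<in>B. \<nu> c *\<^sub>R G c) - (s * (G c0 \<bullet> \<xi>)) *\<^sub>R G c0"
      using \<nu> by (simp add: matrix_vector_mult_add_rdistrib scaleR_matrix_vector_assoc[symmetric] outer_mult algebra_simps)
    also have "(\<Sum>c\<in>B. \<nu> c *\<^sub>R G c) = (\<Sum>c\<in>B. \<nu>' c *\<^sub>R G c)"
      using A(2) by (intro sum.cong refl) (auto simp: \<nu>'_def)
    also have "\<dots> - (s * (G c0 \<bullet> \<xi>)) *\<^sub>R G c0 = (\<Sum>c\<in>A. \<nu>' c *\<^sub>R G c)"
      unfolding A(1) using finB A(2) by (simp add: \<nu>'_def)
    finally show ?thesis using \<xi> unfolding B_def annihilator_def by blast
  qed
qed

text \<open>\<open>F\<close> is a set of switching constraints with zero multiplier whose partner is active as well. For these an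
  arbitrary pair of increments \<open>(\<nu>, \<kappa>)\<close> is the difference of the points \<open>(0, - \<kappa>)\<close> and \<open>(\<nu>, 0)\<close> of the
  cross of pairs with product 0. For weakly active inequalities the sign condition makes the negative parts
  \<open>(\<nu>\<^sup>-, \<kappa>\<^sup>-)\<close> and the positive parts \<open>(\<nu>\<^sup>+, \<kappa>\<^sup>+)\<close> complementary.\<close>
lemma critical_direction_imp_not_strongly_stable:
  fixes P :: "('i, 'j, 'n::finite) mpsc"
  assumes fin: "finite (eq_idx P)" "finite (ineq_idx P)" and C2: "C2_data P" and x: "x \<in> feasible P"
    and m: "is_multiplier P x m" and \<xi>: "\<xi> \<noteq> 0"
    and H: "(Lagrangian_jac P x m) *v \<xi> =
      (\<Sum>c\<in>active P x. \<nu> c *\<^sub>R grad (constr_fun P c) x)"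
    and D: "\<And>c. c \<in> weakly_active P x m \<Longrightarrow> \<nu> c * (grad (constr_fun P c) x \<bullet> \<xi>) \<le> 0"
    and E: "\<And>c. c \<in> active P x - weakly_active P x m - F \<Longrightarrow> grad (constr_fun P c) x \<bullet> \<xi> = 0"
    and F: "\<And>c. c \<in> F \<Longrightarrow> m c = 0 \<and> c \<notin> range Eq \<and> c \<notin> range Ineq"
    and Sw: "\<And>k. k \<in> {1..nsw P} \<Longrightarrow> Sw1 k \<in> active P x - F \<or> Sw2 k \<in> active P x - F"
  shows "\<not> strongly_stable P x"
proof -
  define \<kappa> where "\<kappa> c = grad (constr_fun P c) x \<bullet> \<xi>" for c
  define \<pi> where "\<pi> b c = (if c \<in> F then if b then \<nu> c else 0 else if b then max (\<nu> c) 0 else max (- \<nu> c) 0)" for b :: bool and c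
  define s where "s b c = (if c \<in> F then if b then 0 else - \<kappa> c else if c \<in> weakly_active P x m then
      if b then max (\<kappa> c) 0 else max (- \<kappa> c) 0 else 0)" for b :: bool and c
  have DF: "c \<notin> F" if "c \<in> weakly_active P x m" for c using that F by (auto simp: weakly_active_def)
  show ?thesis
  proof (rule two_stationary_points_imp_not_strongly_stable[OF fin C2 x m \<xi>, of \<pi> s])
    have "\<pi> True c - \<pi> False c = \<nu> c" for c by (auto simp: \<pi>_def max_def)
    then show "(Lagrangian_jac P x m) *v \<xi> =
      (\<Sum>c\<in>active P x. (\<pi> True c - \<pi> False c) *\<^sub>R grad (constr_fun P c) x)" using H by simp
    show "s True c - s False c = grad (constr_fun P c) x \<bullet> \<xi>" if "c \<in> active P x" for c
      using E[of c] that unfolding \<kappa>_def[symmetric] by (auto simp: s_def max_def)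
    show "\<pi> b c * s b c = 0 \<and> m c * s b c = 0" if "c \<in> active P x" for c b
    proof (cases "c \<in> weakly_active P x m")
      case True
      then have "m c = 0" "\<nu> c * \<kappa> c \<le> 0" using D[OF True] by (auto simp: weakly_active_def \<kappa>_def)
      then show ?thesis using True DF[OF True]
        by (cases b) (auto simp: \<pi>_def s_def max_def mult_le_0_iff)
    next
      case False
      then show ?thesis using F[of c] by (cases b) (auto simp: \<pi>_def s_def)
    qed
    show "s b (Eq i) = 0" if "i \<in> eq_idx P" for i b using F[of "Eq i"] by (auto simp: s_def weakly_active_def)
    show "s b (Ineq j) \<ge> 0 \<and> (m (Ineq j) > 0 \<or> \<pi> b (Ineq j) \<ge> 0)" if "Ineq j \<in> active P x" for j b
      using F[of "Ineq j"] by (auto simp: s_def \<pi>_def)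
    show "Sw1 k \<in> active P x \<and> (\<forall>b. s b (Sw1 k) = 0) \<or> Sw2 k \<in> active P x \<and> (\<forall>b. s b (Sw2 k) = 0)"
      if "k \<in> {1..nsw P}" for k
      using Sw[OF that] by (auto simp: s_def weakly_active_def)
  qed
qed

lemma strongly_stable_imp_no_critical_direction:
  fixes P :: "('i, 'j, 'n::finite) mpsc"
  assumes fin: "finite (eq_idx P)" "finite (ineq_idx P)" and C2: "C2_data P" and x: "x \<in> feasible P"
    and m: "is_multiplier P x m" and stab: "strongly_stable P x"
  shows "no_critical_direction (Lagrangian_jac P x m)
      (\<lambda>c. grad (constr_fun P c) x) (active P x - weakly_active P x m) (weakly_active P x m)"
  unfolding no_critical_direction_def
proof (intro allI impI, rule ccontr)
  fix \<xi> \<nu>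
  have A: "active P x - weakly_active P x m \<union> weakly_active P x m = active P x" by (auto simp: weakly_active_def)
  assume H: "(Lagrangian_jac P x m) *v \<xi> =
      (\<Sum>c\<in>active P x - weakly_active P x m \<union> weakly_active P x m. \<nu> c *\<^sub>R grad (constr_fun P c) x)"
    and E: "\<forall>c\<in>active P x - weakly_active P x m. grad (constr_fun P c) x \<bullet> \<xi> = 0"
    and D: "\<forall>c\<in>weakly_active P x m. \<nu> c * (grad (constr_fun P c) x \<bullet> \<xi>) \<le> 0" and \<xi>: "\<xi> \<noteq> 0"
  have "Sw1 k \<in> active P x - {} \<or> Sw2 k \<in> active P x - {}" if "k \<in> {1..nsw P}" for k
    using x that by (auto simp: active_def feasible_def)
  from critical_direction_imp_not_strongly_stable[OF fin C2 x m \<xi> H[unfolded A], of "{}"] this D E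
  show False using stab by blast
qed

lemma strongly_stable_imp_biactive_multipliers_nonzero:
  fixes P :: "('i, 'j, 'n::finite) mpsc"
  assumes fin: "finite (eq_idx P)" "finite (ineq_idx P)" and C2: "C2_data P" and x: "x \<in> feasible P"
    and licq: "LICQ P x" and m: "is_multiplier P x m" and stab: "strongly_stable P x"
    and k: "k \<in> beta P x"
  shows "m (Sw1 k) \<noteq> 0 \<and> m (Sw2 k) \<noteq> 0"
proof (rule ccontr)
  assume "\<not> ?thesis"
  then obtain c0 where c0: "c0 \<in> {Sw1 k, Sw2 k}" "m c0 = 0" by auto
  have c0A: "c0 \<in> active P x" using c0 k by (auto simp: active_def beta_def)
  have finA: "finite (active P x)" using finite_constrs[OF fin] by (simp add: active_def)
  obtain \<xi> \<nu> where \<xi>: "\<xi> \<noteq> 0" and H: "(Lagrangian_jac P x m) *v \<xi> =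
      (\<Sum>c\<in>active P x. \<nu> c *\<^sub>R grad (constr_fun P c) x)" and 0: "\<forall>c\<in>active P x - {c0}. grad (constr_fun P c) x \<bullet> \<xi> = 0"
    using ex_free_critical_direction[OF finA LICQ_active[OF x licq] c0A] by blast
  have "\<not> strongly_stable P x"
  proof (rule critical_direction_imp_not_strongly_stable[OF fin C2 x m \<xi> H])
    show "\<nu> c * (grad (constr_fun P c) x \<bullet> \<xi>) \<le> 0" if "c \<in> weakly_active P x m" for c
    proof -
      have "c \<in> active P x - {c0}" using that c0 by (auto simp: weakly_active_def)
      then show ?thesis using 0 by simp
    qed
    show "grad (constr_fun P c) x \<bullet> \<xi> = 0" if "c \<in> active P x - weakly_active P x m - {c0}" for c using that 0 by auto
    show "m c = 0 \<and> c \<notin> range Eq \<and> c \<notin> range Ineq" if "c \<in> {c0}" for c using that c0 by auto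
    fix k' assume k': "k' \<in> {1..nsw P}"
    show "Sw1 k' \<in> active P x - {c0} \<or> Sw2 k' \<in> active P x - {c0}"
    proof (cases "k' = k")
      case True then show ?thesis using k c0 by (auto simp: active_def beta_def)
    next
      case False then show ?thesis using k' x c0 by (auto simp: active_def feasible_def)
    qed
  qed
  then show False using stab by simp
qed

section \<open>The Kojima system\<close>

text \<open>The multiplier encoded by \<open>z\<close>; the constraint value that it encodes is \<open>ramp E I i z - z\<close>. On \<open>E\<close> the
  value is 0 and the multiplier is free, on \<open>I\<close> the two are complementary, and the remaining indices are
  dummies with multiplier 0. The map is padded with dummies because the number of active constraints has to
  be matched by a type.\<close>
definition ramp :: "'n set \<Rightarrow> 'n set \<Rightarrow> 'n \<Rightarrow> real \<Rightarrow> real" where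
  "ramp E I i z = (if i \<in> E then z else if i \<in> I then max z 0 else 0)"

text \<open>The possible difference quotients of the functions \<open>ramp E I i\<close>.\<close>
definition slopes :: "'n set \<Rightarrow> 'n set \<Rightarrow> (real ^ 'n::finite) set" where
  "slopes E I = cbox (\<chi> i. if i \<in> E then 1 else 0) (\<chi> i. if i \<in> E \<union> I then 1 else 0)"

lemma mem_slopes:
  "t \<in> slopes E I \<longleftrightarrow> (\<forall>i. 0 \<le> t $ i \<and> t $ i \<le> 1 \<and> (i \<in> E \<longrightarrow> t $ i = 1) \<and> (i \<notin> E \<union> I \<longrightarrow> t $ i = 0))"
proof -
  have "(if i \<in> E then 1 else 0) \<le> t $ i \<and> t $ i \<le> (if i \<in> E \<union> I then 1 else 0) \<longleftrightarrow>
    0 \<le> t $ i \<and> t $ i \<le> 1 \<and> (i \<in> E \<longrightarrow> t $ i = 1) \<and> (i \<notin> E \<union> I \<longrightarrow> t $ i = 0)" for i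
    by (cases "i \<in> E"; cases "i \<in> I") auto
  then show ?thesis unfolding slopes_def mem_box_cart by simp
qed

lemma ramp_slope:
  fixes z w :: "real ^ 'n::finite"
  obtains t where "t \<in> slopes E I" "\<And>i. ramp E I i (z $ i) - ramp E I i (w $ i) = t $ i * (z $ i - w $ i)"
proof -
  define t :: "real ^ 'n" where "t = (\<chi> i. if i \<in> E then 1 else if i \<in> I then
      (if z $ i = w $ i then 0 else (max (z $ i) 0 - max (w $ i) 0) / (z $ i - w $ i)) else 0)"
  have "0 \<le> (max a 0 - max b 0) / (a - b) \<and> (max a 0 - max b 0) / (a - b) \<le> 1" if "a \<noteq> b" for a b :: real
    using that by (cases "a < b") (auto simp: divide_le_eq le_divide_eq zero_le_divide_iff max_def)
  then have "t \<in> slopes E I" unfolding mem_slopes t_def by auto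
  moreover have "ramp E I i (z $ i) - ramp E I i (w $ i) = t $ i * (z $ i - w $ i)" for i
    by (simp add: ramp_def t_def)
  ultimately show thesis by (rule that)
qed

text \<open>The linearization of the Kojima map with the derivative of \<open>ramp E I i\<close> replaced by the slope \<open>t $ i\<close>.\<close>
abbreviation kojima_lin :: "real ^ 'n ^ 'n \<Rightarrow> ('n::finite \<Rightarrow> real ^ 'n) \<Rightarrow> real ^ 'n \<Rightarrow> real ^ 'n \<Rightarrow> real ^ 'n \<Rightarrow> (real ^ 'n) \<times> (real ^ 'n)" where
  "kojima_lin H g t \<xi> \<eta> \<equiv> (H *v \<xi> - (\<Sum>i\<in>UNIV. (t $ i * \<eta> $ i) *\<^sub>R g i), \<chi> i. g i \<bullet> \<xi> + (1 - t $ i) * \<eta> $ i)"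

text \<open>For fixed slopes \<open>t\<close>, a kernel vector \<open>(\<xi>, \<eta>)\<close> has \<open>\<nu> i = t i \<eta> i\<close> and \<open>g i \<bullet> \<xi> = - (1 - t i) \<eta> i\<close>, whose
  product is nonpositive. Hence \<open>\<xi>\<close> is critical and vanishes, and \<open>\<eta> = 0\<close> by independence. A common
  constant for all slopes exists by compactness.\<close>
lemma kojima_linear_expansive:
  fixes H :: "real ^ 'n ^ 'n" and g :: "'n::finite \<Rightarrow> real ^ 'n"
  assumes dj: "E \<inter> I = {}" and g0: "\<And>i. i \<notin> E \<union> I \<Longrightarrow> g i = 0"
    and ncd: "no_critical_direction H g E I"
    and ind: "\<forall>\<nu>. (\<Sum>i\<in>E \<union> I. \<nu> i *\<^sub>R g i) = 0 \<longrightarrow> (\<forall>i\<in>E \<union> I. \<nu> i = 0)"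
  obtains c where "c > 0" "\<And>t \<xi> \<eta>. t \<in> slopes E I \<Longrightarrow> c * norm (\<xi>, \<eta>) \<le>
      norm (kojima_lin H g t \<xi> \<eta>)"
proof -
  define L where "L t u = (H *v fst u - (\<Sum>i\<in>UNIV. (t $ i * snd u $ i) *\<^sub>R g i),
      (\<chi> i. g i \<bullet> fst u + (1 - t $ i) * snd u $ i) :: real ^ 'n)" for t :: "real ^ 'n" and u :: "(real ^ 'n) \<times> (real ^ 'n)"
  have nonsing: "u = 0" if t: "t \<in> slopes E I" and 0: "L t u = 0" for t u
  proof -
    obtain \<xi> \<eta> where u: "u = (\<xi>, \<eta>)" by fastforce
    from t have t: "\<And>i. 0 \<le> t $ i" "\<And>i. t $ i \<le> 1" "\<And>i. i \<in> E \<Longrightarrow> t $ i = 1" "\<And>i. i \<notin> E \<union> I \<Longrightarrow> t $ i = 0"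
      by (auto simp: mem_slopes)
    have sum: "(\<Sum>i\<in>UNIV. (t $ i * \<eta> $ i) *\<^sub>R g i) = (\<Sum>i\<in>E \<union> I. (t $ i * \<eta> $ i) *\<^sub>R g i)"
      by (rule sum.mono_neutral_right) (auto simp: g0)
    have 1: "H *v \<xi> = (\<Sum>i\<in>E \<union> I. (t $ i * \<eta> $ i) *\<^sub>R g i)" using 0 by (simp add: L_def u zero_prod_def sum)
    have 2: "g i \<bullet> \<xi> = - (1 - t $ i) * \<eta> $ i" for i
    proof -
      have "g i \<bullet> \<xi> + (1 - t $ i) * \<eta> $ i = 0"
        using 0 by (simp add: L_def u zero_prod_def cart_eq_iff)
      then show ?thesis by (simp add: algebra_simps)
    qed
    have "\<forall>i\<in>E. g i \<bullet> \<xi> = 0" using 2 t(3) by simp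
    moreover have "\<forall>i\<in>I. t $ i * \<eta> $ i * (g i \<bullet> \<xi>) \<le> 0"
    proof
      fix i
      have "t $ i * \<eta> $ i * (g i \<bullet> \<xi>) = - (t $ i * (1 - t $ i) * (\<eta> $ i)\<^sup>2)"
        by (simp add: 2 power2_eq_square algebra_simps)
      then show "t $ i * \<eta> $ i * (g i \<bullet> \<xi>) \<le> 0" using t(1,2)[of i] by simp
    qed
    ultimately have \<xi>: "\<xi> = 0"
      using ncd[unfolded no_critical_direction_def, THEN spec, of \<xi>, THEN spec, of "\<lambda>i. t $ i * \<eta> $ i"] 1 by simp
    have "\<eta> $ i = 0" for i
    proof -
      have "t $ i * \<eta> $ i = 0" using ind[THEN spec, of "\<lambda>i. t $ i * \<eta> $ i"] 1 \<xi> t(4)[of i] by (cases "i \<in> E \<union> I") auto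
      moreover have "(1 - t $ i) * \<eta> $ i = 0" using 2[of i] \<xi> by simp
      ultimately show ?thesis by auto
    qed
    then show ?thesis using \<xi> by (simp add: u zero_prod_def cart_eq_iff)
  qed
  let ?K = "slopes E I \<times> (sphere 0 1 :: ((real ^ 'n) \<times> (real ^ 'n)) set)"
  have "compact ?K" unfolding slopes_def by (intro compact_Times compact_cbox compact_sphere)
  moreover have "?K \<noteq> {}"
  proof -
    have "(\<chi> i. if i \<in> E then 1 else 0) \<in> slopes E I" by (auto simp: mem_slopes)
    moreover have "(axis undefined 1, 0) \<in> (sphere 0 1 :: ((real ^ 'n) \<times> (real ^ 'n)) set)" by (simp add: norm_Pair)
    ultimately show ?thesis by blast
  qed
  moreover have "continuous_on ?K (\<lambda>p. norm (L (fst p) (snd p)))"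
    unfolding L_def
    by (intro continuous_on_norm continuous_on_Pair continuous_on_diff continuous_on_sum continuous_on_vec_lambda
        continuous_intros bounded_linear.continuous_on[OF matrix_vector_mul_bounded_linear])
  ultimately obtain p where p: "p \<in> ?K" and min: "\<And>q. q \<in> ?K \<Longrightarrow> norm (L (fst p) (snd p)) \<le> norm (L (fst q) (snd q))"
    using continuous_attains_inf[of ?K "\<lambda>p. norm (L (fst p) (snd p))"] by blast
  define c where "c = norm (L (fst p) (snd p))"
  have "snd p \<noteq> 0" using p by auto
  then have c: "c > 0" using nonsing[of "fst p" "snd p"] p by (auto simp: c_def)
  have L: "c * norm u \<le> norm (L t u)" if t: "t \<in> slopes E I" for t u
  proof (cases "u = 0")
    case False
    have "L t (s *\<^sub>R u) = s *\<^sub>R L t u" for s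
      by (simp add: L_def scaleR_diff_right scaleR_sum_right matrix_vector_mult_scaleR mult_ac
          cart_eq_iff algebra_simps)
    then have "norm (L t ((1 / norm u) *\<^sub>R u)) = norm (L t u) / norm u" by simp
    moreover have "c \<le> norm (L t ((1 / norm u) *\<^sub>R u))"
      using min[of "(t, (1 / norm u) *\<^sub>R u)"] t False by (simp add: c_def)
    ultimately show ?thesis using False by (simp add: le_divide_eq)
  qed simp
  show thesis
  proof (rule that[OF c])
    show "c * norm (\<xi>, \<eta>) \<le> norm (kojima_lin H g t \<xi> \<eta>)" if "t \<in> slopes E I" for t \<xi> \<eta>
      using L[OF that, of "(\<xi>, \<eta>)"] by (simp add: L_def)
  qed
qed

text \<open>Kojima's form of the stationarity system for an objective with gradient \<open>F\<close> and constraint functions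
  \<open>C i\<close> with gradients \<open>D i\<close>.\<close>
definition kojima :: "'n set \<Rightarrow> 'n set \<Rightarrow> (real ^ 'n \<Rightarrow> real ^ 'n) \<Rightarrow> ('n \<Rightarrow> real ^ 'n \<Rightarrow> real) \<Rightarrow> ('n \<Rightarrow> real ^ 'n \<Rightarrow> real ^ 'n) \<Rightarrow>
    (real ^ 'n) \<times> (real ^ 'n) \<Rightarrow> (real ^ 'n::finite) \<times> (real ^ 'n)" where
  "kojima E I F C D u = (F (fst u) - (\<Sum>i\<in>UNIV. ramp E I i (snd u $ i) *\<^sub>R D i (fst u)),
     \<chi> i. C i (fst u) - (ramp E I i (snd u $ i) - snd u $ i))"

lemma ramp_lipschitz: "\<bar>ramp E I i z - ramp E I i w\<bar> \<le> \<bar>z - w\<bar>"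
  by (simp add: ramp_def max_def)

text \<open>Differences of the map are the linear image for suitable slopes plus errors of size
  \<open>\<kappa> norm (u - v)\<close>, so half of the linear bound survives once \<open>\<kappa>\<close> is small. The hypotheses concern \<open>F\<close>, \<open>C\<close>,
  \<open>D\<close> on a set \<open>X\<close> only through strict differentiability estimates, so that one \<open>\<kappa>0\<close> serves all perturbed
  programs.\<close>
lemma kojima_expansive:
  fixes Hf :: "real ^ 'n ^ 'n" and Hc :: "'n::finite \<Rightarrow> real ^ 'n ^ 'n" and g :: "'n \<Rightarrow> real ^ 'n" and z0 :: "real ^ 'n"
  assumes c: "c > 0" and lin: "\<And>t \<xi> \<eta>. t \<in> slopes E I \<Longrightarrow> c * norm (\<xi>, \<eta>) \<le>
      norm (kojima_lin (Hf - (\<Sum>i\<in>UNIV. ramp E I i (z0 $ i) *\<^sub>R Hc i)) g t \<xi> \<eta>)"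
  obtains \<kappa>0 where "\<kappa>0 > 0"
    "\<And>\<kappa> X F C D u v. 0 < \<kappa> \<Longrightarrow> \<kappa> \<le> \<kappa>0 \<Longrightarrow>
      (\<And>x y. x \<in> X \<Longrightarrow> y \<in> X \<Longrightarrow> norm (F x - F y - Hf *v (x - y)) \<le> \<kappa> * norm (x - y)) \<Longrightarrow>
      (\<And>i x y. x \<in> X \<Longrightarrow> y \<in> X \<Longrightarrow> norm (D i x - D i y - Hc i *v (x - y)) \<le> \<kappa> * norm (x - y)) \<Longrightarrow>
      (\<And>i x y. x \<in> X \<Longrightarrow> y \<in> X \<Longrightarrow> \<bar>C i x - C i y - g i \<bullet> (x - y)\<bar> \<le> \<kappa> * norm (x - y)) \<Longrightarrow>
      (\<And>i x. x \<in> X \<Longrightarrow> norm (D i x - g i) \<le> \<kappa>) \<Longrightarrow>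
      u \<in> X \<times> cball z0 \<kappa> \<Longrightarrow> v \<in> X \<times> cball z0 \<kappa> \<Longrightarrow>
      c / 2 * norm (u - v) \<le> norm (kojima E I F C D u - kojima E I F C D v)"
proof -
  define m where "m i = ramp E I i (z0 $ i)" for i
  define n where "n = real CARD('n)"
  define K where "K = 1 + (\<Sum>i\<in>UNIV. \<bar>m i\<bar> + 1) + (\<Sum>i\<in>UNIV. onorm ((*v) (Hc i))) + n + n"
  have on: "onorm ((*v) (Hc i)) \<ge> 0" for i by (rule onorm_pos_le[OF matrix_vector_mul_bounded_linear])
  have "n \<ge> 0" by (simp add: n_def)
  then have K: "K \<ge> 1" unfolding K_def using on by (simp add: sum_nonneg add_nonneg_nonneg)
  define \<kappa>0 where "\<kappa>0 = min 1 (c / (2 * K))"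
  have "\<kappa>0 > 0" using c K by (simp add: \<kappa>0_def)
  moreover have "c / 2 * norm (u - v) \<le> norm (kojima E I F C D u - kojima E I F C D v)"
    if \<kappa>: "0 < \<kappa>" "\<kappa> \<le> \<kappa>0"
      and F: "\<And>x y. x \<in> X \<Longrightarrow> y \<in> X \<Longrightarrow> norm (F x - F y - Hf *v (x - y)) \<le> \<kappa> * norm (x - y)"
      and D: "\<And>i x y. x \<in> X \<Longrightarrow> y \<in> X \<Longrightarrow> norm (D i x - D i y - Hc i *v (x - y)) \<le> \<kappa> * norm (x - y)"
      and C: "\<And>i x y. x \<in> X \<Longrightarrow> y \<in> X \<Longrightarrow> \<bar>C i x - C i y - g i \<bullet> (x - y)\<bar> \<le> \<kappa> * norm (x - y)"
      and Dg: "\<And>i x. x \<in> X \<Longrightarrow> norm (D i x - g i) \<le> \<kappa>"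
      and u: "u \<in> X \<times> cball z0 \<kappa>" and v: "v \<in> X \<times> cball z0 \<kappa>" for \<kappa> X F C D u v
  proof -
    obtain x z y w where uv: "u = (x, z)" "v = (y, w)" by fastforce
    have x: "x \<in> X" and y: "y \<in> X" and z: "z \<in> cball z0 \<kappa>" and w: "w \<in> cball z0 \<kappa>" using u v uv by auto
    define \<xi> \<eta> where "\<xi> = x - y" and "\<eta> = z - w"
    define R where "R i z = ramp E I i z" for i z
    obtain t where t: "t \<in> slopes E I" and ts: "\<And>i. R i (z $ i) - R i (w $ i) = t $ i * (z $ i - w $ i)"
      using ramp_slope[of E I z w] R_def by metis
    have \<xi>le: "norm \<xi> \<le> norm (u - v)" and \<eta>le: "norm \<eta> \<le> norm (u - v)"
      using norm_fst_le[of "x - y" "z - w"] norm_snd_le[of "z - w" "x - y"] by (simp_all add: uv \<xi>_def \<eta>_def)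
    have Rm: "\<bar>R i (w $ i) - m i\<bar> \<le> \<kappa>" for i
    proof -
      have "\<bar>R i (w $ i) - m i\<bar> \<le> \<bar>(w - z0) $ i\<bar>" using ramp_lipschitz[of E I i "w $ i" "z0 $ i"] by (simp add: R_def m_def)
      also have "\<dots> \<le> norm (w - z0)" by (rule component_le_norm_cart)
      also have "\<dots> \<le> \<kappa>" using w by (simp add: dist_norm norm_minus_commute)
      finally show ?thesis .
    qed
    \<comment> \<open>Errors caused by the objective, by the constraint gradients at the two points, by the variation of the
      multipliers, and by evaluating gradients away from the centre.\<close>
    define a0 a1 a2 a3 where "a0 = F x - F y - Hf *v \<xi>"
      and "a1 = (\<Sum>i\<in>UNIV. R i (w $ i) *\<^sub>R (D i x - D i y - Hc i *v \<xi>))"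
      and "a2 = (\<Sum>i\<in>UNIV. (R i (w $ i) - m i) *\<^sub>R (Hc i *v \<xi>))"
      and "a3 = (\<Sum>i\<in>UNIV. (t $ i * \<eta> $ i) *\<^sub>R (D i x - g i))"
    define e2 :: "real ^ 'n" where "e2 = (\<chi> i. C i x - C i y - g i \<bullet> \<xi>)"
    let ?L1 = "(Hf - (\<Sum>i\<in>UNIV. m i *\<^sub>R Hc i)) *v \<xi> - (\<Sum>i\<in>UNIV. (t $ i * \<eta> $ i) *\<^sub>R g i)"
    let ?L2 = "(\<chi> i. g i \<bullet> \<xi> + (1 - t $ i) * \<eta> $ i) :: real ^ 'n"
    have fst_eq: "fst (kojima E I F C D u) - fst (kojima E I F C D v) = ?L1 + (a0 - a1 - a2 - a3)"
    proof -
      have "(\<Sum>i\<in>UNIV. R i (z $ i) *\<^sub>R D i x) - (\<Sum>i\<in>UNIV. R i (w $ i) *\<^sub>R D i y) =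
          (\<Sum>i\<in>UNIV. m i *\<^sub>R (Hc i *v \<xi>)) + (\<Sum>i\<in>UNIV. (t $ i * \<eta> $ i) *\<^sub>R g i) + a1 + a2 + a3"
        unfolding a1_def a2_def a3_def sum_subtractf[symmetric] sum.distrib[symmetric]
      proof (rule sum.cong[OF refl])
        fix i
        have "R i (z $ i) = R i (w $ i) + t $ i * \<eta> $ i" using ts[of i] by (simp add: \<eta>_def)
        then show "R i (z $ i) *\<^sub>R D i x - R i (w $ i) *\<^sub>R D i y = m i *\<^sub>R (Hc i *v \<xi>) + (t $ i * \<eta> $ i) *\<^sub>R g i +
          R i (w $ i) *\<^sub>R (D i x - D i y - Hc i *v \<xi>) + (R i (w $ i) - m i) *\<^sub>R (Hc i *v \<xi>) +
          (t $ i * \<eta> $ i) *\<^sub>R (D i x - g i)" by (simp add: algebra_simps)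
      qed
      moreover have "(Hf - (\<Sum>i\<in>UNIV. m i *\<^sub>R Hc i)) *v \<xi> = Hf *v \<xi> - (\<Sum>i\<in>UNIV. m i *\<^sub>R (Hc i *v \<xi>))"
        by (simp add: matrix_vector_mult_diff_rdistrib sum_matrix_vector_mult scaleR_matrix_vector_assoc[symmetric])
      moreover have "fst (kojima E I F C D u) - fst (kojima E I F C D v) =
          F x - F y - ((\<Sum>i\<in>UNIV. R i (z $ i) *\<^sub>R D i x) - (\<Sum>i\<in>UNIV. R i (w $ i) *\<^sub>R D i y))"
        by (simp add: kojima_def uv R_def)
      ultimately show ?thesis by (simp add: a0_def)
    qed
    have snd_eq: "snd (kojima E I F C D u) - snd (kojima E I F C D v) = ?L2 + e2"
      using ts by (simp add: kojima_def uv cart_eq_iff e2_def \<eta>_def R_def algebra_simps)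
    have eq: "kojima E I F C D u - kojima E I F C D v = (?L1, ?L2) + (a0 - a1 - a2 - a3, e2)"
      using fst_eq snd_eq by (simp add: prod_eq_iff)
    have b0: "norm a0 \<le> \<kappa> * norm (u - v)"
      using F[OF x y] mult_left_mono[OF \<xi>le less_imp_le[OF \<kappa>(1)]] by (simp add: a0_def \<xi>_def)
    have b1: "norm a1 \<le> (\<Sum>i\<in>UNIV. \<bar>m i\<bar> + 1) * (\<kappa> * norm (u - v))"
      unfolding a1_def sum_distrib_right
    proof (rule sum_norm_le)
      fix i
      have "\<bar>R i (w $ i)\<bar> \<le> \<bar>m i\<bar> + 1" using Rm[of i] \<kappa> by (auto simp: \<kappa>0_def)
      moreover have "norm (D i x - D i y - Hc i *v \<xi>) \<le> \<kappa> * norm (u - v)"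
        using D[OF x y, of i] mult_left_mono[OF \<xi>le less_imp_le[OF \<kappa>(1)]] by (simp add: \<xi>_def)
      ultimately show "norm (R i (w $ i) *\<^sub>R (D i x - D i y - Hc i *v \<xi>)) \<le> (\<bar>m i\<bar> + 1) * (\<kappa> * norm (u - v))"
        unfolding norm_scaleR by (intro mult_mono) auto
    qed
    have b2: "norm a2 \<le> (\<Sum>i\<in>UNIV. onorm ((*v) (Hc i))) * (\<kappa> * norm (u - v))"
      unfolding a2_def sum_distrib_right
    proof (rule sum_norm_le)
      fix i
      have "norm (Hc i *v \<xi>) \<le> onorm ((*v) (Hc i)) * norm \<xi>"
        by (rule onorm[OF matrix_vector_mul_bounded_linear])
      also have "\<dots> \<le> onorm ((*v) (Hc i)) * norm (u - v)" by (rule mult_left_mono[OF \<xi>le on])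
      finally have "\<bar>R i (w $ i) - m i\<bar> * norm (Hc i *v \<xi>) \<le> \<kappa> * (onorm ((*v) (Hc i)) * norm (u - v))"
        using Rm[of i] \<kappa> by (intro mult_mono) auto
      then show "norm ((R i (w $ i) - m i) *\<^sub>R (Hc i *v \<xi>)) \<le> onorm ((*v) (Hc i)) * (\<kappa> * norm (u - v))"
        by (simp add: mult_ac)
    qed
    have b3: "norm a3 \<le> n * (\<kappa> * norm (u - v))"
    proof -
      have "norm a3 \<le> (\<Sum>i\<in>(UNIV :: 'n set). \<kappa> * norm (u - v))"
        unfolding a3_def
      proof (rule sum_norm_le)
        fix i
        have "\<bar>t $ i\<bar> \<le> 1" using t by (simp add: mem_slopes)
        then have "\<bar>t $ i\<bar> * \<bar>\<eta> $ i\<bar> \<le> 1 * norm (u - v)"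
          using component_le_norm_cart[of \<eta> i] \<eta>le by (intro mult_mono) auto
        then have "\<bar>t $ i * \<eta> $ i\<bar> * norm (D i x - g i) \<le> norm (u - v) * \<kappa>"
          using Dg[OF x, of i] by (intro mult_mono) (auto simp: abs_mult)
        then show "norm ((t $ i * \<eta> $ i) *\<^sub>R (D i x - g i)) \<le> \<kappa> * norm (u - v)" by (simp add: mult_ac)
      qed
      then show ?thesis by (simp add: n_def)
    qed
    have b4: "norm e2 \<le> n * (\<kappa> * norm (u - v))"
      unfolding n_def
    proof (rule norm_le_CARD)
      fix i
      show "\<bar>e2 $ i\<bar> \<le> \<kappa> * norm (u - v)"
        using C[OF x y, of i] mult_left_mono[OF \<xi>le less_imp_le[OF \<kappa>(1)]] by (simp add: e2_def \<xi>_def)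
    qed
    have "norm (a0 - a1 - a2 - a3, e2) \<le> norm (a0 - a1 - a2 - a3) + norm e2" by (rule norm_Pair_le)
    also have "norm (a0 - a1 - a2 - a3) \<le> norm a0 + norm a1 + norm a2 + norm a3"
      by (meson add_mono_thms_linordered_semiring(3) norm_triangle_ineq4 order_trans)
    also have "norm a0 + norm a1 + norm a2 + norm a3 + norm e2 \<le> K * (\<kappa> * norm (u - v))"
      using b0 b1 b2 b3 b4 unfolding K_def distrib_right mult_1 by linarith
    also have "\<dots> \<le> c / 2 * norm (u - v)"
    proof -
      have "K * \<kappa> \<le> K * (c / (2 * K))" using \<kappa> K by (intro mult_left_mono) (auto simp: \<kappa>0_def)
      then have "K * \<kappa> \<le> c / 2" using K by simp
      from mult_right_mono[OF this norm_ge_zero[of "u - v"]] show ?thesis by (simp add: mult.assoc)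
    qed
    finally have err: "norm (a0 - a1 - a2 - a3, e2) \<le> c / 2 * norm (u - v)" by simp
    have "u - v = (\<xi>, \<eta>)" by (simp add: uv \<xi>_def \<eta>_def)
    then have "c * norm (u - v) \<le> norm (?L1, ?L2)" using lin[OF t, of \<xi> \<eta>] by (simp add: m_def)
    also have "\<dots> \<le> norm (kojima E I F C D u - kojima E I F C D v) + norm (a0 - a1 - a2 - a3, e2)"
      unfolding eq using norm_triangle_ineq4[of "(?L1, ?L2) + (a0 - a1 - a2 - a3, e2)" "(a0 - a1 - a2 - a3, e2)"] by simp
    finally show ?thesis using err by simp
  qed
  ultimately show thesis using that[of \<kappa>0] by blast
qed

text \<open>A minimizer of \<open>norm \<circ> f\<close> on the ball cannot lie on the sphere, where expansiveness makes the norm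
  larger than at the centre. An expansive map is injective, hence open by invariance of domain, so a
  nonzero value at an interior point could be decreased.\<close>
lemma expansive_map_has_zero:
  fixes f :: "'a \<Rightarrow> 'a::euclidean_space"
  assumes cont: "continuous_on (cball u0 \<rho>) f" and \<rho>: "\<rho> > 0" and c: "c > 0"
    and exp: "\<And>u v. u \<in> cball u0 \<rho> \<Longrightarrow> v \<in> cball u0 \<rho> \<Longrightarrow> c * norm (u - v) \<le> norm (f u - f v)"
    and small: "norm (f u0) < c * \<rho> / 2"
  shows "\<exists>u\<in>cball u0 \<rho>. f u = 0"
proof -
  have "continuous_on (cball u0 \<rho>) (\<lambda>u. norm (f u))" using cont by (intro continuous_intros)
  then obtain u where u: "u \<in> cball u0 \<rho>" and min: "\<And>v. v \<in> cball u0 \<rho> \<Longrightarrow> norm (f u) \<le> norm (f v)"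
    using continuous_attains_inf[of "cball u0 \<rho>" "\<lambda>u. norm (f u)"] \<rho> by auto
  have "u \<in> ball u0 \<rho>"
  proof (rule ccontr)
    assume "u \<notin> ball u0 \<rho>"
    then have "norm (u - u0) = \<rho>" using u by (simp add: dist_norm norm_minus_commute)
    then have "c * \<rho> \<le> norm (f u - f u0)" using exp[OF u, of u0] \<rho> by simp
    also have "\<dots> \<le> norm (f u) + norm (f u0)" by (rule norm_triangle_ineq4)
    also have "norm (f u) \<le> norm (f u0)" using min[of u0] \<rho> by simp
    finally show False using small by simp
  qed
  moreover have "open (f ` ball u0 \<rho>)"
  proof (rule invariance_of_domain)
    show "continuous_on (ball u0 \<rho>) f" using cont ball_subset_cball continuous_on_subset by blast
    show "inj_on f (ball u0 \<rho>)"
    proof (rule inj_onI)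
      fix a b assume ab: "a \<in> ball u0 \<rho>" "b \<in> ball u0 \<rho>" and eq: "f a = f b"
      have "c * norm (a - b) \<le> 0" using exp[of a b] ab eq by simp
      then show "a = b" using c by (simp add: mult_le_0_iff)
    qed
  qed simp
  ultimately obtain e where e: "e > 0" "ball (f u) e \<subseteq> f ` ball u0 \<rho>"
    using open_contains_ball by (metis image_eqI)
  have "f u = 0"
  proof (rule ccontr)
    assume nz: "f u \<noteq> 0"
    define s where "s = min 1 (e / (2 * norm (f u)))"
    have s: "0 < s" "s \<le> 1" using e nz by (auto simp: s_def)
    have "s * norm (f u) \<le> e / (2 * norm (f u)) * norm (f u)" by (intro mult_right_mono) (auto simp: s_def)
    then have "s * norm (f u) < e" using nz e by simp
    then have "(1 - s) *\<^sub>R f u \<in> ball (f u) e"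
      using s by (simp add: dist_norm scaleR_left_diff_distrib)
    then obtain v where v: "v \<in> ball u0 \<rho>" "f v = (1 - s) *\<^sub>R f u" using e(2) by (metis imageE subset_eq)
    then have "norm (f u) \<le> (1 - s) * norm (f u)" using min[of v] s by simp
    then show False using s nz by (simp add: algebra_simps mult_le_0_iff)
  qed
  then show ?thesis using u by blast
qed

lemma continuous_on_kojima:
  assumes "continuous_on UNIV F" "\<And>i. continuous_on UNIV (C i)" "\<And>i. continuous_on UNIV (D i)"
  shows "continuous_on S (kojima E I F C D)"
proof -
  have r: "continuous_on S (\<lambda>u. ramp E I i (snd u $ i))" for i
    unfolding ramp_def by (cases "i \<in> E"; cases "i \<in> I") (auto intro!: continuous_intros)
  have f: "continuous_on S (\<lambda>u. f (fst u))" if "continuous_on UNIV f" for f :: "real ^ 'a \<Rightarrow> 'z::topological_space"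
    by (rule continuous_on_compose2[OF that]) (auto intro: continuous_intros)
  show ?thesis
    unfolding kojima_def
    by (intro continuous_on_Pair continuous_on_diff continuous_on_sum continuous_on_scaleR continuous_on_vec_lambda
        r f assms continuous_on_component continuous_on_snd continuous_on_id)
qed

section \<open>Sufficiency: stationary points as zeros of the Kojima map\<close>

text \<open>\<open>e\<close> assigns to the active constraints distinct components of \<open>real ^ 'n\<close>,
  which suffice because LICQ allows at most \<open>CARD('n)\<close> of them.\<close>
locale kojima_reduction =
  fixes P :: "('i, 'j, 'n::finite) mpsc" and x :: "real ^ 'n" and m :: "('i, 'j) constr \<Rightarrow> real"
    and e :: "('i, 'j) constr \<Rightarrow> 'n"
  assumes fin: "finite (eq_idx P)" "finite (ineq_idx P)" and C2: "C2_data P" and x: "x \<in> feasible P"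
    and m: "is_multiplier P x m"
    and licq: "inj_on (\<lambda>c. grad (constr_fun P c) x) (active P x)"
      "independent ((\<lambda>c. grad (constr_fun P c) x) ` active P x)"
    and e: "inj_on e (active P x)"
    and ncd: "no_critical_direction (Lagrangian_jac P x m)
      (\<lambda>c. grad (constr_fun P c) x) (active P x - weakly_active P x m) (weakly_active P x m)"
    and biactive: "\<And>k. k \<in> beta P x \<Longrightarrow> m (Sw1 k) \<noteq> 0 \<and> m (Sw2 k) \<noteq> 0"
begin

abbreviation "A \<equiv> active P x"
abbreviation "D \<equiv> weakly_active P x m"

definition idx where "idx = the_inv_into A e"
definition pad :: "(('i, 'j) constr \<Rightarrow> 'v::zero) \<Rightarrow> 'n \<Rightarrow> 'v" where
  "pad f i = (if i \<in> e ` A then f (idx i) else 0)"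
definition "z0 = (\<chi> i. pad m i)"
definition "\<Phi> Q = kojima (e ` (A - D)) (e ` D) (grad (obj Q))
   (\<lambda>i y. pad (\<lambda>c. constr_fun Q c y) i) (\<lambda>i y. pad (\<lambda>c. grad (constr_fun Q c) y) i)"

lemma pad_e [simp]: "c \<in> A \<Longrightarrow> pad f (e c) = f c"
  unfolding pad_def idx_def using the_inv_into_f_f[OF e] by auto

lemma pad_out [simp]: "i \<notin> e ` A \<Longrightarrow> pad f i = 0"
  by (simp add: pad_def)

lemma D_subset: "D \<subseteq> A" by (auto simp: weakly_active_def)

lemma finite_A: "finite A" using finite_constrs[OF fin] by (simp add: active_def)

lemma A_constrs: "c \<in> A \<Longrightarrow> c \<in> constrs P" by (simp add: active_def)

lemma classes: "e ` (A - D) \<union> e ` D = e ` A" "e ` (A - D) \<inter> e ` D = {}"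
  using D_subset e by (auto simp: inj_on_def)

lemma sum_e: "sum f (e ` A) = (\<Sum>c\<in>A. f (e c))"
  by (rule sum.reindex[OF e, unfolded o_def])

lemma sum_UNIV:
  assumes "\<And>i. i \<notin> e ` A \<Longrightarrow> f i = (0 :: 'v :: comm_monoid_add)"
  shows "sum f UNIV = (\<Sum>c\<in>A. f (e c))"
  unfolding sum_e[symmetric] by (rule sum.mono_neutral_right) (use assms in auto)

lemma e_mem: "c \<in> A \<Longrightarrow> e c \<in> e ` (A - D) \<longleftrightarrow> c \<notin> D" "c \<in> A \<Longrightarrow> e c \<in> e ` D \<longleftrightarrow> c \<in> D"
  using D_subset e by (auto simp: inj_on_def)

lemma ramp_e: "c \<in> A \<Longrightarrow> ramp (e ` (A - D)) (e ` D) (e c) z = (if c \<in> D then max z 0 else z)"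
  by (simp add: ramp_def e_mem)

lemma ramp_out: "i \<notin> e ` A \<Longrightarrow> ramp (e ` (A - D)) (e ` D) i z = 0"
  using D_subset by (auto simp: ramp_def)

lemma m_D: "c \<in> D \<Longrightarrow> m c = 0" by (simp add: weakly_active_def)

lemma ramp_z0: "ramp (e ` (A - D)) (e ` D) i (z0 $ i) = z0 $ i"
proof (cases "i \<in> e ` A")
  case True
  then show ?thesis by (auto simp: z0_def ramp_e m_D)
qed (simp add: z0_def ramp_out)

lemma \<Phi>_eq_0_iff:
  "\<Phi> Q (y, z) = 0 \<longleftrightarrow>
     grad (obj Q) y = (\<Sum>c\<in>A. (if c \<in> D then max (z $ e c) 0 else z $ e c) *\<^sub>R grad (constr_fun Q c) y) \<and>
     (\<forall>c\<in>A. constr_fun Q c y = (if c \<in> D then max (z $ e c) 0 - z $ e c else 0)) \<and> (\<forall>i. i \<notin> e ` A \<longrightarrow> z $ i = 0)"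
proof -
  let ?R = "ramp (e ` (A - D)) (e ` D)"
  have 1: "(\<Sum>i\<in>UNIV. ?R i (z $ i) *\<^sub>R pad (\<lambda>c. grad (constr_fun Q c) y) i) =
      (\<Sum>c\<in>A. (if c \<in> D then max (z $ e c) 0 else z $ e c) *\<^sub>R grad (constr_fun Q c) y)"
    by (subst sum_UNIV) (auto simp: ramp_e intro!: sum.cong)
  have "(\<forall>i. pad (\<lambda>c. constr_fun Q c y) i - (?R i (z $ i) - z $ i) = 0) \<longleftrightarrow>
    (\<forall>i\<in>e ` A. pad (\<lambda>c. constr_fun Q c y) i - (?R i (z $ i) - z $ i) = 0) \<and>
    (\<forall>i. i \<notin> e ` A \<longrightarrow> pad (\<lambda>c. constr_fun Q c y) i - (?R i (z $ i) - z $ i) = 0)" by blast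
  also have "(\<forall>i\<in>e ` A. pad (\<lambda>c. constr_fun Q c y) i - (?R i (z $ i) - z $ i) = 0) \<longleftrightarrow>
    (\<forall>c\<in>A. constr_fun Q c y = (if c \<in> D then max (z $ e c) 0 - z $ e c else 0))"
    by (auto simp: ramp_e)
  also have "(\<forall>i. i \<notin> e ` A \<longrightarrow> pad (\<lambda>c. constr_fun Q c y) i - (?R i (z $ i) - z $ i) = 0) \<longleftrightarrow>
    (\<forall>i. i \<notin> e ` A \<longrightarrow> z $ i = 0)"
    by (simp add: ramp_out)
  finally show ?thesis
    unfolding \<Phi>_def kojima_def fst_conv snd_conv 1 zero_prod_def
    by (simp add: cart_eq_iff[of "\<chi> i. _ i"] del: constr_fun.simps)
qed

lemma KKT: "grad (obj P) x = (\<Sum>c\<in>A. m c *\<^sub>R grad (constr_fun P c) x)"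
  using m is_multiplier_sum_active[OF fin m] by (simp add: is_multiplier_def)

lemma constr_P_0: "c \<in> A \<Longrightarrow> constr_fun P c x = 0"
  by (simp add: active_def)

lemma multiplier_nonneg: "Ineq j \<in> A \<Longrightarrow> m (Ineq j) \<ge> 0"
  using m by (auto simp: is_multiplier_def active_def)

lemma feasible_active:
  "i \<in> eq_idx P \<Longrightarrow> Eq i \<in> A" "k \<in> {1..nsw P} \<Longrightarrow> Sw1 k \<in> A \<or> Sw2 k \<in> A"
  using x by (auto simp: active_def feasible_def)

text \<open>The second estimate is the first one for \<open>\<xi> = 0\<close> and slope 1 on all active constraints: it makes linear
  independence of the active gradients quantitative.\<close>
lemma linear_bounds:
  obtains c where "c > 0" "\<And>t \<xi> \<eta>. t \<in> slopes (e ` (A - D)) (e ` D) \<Longrightarrow> c * norm (\<xi>, \<eta>) \<le>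
      norm (kojima_lin (jac (obj P) x - (\<Sum>i\<in>UNIV. ramp (e ` (A - D)) (e ` D) i (z0 $ i) *\<^sub>R pad (\<lambda>c. jac (constr_fun P c) x) i)) (pad (\<lambda>c. grad (constr_fun P c) x)) t \<xi> \<eta>)"
    "\<And>\<nu>. c * (\<Sum>a\<in>A. \<bar>\<nu> a\<bar>) \<le> real CARD('n) * norm (\<Sum>a\<in>A. \<nu> a *\<^sub>R grad (constr_fun P a) x)"
proof -
  let ?E = "e ` (A - D)" and ?I = "e ` D"
  define H where "H = jac (obj P) x - (\<Sum>c\<in>A. m c *\<^sub>R jac (constr_fun P c) x)"
  define g where "g = pad (\<lambda>c. grad (constr_fun P c) x)"
  have Heq: "jac (obj P) x - (\<Sum>i\<in>UNIV. ramp ?E ?I i (z0 $ i) *\<^sub>R pad (\<lambda>c. jac (constr_fun P c) x) i) = H"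
    unfolding H_def ramp_z0 by (subst sum_UNIV) (auto simp: z0_def)
  have AD: "A - D \<union> D = A" using D_subset by auto
  have ncd': "no_critical_direction H g ?E ?I"
    unfolding no_critical_direction_def classes
  proof (intro allI impI)
    fix \<xi> \<nu> assume 1: "H *v \<xi> = (\<Sum>i\<in>e ` A. \<nu> i *\<^sub>R g i)" and 2: "\<forall>i\<in>?E. g i \<bullet> \<xi> = 0" and 3: "\<forall>i\<in>?I. \<nu> i * (g i \<bullet> \<xi>) \<le> 0"
    have "H *v \<xi> = (\<Sum>c\<in>A - D \<union> D. \<nu> (e c) *\<^sub>R grad (constr_fun P c) x)"
      unfolding 1 sum_e AD by (intro sum.cong refl) (simp add: g_def)
    moreover have "\<forall>c\<in>A - D. grad (constr_fun P c) x \<bullet> \<xi> = 0" using 2 by (auto simp: g_def)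
    moreover have "\<forall>c\<in>D. \<nu> (e c) * (grad (constr_fun P c) x \<bullet> \<xi>) \<le> 0" using 3 D_subset by (auto simp: g_def subset_iff)
    ultimately show "\<xi> = 0"
      using ncd[unfolded no_critical_direction_def, THEN spec, of \<xi>, THEN spec, of "\<lambda>c. \<nu> (e c)"] unfolding H_def by blast
  qed
  have g0: "g i = 0" if "i \<notin> ?E \<union> ?I" for i using that unfolding classes by (simp add: g_def)
  have ind': "\<nu> i = 0" if 0: "(\<Sum>i\<in>?E \<union> ?I. \<nu> i *\<^sub>R g i) = 0" and i: "i \<in> ?E \<union> ?I" for \<nu> i
  proof -
    obtain c where c: "c \<in> A" "i = e c" using i unfolding classes by auto
    have "(\<Sum>c\<in>A. \<nu> (e c) *\<^sub>R grad (constr_fun P c) x) = 0"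
      using 0 unfolding classes sum_e by (simp add: g_def)
    from indep_family_coeffs[OF finite_A licq this c(1)] show ?thesis by (simp add: c)
  qed
  obtain c where c: "c > 0" and lin: "\<And>t \<xi> \<eta>. t \<in> slopes ?E ?I \<Longrightarrow> c * norm (\<xi>, \<eta>) \<le>
      norm (kojima_lin H g t \<xi> \<eta>)"
    using kojima_linear_expansive[where E = ?E and I = ?I and g = g and H = H, OF classes(2) g0 ncd'] ind' by blast
  show thesis
  proof (rule that[OF c])
    show "c * norm (\<xi>, \<eta>) \<le> norm (kojima_lin (jac (obj P) x - (\<Sum>i\<in>UNIV. ramp ?E ?I i (z0 $ i) *\<^sub>R pad (\<lambda>c. jac (constr_fun P c) x) i)) (pad (\<lambda>c. grad (constr_fun P c) x)) t \<xi> \<eta>)"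
      if "t \<in> slopes ?E ?I" for t \<xi> \<eta>
      using lin[OF that] unfolding Heq g_def .
    fix \<nu> :: "('i, 'j) constr \<Rightarrow> real"
    define t :: "real ^ 'n" where "t = (\<chi> i. if i \<in> e ` A then 1 else 0)"
    define \<eta> :: "real ^ 'n" where "\<eta> = (\<chi> i. pad \<nu> i)"
    have t: "t \<in> slopes ?E ?I" unfolding mem_slopes classes using D_subset by (auto simp: t_def)
    have "(\<Sum>i\<in>UNIV. (t $ i * \<eta> $ i) *\<^sub>R g i) = (\<Sum>a\<in>A. \<nu> a *\<^sub>R grad (constr_fun P a) x)"
      by (subst sum_UNIV) (auto simp: g_def t_def \<eta>_def)
    moreover have "(\<chi> i. g i \<bullet> 0 + (1 - t $ i) * \<eta> $ i) = (0 :: real ^ 'n)"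
      by (auto simp: cart_eq_iff t_def \<eta>_def)
    ultimately have le: "c * norm \<eta> \<le> norm (\<Sum>a\<in>A. \<nu> a *\<^sub>R grad (constr_fun P a) x)"
      using lin[OF t, of 0 \<eta>] by (simp add: norm_Pair)
    have "(\<Sum>a\<in>A. \<bar>\<nu> a\<bar>) = (\<Sum>i\<in>UNIV. \<bar>\<eta> $ i\<bar>)"
      by (subst sum_UNIV) (auto simp: \<eta>_def)
    also have "\<dots> \<le> (\<Sum>i\<in>(UNIV :: 'n set). norm \<eta>)" by (intro sum_mono component_le_norm_cart)
    finally have "(\<Sum>a\<in>A. \<bar>\<nu> a\<bar>) \<le> real CARD('n) * norm \<eta>" by simp
    then have "c * (\<Sum>a\<in>A. \<bar>\<nu> a\<bar>) \<le> real CARD('n) * (c * norm \<eta>)"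
      using c by (simp add: mult.left_commute)
    also have "\<dots> \<le> real CARD('n) * norm (\<Sum>a\<in>A. \<nu> a *\<^sub>R grad (constr_fun P a) x)"
      by (rule mult_left_mono[OF le]) simp
    finally show "c * (\<Sum>a\<in>A. \<bar>\<nu> a\<bar>) \<le> real CARD('n) * norm (\<Sum>a\<in>A. \<nu> a *\<^sub>R grad (constr_fun P a) x)" .
  qed
qed

definition near :: "real \<Rightarrow> real \<Rightarrow> ('i, 'j, 'n) mpsc \<Rightarrow> bool" where
  "near r \<kappa> Q \<longleftrightarrow> same_format P Q \<and> C2_strictly_near x r \<kappa> (obj P) (obj Q) \<and>
     (\<forall>c\<in>constrs P. C2_strictly_near x r \<kappa> (constr_fun P c) (constr_fun Q c))"

lemma same_formatD:
  assumes "same_format P Q"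
  shows "eq_idx Q = eq_idx P" "ineq_idx Q = ineq_idx P" "nsw Q = nsw P" "constrs Q = constrs P"
  using assms by (simp_all add: same_format_def constrs_def)

lemma ex_near:
  assumes "\<kappa> > 0"
  obtains r where "r > 0" "\<And>Q. same_format P Q \<Longrightarrow> C2_data Q \<Longrightarrow>
    C2_norm (cball x r) (diff_components P Q) \<le> r \<Longrightarrow> near r \<kappa> Q"
proof -
  let ?ev = "\<lambda>\<phi> d. \<forall>\<rho> \<psi>. 0 < \<rho> \<and> \<rho> \<le> d \<and> C2 \<psi> \<and> C2_close (cball x \<rho>) d \<phi> \<psi> \<longrightarrow> C2_strictly_near x \<rho> \<kappa> \<phi> \<psi>"
  have "eventually (?ev (obj P)) (at_right 0)"
    using C2 assms by (intro C2_close_imp_strictly_near) (auto simp: C2_data_def)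
  moreover have "eventually (\<lambda>d. \<forall>c\<in>constrs P. ?ev (constr_fun P c) d) (at_right 0)"
    using C2 assms by (intro eventually_ball_finite finite_constrs fin ballI C2_close_imp_strictly_near) (auto simp: C2_data_def)
  moreover have "eventually (\<lambda>d::real. 0 < d) (at_right 0)" by (rule eventually_at_right_less)
  ultimately have "eventually (\<lambda>d. ?ev (obj P) d \<and> (\<forall>c\<in>constrs P. ?ev (constr_fun P c) d) \<and> 0 < d) (at_right 0)"
    by (intro eventually_conj)
  then obtain r where r: "?ev (obj P) r" "\<forall>c\<in>constrs P. ?ev (constr_fun P c) r" "0 < r"
    using eventually_happens'[OF trivial_limit_at_right_real] by blast
  show thesis
  proof (rule that[OF r(3)])
    fix Q assume Q: "same_format P Q" "C2_data Q" "C2_norm (cball x r) (diff_components P Q) \<le> r"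
    note close = C2_norm_imp_close[OF fin C2 Q(2,1) compact_cball Q(3)]
    have "C2 (obj Q)" "\<And>c. c \<in> constrs P \<Longrightarrow> C2 (constr_fun Q c)"
      using Q(2) same_formatD(4)[OF Q(1)] by (auto simp: C2_data_def)
    then show "near r \<kappa> Q" unfolding near_def using r close Q(1) by blast
  qed
qed

lemma near_inactive:
  assumes Q: "near r \<kappa> Q" and y: "y \<in> cball x r" and inactive: "\<And>c. c \<in> constrs P - A \<Longrightarrow> \<kappa> < \<bar>constr_fun P c x\<bar>"
    and c: "c \<in> constrs P - A"
  shows "constr_fun Q c y * constr_fun P c x > 0"
proof -
  have "\<bar>constr_fun Q c y - constr_fun P c x\<bar> \<le> \<kappa>"
    using Q y c unfolding near_def C2_strictly_near_def by blast
  then have "constr_fun P c x > 0 \<and> constr_fun Q c y > 0 \<or> constr_fun P c x < 0 \<and> constr_fun Q c y < 0"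
    using inactive[OF c] by linarith
  then show ?thesis by (auto simp: zero_less_mult_iff)
qed

text \<open>A multiplier that is nonzero at \<open>x\<close> keeps its sign within the radius \<open>\<kappa>1\<close>. So the inequalities that are
  treated as equations still have nonnegative multipliers.\<close>
lemma zero_imp_stationary:
  assumes Q: "near r \<kappa> Q" and y: "y \<in> cball x r" and inactive: "\<And>c. c \<in> constrs P - A \<Longrightarrow> \<kappa> < \<bar>constr_fun P c x\<bar>"
    and z: "z \<in> cball z0 \<kappa>1" and \<kappa>1: "\<And>c. c \<in> A \<Longrightarrow> m c \<noteq> 0 \<Longrightarrow> \<kappa>1 < \<bar>m c\<bar>" and zero: "\<Phi> Q (y, z) = 0"
  shows "W_stationary Q y"
proof -
  have sf: "same_format P Q" using Q by (simp add: near_def)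
  note sf = same_formatD[OF sf]
  define m' where "m' c = (if c \<in> A then if c \<in> D then max (z $ e c) 0 else z $ e c else 0)" for c
  from zero have g: "grad (obj Q) y = (\<Sum>c\<in>A. (if c \<in> D then max (z $ e c) 0 else z $ e c) *\<^sub>R grad (constr_fun Q c) y)"
    and val: "\<And>c. c \<in> A \<Longrightarrow> constr_fun Q c y = (if c \<in> D then max (z $ e c) 0 - z $ e c else 0)"
    unfolding \<Phi>_eq_0_iff by blast+
  have zm: "\<bar>z $ e c - m c\<bar> \<le> \<kappa>1" if "c \<in> A" for c
  proof -
    have "\<bar>z $ e c - m c\<bar> = \<bar>(z - z0) $ e c\<bar>" using that by (simp add: z0_def)
    also have "\<dots> \<le> norm (z - z0)" by (rule component_le_norm_cart)
    finally show ?thesis using z by (simp add: dist_norm norm_minus_commute)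
  qed
  have val0: "constr_fun Q c y = 0" if "c \<in> A" "c \<notin> range Ineq" for c
    using val[OF that(1)] that(2) by (auto simp: weakly_active_def)
  have "y \<in> feasible Q"
    unfolding feasible_iff_constr_fun sf
  proof (intro conjI ballI)
    show "constr_fun Q (Eq i) y = 0" if "i \<in> eq_idx P" for i
      using val0 feasible_active(1)[OF that] by (auto simp del: constr_fun.simps)
    show "0 \<le> constr_fun Q (Ineq j) y" if j: "j \<in> ineq_idx P" for j
    proof (cases "Ineq j \<in> A")
      case True then show ?thesis using val[OF True] by (auto simp del: constr_fun.simps)
    next
      case False
      then have "Ineq j \<in> constrs P - A" using j by simp
      moreover have "constr_fun P (Ineq j) x \<ge> 0" using x j by (auto simp: feasible_def)
      ultimately show ?thesis using near_inactive[OF Q y inactive, of "Ineq j"]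
        by (auto simp: zero_less_mult_iff simp del: constr_fun.simps)
    qed
    show "constr_fun Q (Sw1 k) y * constr_fun Q (Sw2 k) y = 0" if "k \<in> {1..nsw P}" for k
      using feasible_active(2)[OF that] val0[of "Sw1 k"] val0[of "Sw2 k"] by (auto simp del: constr_fun.simps)
  qed
  moreover have "is_multiplier Q y m'"
    unfolding is_multiplier_def sf
  proof (intro conjI ballI)
    have "(\<Sum>c\<in>constrs P. m' c *\<^sub>R grad (constr_fun Q c) y) = (\<Sum>c\<in>A. m' c *\<^sub>R grad (constr_fun Q c) y)"
      using finite_constrs[OF fin] A_constrs by (intro sum.mono_neutral_right) (auto simp: m'_def)
    then show "grad (obj Q) y = (\<Sum>c\<in>constrs P. m' c *\<^sub>R grad (constr_fun Q c) y)"
      using g by (simp add: m'_def)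
    show "m' c * constr_fun Q c y = 0" for c
      using val[of c] by (auto simp: m'_def max_def simp del: constr_fun.simps)
    show "m' (Ineq j) \<ge> 0" if "j \<in> ineq_idx P" for j
    proof (cases "Ineq j \<in> A - D")
      case True
      then have "m (Ineq j) > 0" using multiplier_nonneg[of j] by (auto simp: weakly_active_def)
      then have "\<kappa>1 < m (Ineq j)" using \<kappa>1[of "Ineq j"] True by auto
      then show ?thesis using zm[of "Ineq j"] True by (auto simp: m'_def)
    qed (auto simp: m'_def)
  qed
  ultimately show ?thesis using W_stationary_iff[of Q y] fin sf by auto
qed

text \<open>Comparing the stationarity equations at \<open>x\<close> and \<open>y\<close>, the quantitative independence of the active
  gradients bounds the distance of the multipliers. Thus multipliers that are nonzero at \<open>x\<close> stay nonzero
  and force their constraints to vanish. A switching constraint with zero multiplier that is active at \<open>x\<close>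
  has an inactive partner, by \<open>biactive\<close>, and must vanish because the product does.\<close>
lemma stationary_imp_zero:
  assumes Q: "near r \<kappa> Q" and y: "y \<in> cball x r" and inactive: "\<And>c. c \<in> constrs P - A \<Longrightarrow> \<kappa> < \<bar>constr_fun P c x\<bar>"
    and stat: "W_stationary Q y" and \<kappa>1: "\<And>c. c \<in> A \<Longrightarrow> m c \<noteq> 0 \<Longrightarrow> \<kappa>1 < \<bar>m c\<bar>"
    and c1: "c1 > 0" "\<And>\<nu>. c1 * (\<Sum>a\<in>A. \<bar>\<nu> a\<bar>) \<le> norm (\<Sum>a\<in>A. \<nu> a *\<^sub>R grad (constr_fun P a) x)"
    and \<kappa>: "0 < \<kappa>" "\<kappa> \<le> c1 / 2" "real CARD('n) * (2 / c1 * \<kappa> * (1 + (\<Sum>c\<in>A. \<bar>m c\<bar>)) + \<kappa>) \<le> \<kappa>1"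
  shows "\<exists>z\<in>cball z0 \<kappa>1. \<Phi> Q (y, z) = 0"
proof -
  have "same_format P Q" using Q by (simp add: near_def)
  note sf = same_formatD[OF this]
  obtain m' where feas: "y \<in> feasible Q" and m': "is_multiplier Q y m'"
    using stat W_stationary_iff[of Q y] fin sf by auto
  define M where "M = (\<Sum>c\<in>A. \<bar>m c\<bar>)"
  define G where "G c = grad (constr_fun P c) x" for c
  define G' where "G' c = grad (constr_fun Q c) y" for c
  have nG: "norm (G' c - G c) \<le> \<kappa>" and nv: "\<bar>constr_fun Q c y - constr_fun P c x\<bar> \<le> \<kappa>" if "c \<in> A" for c
    using Q y A_constrs[OF that] unfolding near_def C2_strictly_near_def G_def G'_def by blast+
  have nF: "norm (grad (obj Q) y - grad (obj P) x) \<le> \<kappa>"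
    using Q y unfolding near_def C2_strictly_near_def by blast
  have nz: "constr_fun Q c y \<noteq> 0" if "c \<in> constrs P - A" for c
    using near_inactive[OF Q y inactive that] by auto
  have m'0: "m' c = 0" if "c \<in> constrs P - A" for c
    using m' nz[OF that] that sf by (auto simp: is_multiplier_def)
  have KKT': "grad (obj Q) y = (\<Sum>c\<in>A. m' c *\<^sub>R G' c)"
  proof -
    have "grad (obj Q) y = (\<Sum>c\<in>constrs P. m' c *\<^sub>R G' c)" using m' sf by (simp add: is_multiplier_def G'_def)
    also have "\<dots> = (\<Sum>c\<in>A. m' c *\<^sub>R G' c)"
      using finite_constrs[OF fin] A_constrs m'0 by (intro sum.mono_neutral_right) auto
    finally show ?thesis .
  qed
  define S where "S = (\<Sum>c\<in>A. \<bar>m' c - m c\<bar>)"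
  have "(\<Sum>c\<in>A. (m' c - m c) *\<^sub>R G c) =
      (grad (obj Q) y - grad (obj P) x) - (\<Sum>c\<in>A. m c *\<^sub>R (G' c - G c)) - (\<Sum>c\<in>A. (m' c - m c) *\<^sub>R (G' c - G c))"
    unfolding KKT' KKT G_def[symmetric] sum_subtractf[symmetric] by (intro sum.cong refl) (simp add: algebra_simps)
  also have "norm \<dots> \<le> \<kappa> + M * \<kappa> + S * \<kappa>"
  proof -
    have "norm (\<Sum>c\<in>A. m c *\<^sub>R (G' c - G c)) \<le> M * \<kappa>"
      unfolding M_def sum_distrib_right by (rule sum_norm_le) (use nG in \<open>auto intro: mult_left_mono\<close>)
    moreover have "norm (\<Sum>c\<in>A. (m' c - m c) *\<^sub>R (G' c - G c)) \<le> S * \<kappa>"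
      unfolding S_def sum_distrib_right by (rule sum_norm_le) (use nG in \<open>auto intro: mult_left_mono\<close>)
    ultimately show ?thesis using nF by (intro norm_triangle_le_diff) (smt (verit) norm_triangle_ineq4)
  qed
  finally have "norm (\<Sum>c\<in>A. (m' c - m c) *\<^sub>R G c) \<le> \<kappa> + M * \<kappa> + S * \<kappa>" .
  then have "c1 * S \<le> \<kappa> + M * \<kappa> + S * \<kappa>" using c1(2)[of "\<lambda>c. m' c - m c"] by (simp add: S_def G_def)
  moreover have S0: "S \<ge> 0" by (simp add: S_def sum_nonneg)
  then have "S * \<kappa> \<le> S * (c1 / 2)" using \<kappa>(2) by (rule mult_left_mono[rotated])
  ultimately have "S \<le> 2 / c1 * \<kappa> * (1 + M)" using c1(1) by (simp add: field_simps)
  moreover have "\<bar>m' c - m c\<bar> \<le> S" if "c \<in> A" for c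
    unfolding S_def by (rule member_le_sum[OF that _ finite_A]) simp
  ultimately have mm: "\<bar>m' c - m c\<bar> \<le> 2 / c1 * \<kappa> * (1 + M)" if "c \<in> A" for c using that by fastforce
  have n1: "real CARD('n) \<ge> 1" by (simp add: Suc_leI)
  have b0: "2 / c1 * \<kappa> * (1 + M) + \<kappa> \<ge> 0"
    using c1(1) \<kappa>(1) by (simp add: M_def sum_nonneg add_nonneg_nonneg)
  have mm1: "\<bar>m' c - m c\<bar> \<le> \<kappa>1" if "c \<in> A" for c
  proof -
    have "\<bar>m' c - m c\<bar> \<le> 1 * (2 / c1 * \<kappa> * (1 + M) + \<kappa>)" using mm[OF that] \<kappa>(1) by simp
    also have "\<dots> \<le> real CARD('n) * (2 / c1 * \<kappa> * (1 + M) + \<kappa>)" by (rule mult_right_mono[OF n1 b0])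
    finally show ?thesis using \<kappa>(3) unfolding M_def by linarith
  qed
  have m'nz: "m' c \<noteq> 0" if "c \<in> A" "m c \<noteq> 0" for c
    using mm1[OF that(1)] \<kappa>1[OF that] by auto
  have compl: "m' c * constr_fun Q c y = 0" if "c \<in> A" for c
    using m' A_constrs[OF that] sf by (simp add: is_multiplier_def)
  define z where "z = (\<chi> i. pad (\<lambda>c. if c \<in> D then m' c - constr_fun Q c y else m' c) i)"
  have "norm (z - z0) \<le> real CARD('n) * (2 / c1 * \<kappa> * (1 + M) + \<kappa>)"
  proof (rule norm_le_CARD)
    fix i
    show "\<bar>(z - z0) $ i\<bar> \<le> 2 / c1 * \<kappa> * (1 + M) + \<kappa>"
    proof (cases "i \<in> e ` A")
      case True
      then obtain c where c: "c \<in> A" "i = e c" by auto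
      have "\<bar>(z - z0) $ i\<bar> \<le> \<bar>m' c - m c\<bar> + \<bar>constr_fun Q c y\<bar>"
        using c by (cases "c \<in> D") (simp_all add: z_def z0_def)
      then show ?thesis using mm[OF c(1)] nv[OF c(1)] constr_P_0[OF c(1)] by simp
    qed (use b0 in \<open>simp add: z_def z0_def\<close>)
  qed
  then have "z \<in> cball z0 \<kappa>1" using \<kappa>(3) by (simp add: dist_norm norm_minus_commute M_def)
  moreover have "\<Phi> Q (y, z) = 0"
    unfolding \<Phi>_eq_0_iff
  proof (intro conjI ballI allI impI)
    have zc: "z $ e c = (if c \<in> D then m' c - constr_fun Q c y else m' c)" if "c \<in> A" for c
      using that by (simp add: z_def)
    have zD: "max (z $ e c) 0 = m' c" if c: "c \<in> D" for c
    proof -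
      obtain j where j: "c = Ineq j" using c by (auto simp: weakly_active_def)
      have cA: "c \<in> A" using c D_subset by auto
      have "j \<in> ineq_idx Q" using A_constrs[OF cA] sf j by simp
      then have "m' c \<ge> 0" "constr_fun Q c y \<ge> 0" using m' feas by (auto simp: is_multiplier_def feasible_def j)
      then show ?thesis using compl[OF cA] zc[OF cA] c by (auto simp: max_def)
    qed
    show "grad (obj Q) y = (\<Sum>c\<in>A. (if c \<in> D then max (z $ e c) 0 else z $ e c) *\<^sub>R grad (constr_fun Q c) y)"
    proof -
      have "(if c \<in> D then max (z $ e c) 0 else z $ e c) = m' c" if "c \<in> A" for c
        using zD[of c] zc[OF that] by (cases "c \<in> D") (simp_all only: if_True if_False simp_thms)
      then show ?thesis unfolding KKT' G'_def by (intro sum.cong refl) simp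
    qed
    show "z $ i = 0" if "i \<notin> e ` A" for i using that by (simp add: z_def)
    fix c assume c: "c \<in> A"
    show "constr_fun Q c y = (if c \<in> D then max (z $ e c) 0 - z $ e c else 0)"
    proof (cases "c \<in> D")
      case True then show ?thesis using zD[OF True] zc[OF c] by simp
    next
      case False
      have sw: "constr_fun Q (Sw1 k) y * constr_fun Q (Sw2 k) y = 0" if "k \<in> {1..nsw P}" for k
        using feas that sf unfolding feasible_iff_constr_fun by metis
      have "constr_fun Q c y = 0"
      proof (cases "m c = 0")
        case True
        show ?thesis
        proof (cases c)
          case (Eq i)
          then show ?thesis using feas A_constrs[OF c] sf by (simp add: feasible_def)
        next
          case (Ineq j) then show ?thesis using False True c by (auto simp: weakly_active_def)
        next
          case (Sw1 k)
          have k: "k \<in> {1..nsw P}" using A_constrs[OF c] Sw1 by simp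
          have inact: "Sw2 k \<in> constrs P - A"
            using biactive[of k] True Sw1 k c by (auto simp: active_def beta_def)
          show ?thesis using nz[OF inact] sw[OF k] Sw1 by auto
        next
          case (Sw2 k)
          have k: "k \<in> {1..nsw P}" using A_constrs[OF c] Sw2 by simp
          have inact: "Sw1 k \<in> constrs P - A"
            using biactive[of k] True Sw2 k c by (auto simp: active_def beta_def)
          show ?thesis using nz[OF inact] sw[OF k] Sw2 by auto
        qed
      next
        case False
        then show ?thesis using compl[OF c] m'nz[OF c] by simp
      qed
      then show ?thesis using False by simp
    qed
  qed
  ultimately show ?thesis by blast
qed

lemma \<Phi>_base_small:
  assumes "C2_close {x} d (obj P) (obj Q)" "\<And>c. c \<in> constrs P \<Longrightarrow> C2_close {x} d (constr_fun P c) (constr_fun Q c)"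
    and "0 \<le> d"
  shows "norm (\<Phi> Q (x, z0)) \<le> real CARD('n) * (2 + (\<Sum>c\<in>A. \<bar>m c\<bar>)) * d"
proof -
  let ?n = "real CARD('n)"
  let ?v = "grad (obj Q) x - (\<Sum>c\<in>A. m c *\<^sub>R grad (constr_fun Q c) x)"
  let ?w = "(\<chi> i. pad (\<lambda>c. constr_fun Q c x) i) :: real ^ 'n"
  have "(\<Sum>i\<in>UNIV. z0 $ i *\<^sub>R pad (\<lambda>c. grad (constr_fun Q c) x) i) = (\<Sum>c\<in>A. m c *\<^sub>R grad (constr_fun Q c) x)"
    by (subst sum_UNIV) (auto simp: z0_def)
  then have eq: "\<Phi> Q (x, z0) = (?v, ?w)" by (simp add: \<Phi>_def kojima_def ramp_z0)
  have "?v = (grad (obj Q) x - grad (obj P) x) - (\<Sum>c\<in>A. m c *\<^sub>R (grad (constr_fun Q c) x - grad (constr_fun P c) x))"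
    unfolding KKT by (simp add: scaleR_diff_right sum_subtractf)
  also have "norm \<dots> \<le> ?n * d + (\<Sum>c\<in>A. \<bar>m c\<bar>) * (?n * d)"
  proof (rule order_trans[OF norm_triangle_ineq4 add_mono])
    show "norm (grad (obj Q) x - grad (obj P) x) \<le> ?n * d" using grad_C2_close[OF assms(1)] by simp
    show "norm (\<Sum>c\<in>A. m c *\<^sub>R (grad (constr_fun Q c) x - grad (constr_fun P c) x)) \<le> (\<Sum>c\<in>A. \<bar>m c\<bar>) * (?n * d)"
      unfolding sum_distrib_right
      by (rule sum_norm_le) (use grad_C2_close[OF assms(2)] A_constrs in \<open>auto intro!: mult_left_mono\<close>)
  qed
  finally have v: "norm ?v \<le> ?n * d + (\<Sum>c\<in>A. \<bar>m c\<bar>) * (?n * d)" .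
  have w: "norm ?w \<le> ?n * d"
  proof (rule norm_le_CARD)
    fix i
    show "\<bar>?w $ i\<bar> \<le> d"
    proof (cases "i \<in> e ` A")
      case True
      then obtain c where c: "c \<in> A" "i = e c" by auto
      then show ?thesis using assms(2)[OF A_constrs[OF c(1)]] constr_P_0[OF c(1)] by (simp add: C2_close_def)
    qed (use assms(3) in simp)
  qed
  have "norm (\<Phi> Q (x, z0)) \<le> norm ?v + norm ?w" unfolding eq by (rule norm_Pair_le)
  also have "\<dots> \<le> (?n * d + (\<Sum>c\<in>A. \<bar>m c\<bar>) * (?n * d)) + ?n * d" by (rule add_mono[OF v w])
  finally show ?thesis by (simp add: algebra_simps)
qed

lemma continuous_on_\<Phi>:
  assumes "same_format P Q" "C2_data Q"
  shows "continuous_on S (\<Phi> Q)"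
proof -
  have C2': "C2 (obj Q)" "\<And>c. c \<in> A \<Longrightarrow> C2 (constr_fun Q c)"
    using assms same_formatD(4)[OF assms(1)] A_constrs by (auto simp: C2_data_def)
  have g: "continuous_on UNIV (grad \<phi>)" if "C2 \<phi>" for \<phi> :: "real ^ 'n \<Rightarrow> real"
    using has_derivative_grad_jac[OF that] has_derivative_continuous
    by (blast intro: continuous_at_imp_continuous_on)
  have f: "continuous_on UNIV \<phi>" if "C2 \<phi>" for \<phi> :: "real ^ 'n \<Rightarrow> real"
    using C2_differentiable[OF that] differentiable_imp_continuous_within
    by (blast intro: continuous_at_imp_continuous_on)
  have idx: "idx i \<in> A" if "i \<in> e ` A" for i
    unfolding idx_def using that e by (auto simp: the_inv_into_f_f)
  show ?thesis
    unfolding \<Phi>_def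
  proof (rule continuous_on_kojima)
    show "continuous_on UNIV (grad (obj Q))" by (rule g[OF C2'(1)])
    show "continuous_on UNIV (\<lambda>y. pad (\<lambda>c. constr_fun Q c y) i)" for i
      unfolding pad_def using f[OF C2'(2)[OF idx]] by (cases "i \<in> e ` A") auto
    show "continuous_on UNIV (\<lambda>y. pad (\<lambda>c. grad (constr_fun Q c) y) i)" for i
      unfolding pad_def using g[OF C2'(2)[OF idx]] by (cases "i \<in> e ` A") auto
  qed
qed

text \<open>The constants are chosen from the inside out: \<open>\<kappa>1\<close> bounds the multiplier variables, then \<open>\<kappa>\<close> the
  deviation of the data, then the radius \<open>r\<close>. Only the last choice, \<open>\<delta>\<close>, may depend on \<open>\<epsilon>\<close>; it makes the
  map at the unperturbed solution so small that its zero lies within \<open>\<epsilon>\<close>.\<close>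
theorem W_stationary_point_strongly_stable: "strongly_stable P x"
proof -
  let ?n = "real CARD('n)"
  define M where "M = (\<Sum>c\<in>A. \<bar>m c\<bar>)"
  have M: "M \<ge> 0" by (simp add: M_def sum_nonneg)
  have n1: "?n \<ge> 1" by (simp add: Suc_leI)
  obtain c where c: "c > 0" and lin: "\<And>t \<xi> \<eta>. t \<in> slopes (e ` (A - D)) (e ` D) \<Longrightarrow> c * norm (\<xi>, \<eta>) \<le>
      norm (kojima_lin (jac (obj P) x - (\<Sum>i\<in>UNIV. ramp (e ` (A - D)) (e ` D) i (z0 $ i) *\<^sub>R pad (\<lambda>c. jac (constr_fun P c) x) i)) (pad (\<lambda>c. grad (constr_fun P c) x)) t \<xi> \<eta>)"
    and indep: "\<And>\<nu>. c * (\<Sum>a\<in>A. \<bar>\<nu> a\<bar>) \<le> ?n * norm (\<Sum>a\<in>A. \<nu> a *\<^sub>R grad (constr_fun P a) x)"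
    using linear_bounds by blast
  define c1 where "c1 = c / ?n"
  have c1: "c1 > 0" "\<And>\<nu>. c1 * (\<Sum>a\<in>A. \<bar>\<nu> a\<bar>) \<le> norm (\<Sum>a\<in>A. \<nu> a *\<^sub>R grad (constr_fun P a) x)"
    using c n1 indep by (auto simp: c1_def divide_le_eq mult.commute)
  obtain \<kappa>0 where \<kappa>0: "\<kappa>0 > 0" and expansive: "\<And>\<kappa> X F C D' u v. 0 < \<kappa> \<Longrightarrow> \<kappa> \<le> \<kappa>0 \<Longrightarrow>
      (\<And>x1 y. x1 \<in> X \<Longrightarrow> y \<in> X \<Longrightarrow> norm (F x1 - F y - jac (obj P) x *v (x1 - y)) \<le> \<kappa> * norm (x1 - y)) \<Longrightarrow>
      (\<And>i x1 y. x1 \<in> X \<Longrightarrow> y \<in> X \<Longrightarrow> norm (D' i x1 - D' i y - pad (\<lambda>c. jac (constr_fun P c) x) i *v (x1 - y)) \<le> \<kappa> * norm (x1 - y)) \<Longrightarrow>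
      (\<And>i x1 y. x1 \<in> X \<Longrightarrow> y \<in> X \<Longrightarrow> \<bar>C i x1 - C i y - pad (\<lambda>c. grad (constr_fun P c) x) i \<bullet> (x1 - y)\<bar> \<le> \<kappa> * norm (x1 - y)) \<Longrightarrow>
      (\<And>i x1. x1 \<in> X \<Longrightarrow> norm (D' i x1 - pad (\<lambda>c. grad (constr_fun P c) x) i) \<le> \<kappa>) \<Longrightarrow>
      u \<in> X \<times> cball z0 \<kappa> \<Longrightarrow> v \<in> X \<times> cball z0 \<kappa> \<Longrightarrow>
      c / 2 * norm (u - v) \<le> norm (kojima (e ` (A - D)) (e ` D) F C D' u - kojima (e ` (A - D)) (e ` D) F C D' v)"
    using kojima_expansive[OF c lin] by blast
  have id_lim: "((\<lambda>\<kappa>::real. \<kappa>) \<longlongrightarrow> 0) (at_right 0)" by (rule tendsto_ident_at)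
  have pos: "eventually (\<lambda>\<kappa>::real. 0 < \<kappa>) (at_right 0)" by (rule eventually_at_right_less)
  have "eventually (\<lambda>\<kappa>. \<forall>a\<in>A. m a \<noteq> 0 \<longrightarrow> \<kappa> < \<bar>m a\<bar>) (at_right 0)"
    by (intro eventually_ball_finite finite_A ballI) (use order_tendstoD(2)[OF id_lim] in \<open>auto elim: eventually_mono\<close>)
  from eventually_conj[OF this eventually_conj[OF order_tendstoD(2)[OF id_lim \<kappa>0] pos]]
  obtain \<kappa>1 where \<kappa>1: "\<And>a. a \<in> A \<Longrightarrow> m a \<noteq> 0 \<Longrightarrow> \<kappa>1 < \<bar>m a\<bar>" "\<kappa>1 < \<kappa>0" "0 < \<kappa>1"
    using eventually_happens'[OF trivial_limit_at_right_real] by blast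
  have "eventually (\<lambda>\<kappa>. \<forall>a\<in>constrs P. a \<notin> A \<longrightarrow> \<kappa> < \<bar>constr_fun P a x\<bar>) (at_right 0)"
  proof (intro eventually_ball_finite finite_constrs fin ballI)
    fix a assume "a \<in> constrs P"
    show "eventually (\<lambda>\<kappa>. a \<notin> A \<longrightarrow> \<kappa> < \<bar>constr_fun P a x\<bar>) (at_right 0)"
    proof (cases "a \<in> A")
      case False
      then have "0 < \<bar>constr_fun P a x\<bar>" using \<open>a \<in> constrs P\<close> by (simp add: active_def)
      from order_tendstoD(2)[OF id_lim this] show ?thesis by (auto elim: eventually_mono)
    qed simp
  qed
  moreover have "eventually (\<lambda>\<kappa>. ?n * (2 / c1 * \<kappa> * (1 + M) + \<kappa>) < \<kappa>1) (at_right 0)"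
  proof -
    have "((\<lambda>\<kappa>. ?n * (2 / c1 * \<kappa> * (1 + M) + \<kappa>)) \<longlongrightarrow> ?n * (2 / c1 * 0 * (1 + M) + 0)) (at_right 0)"
      by (intro tendsto_intros id_lim)
    from order_tendstoD(2)[OF this, of \<kappa>1] \<kappa>1 show ?thesis by simp
  qed
  moreover have "eventually (\<lambda>\<kappa>. \<kappa> < c1 / 2) (at_right 0)" "eventually (\<lambda>\<kappa>. \<kappa> < \<kappa>1) (at_right 0)"
    by (rule order_tendstoD(2)[OF id_lim]; use c1(1) \<kappa>1 in simp)+
  ultimately have "eventually (\<lambda>\<kappa>. (\<forall>a\<in>constrs P. a \<notin> A \<longrightarrow> \<kappa> < \<bar>constr_fun P a x\<bar>) \<and>
      ?n * (2 / c1 * \<kappa> * (1 + M) + \<kappa>) < \<kappa>1 \<and> \<kappa> < c1 / 2 \<and> \<kappa> < \<kappa>1 \<and> 0 < \<kappa>) (at_right 0)"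
    using pos by (intro eventually_conj)
  then obtain \<kappa> where inactive: "\<And>a. a \<in> constrs P - A \<Longrightarrow> \<kappa> < \<bar>constr_fun P a x\<bar>"
    and \<kappa>: "?n * (2 / c1 * \<kappa> * (1 + M) + \<kappa>) < \<kappa>1" "\<kappa> < c1 / 2" "\<kappa> < \<kappa>1" "0 < \<kappa>"
    using eventually_happens'[OF trivial_limit_at_right_real] by (metis (no_types, lifting) DiffE)
  obtain r where r: "r > 0" and near: "\<And>Q. same_format P Q \<Longrightarrow> C2_data Q \<Longrightarrow>
    C2_norm (cball x r) (diff_components P Q) \<le> r \<Longrightarrow> near r \<kappa> Q"
    using ex_near[OF \<kappa>(4)] by blast

  have exp\<Phi>: "c / 2 * norm (u - v) \<le> norm (\<Phi> Q u - \<Phi> Q v)"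
    if Q: "near r \<kappa> Q" and u: "u \<in> cball x r \<times> cball z0 \<kappa>1" and v: "v \<in> cball x r \<times> cball z0 \<kappa>1" for Q u v
    unfolding \<Phi>_def
  proof (rule expansive[OF \<kappa>1(3) less_imp_le[OF \<kappa>1(2)] _ _ _ _ u v])
    have le: "\<kappa> * norm w \<le> \<kappa>1 * norm w" for w :: "real ^ 'n" using \<kappa> by (intro mult_right_mono) auto
    fix y w assume yw: "y \<in> cball x r" "w \<in> cball x r"
    show "norm (grad (obj Q) y - grad (obj Q) w - jac (obj P) x *v (y - w)) \<le> \<kappa>1 * norm (y - w)"
      using Q yw le[of "y - w"] unfolding near_def C2_strictly_near_def by (meson order_trans)
    fix i
    have idx: "i \<notin> e ` A \<or> (\<exists>a\<in>A. i = e a)" by blast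
    show "norm (pad (\<lambda>c. grad (constr_fun Q c) y) i - pad (\<lambda>c. grad (constr_fun Q c) w) i - pad (\<lambda>c. jac (constr_fun P c) x) i *v (y - w)) \<le> \<kappa>1 * norm (y - w)"
      using idx
    proof (elim disjE bexE)
      fix a assume a: "a \<in> A" "i = e a"
      show ?thesis using Q yw le[of "y - w"] A_constrs[OF a(1)] unfolding near_def C2_strictly_near_def a(2) pad_e[OF a(1)]
        by (meson order_trans)
    qed (use \<kappa>1 in simp)
    show "\<bar>pad (\<lambda>c. constr_fun Q c y) i - pad (\<lambda>c. constr_fun Q c w) i - pad (\<lambda>c. grad (constr_fun P c) x) i \<bullet> (y - w)\<bar> \<le> \<kappa>1 * norm (y - w)"
      using idx
    proof (elim disjE bexE)
      fix a assume a: "a \<in> A" "i = e a"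
      show ?thesis using Q yw le[of "y - w"] A_constrs[OF a(1)] unfolding near_def C2_strictly_near_def a(2) pad_e[OF a(1)]
        by (meson order_trans)
    qed (use \<kappa>1 in simp)
  next
    fix i y assume y: "y \<in> cball x r"
    have idx: "i \<notin> e ` A \<or> (\<exists>a\<in>A. i = e a)" by blast
    then show "norm (pad (\<lambda>c. grad (constr_fun Q c) y) i - pad (\<lambda>c. grad (constr_fun P c) x) i) \<le> \<kappa>1"
    proof (elim disjE bexE)
      fix a assume a: "a \<in> A" "i = e a"
      have "norm (grad (constr_fun Q a) y - grad (constr_fun P a) x) \<le> \<kappa>"
        using Q y A_constrs[OF a(1)] unfolding near_def C2_strictly_near_def by blast
      then show ?thesis unfolding a(2) pad_e[OF a(1)] using \<kappa> by simp
    qed (use \<kappa>1 in simp)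
  qed

  have stable: "\<exists>\<delta>>0. \<forall>Q. same_format P Q \<and> C2_data Q \<and> C2_norm (cball x r) (diff_components P Q) \<le> \<delta> \<longrightarrow>
         (\<exists>x'\<in>cball x \<epsilon>. W_stationary Q x' \<and> (\<forall>y\<in>cball x r. W_stationary Q y \<longrightarrow> y = x'))"
    if \<epsilon>: "0 < \<epsilon> \<and> \<epsilon> \<le> r" for \<epsilon>
  proof -
    define \<epsilon>' where "\<epsilon>' = min \<epsilon> \<kappa>1"
    have \<epsilon>': "0 < \<epsilon>'" "\<epsilon>' \<le> \<epsilon>" "\<epsilon>' \<le> \<kappa>1" using \<epsilon> \<kappa>1 by (auto simp: \<epsilon>'_def)
    define K where "K = ?n * (2 + M)"
    have K: "K > 0" using n1 M by (simp add: K_def)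
    define \<delta> where "\<delta> = min r (c / 2 * \<epsilon>' / (4 * K))"
    have \<delta>: "\<delta> > 0" "\<delta> \<le> r" using r c \<epsilon>' K by (auto simp: \<delta>_def)
    have K\<delta>: "K * \<delta> < c / 2 * \<epsilon>' / 2"
    proof -
      have "K * \<delta> \<le> K * (c / 2 * \<epsilon>' / (4 * K))" using K by (intro mult_left_mono) (auto simp: \<delta>_def)
      also have "\<dots> = c / 2 * \<epsilon>' / 4" using K by simp
      also have "\<dots> < c / 2 * \<epsilon>' / 2" using c \<epsilon>' by simp
      finally show ?thesis .
    qed
    show ?thesis
    proof (intro exI[of _ \<delta>] conjI allI impI \<delta>(1))
      fix Q assume "same_format P Q \<and> C2_data Q \<and> C2_norm (cball x r) (diff_components P Q) \<le> \<delta>"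
      then have Q: "same_format P Q" "C2_data Q" "C2_norm (cball x r) (diff_components P Q) \<le> \<delta>" by auto
      have nearQ: "near r \<kappa> Q" using near[OF Q(1,2)] Q(3) \<delta>(2) by simp
      note close = C2_norm_imp_close[OF fin C2 Q(2,1) compact_cball Q(3)]
      have "norm (\<Phi> Q (x, z0)) \<le> K * \<delta>"
        unfolding K_def M_def
      proof (rule \<Phi>_base_small)
        show "C2_close {x} \<delta> (obj P) (obj Q)" using close(1) r by (simp add: C2_close_def)
        show "C2_close {x} \<delta> (constr_fun P c) (constr_fun Q c)" if "c \<in> constrs P" for c
          using close(2)[OF that] r by (simp add: C2_close_def)
      qed (use \<delta> in simp)
      then have small: "norm (\<Phi> Q (x, z0)) < c / 2 * \<epsilon>' / 2" using K\<delta> by simp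
      have sub: "u \<in> cball x \<epsilon> \<times> cball z0 \<kappa>1 \<and> u \<in> cball x r \<times> cball z0 \<kappa>1" if "u \<in> cball (x, z0) \<epsilon>'" for u
      proof -
        obtain y z where u: "u = (y, z)" by fastforce
        have "dist x y \<le> \<epsilon>'" "dist z0 z \<le> \<epsilon>'"
          using that dist_fst_le[of "(x, z0)" u] dist_snd_le[of "(x, z0)" u] by (auto simp: u)
        then show ?thesis using \<epsilon>' \<epsilon> by (auto simp: u)
      qed
      have "\<exists>u\<in>cball (x, z0) \<epsilon>'. \<Phi> Q u = 0"
        by (rule expansive_map_has_zero[OF continuous_on_\<Phi>[OF Q(1,2)] \<epsilon>'(1) _ exp\<Phi>[OF nearQ] small])
          (use c in simp, use sub in blast, use sub in blast)
      then obtain u where u: "u \<in> cball (x, z0) \<epsilon>'" and zero: "\<Phi> Q u = 0" by blast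
      obtain y z where yz: "u = (y, z)" by fastforce
      have "W_stationary Q y"
        by (rule zero_imp_stationary[OF nearQ _ inactive _ \<kappa>1(1)]) (use sub[OF u] zero yz in auto)
      moreover have "y' = y" if y': "y' \<in> cball x r" and stat: "W_stationary Q y'" for y'
      proof -
        obtain z' where z': "z' \<in> cball z0 \<kappa>1" "\<Phi> Q (y', z') = 0"
          using stationary_imp_zero[OF nearQ y' inactive stat \<kappa>1(1) c1 \<kappa>(4)] \<kappa>(1,2) unfolding M_def by force
        have "c / 2 * norm (u - (y', z')) \<le> norm (\<Phi> Q u - \<Phi> Q (y', z'))"
          using exp\<Phi>[OF nearQ, of u "(y', z')"] sub[OF u] y' z' by simp
        then have "u = (y', z')" using c z' zero by (simp add: mult_le_0_iff)
        then show ?thesis by (simp add: yz)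
      qed
      ultimately show "\<exists>x'\<in>cball x \<epsilon>. W_stationary Q x' \<and> (\<forall>y\<in>cball x r. W_stationary Q y \<longrightarrow> y = x')"
        using sub[OF u] yz by (intro bexI[of _ y]) auto
    qed
  qed
  moreover have "W_stationary P x" using x m W_stationary_iff[OF fin] by blast
  ultimately show ?thesis unfolding strongly_stable_def using r by blast
qed

end

section \<open>Characterization of strong stability\<close>

theorem theorem4p6:
  fixes P :: "('i, 'j, 'n::finite) mpsc"
    and x :: "real ^ 'n"
    and lam :: "'i \<Rightarrow> real" and mu :: "'j \<Rightarrow> real" and sig1 sig2 :: "nat \<Rightarrow> real"
  assumes "finite (eq_idx P)" and "finite (ineq_idx P)"
    and "C2_data P"
    and "x \<in> feasible P"
    and "W_stationary P x"
    and "LICQ P x"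
    and "W_multipliers P x lam mu sig1 sig2"
  shows "strongly_stable P x \<longleftrightarrow>
    (\<forall>m\<in>beta P x. sig1 m * sig2 m \<noteq> 0) \<and>
    restr_nonsingular_same_sign (hess (Lagrangian P lam mu sig1 sig2) x)
      {tangent_space P x Js | Js. J_plus P x mu \<subseteq> Js \<and> Js \<subseteq> J0 P x}"
proof -
  let ?m = "mult_of lam mu sig1 sig2"
  note fin = assms(1,2) and C2 = assms(3) and x = assms(4) and licq = assms(6)
  have m: "is_multiplier P x ?m" using assms(7) W_multipliers_iff[OF fin x] by blast
  note soc = second_order_condition_iff[OF fin C2 x licq m]
  show ?thesis
    unfolding soc
  proof (intro iffI conjI ballI)
    assume stab: "strongly_stable P x"
    show "no_critical_direction (Lagrangian_jac P x ?m)
      (\<lambda>c. grad (constr_fun P c) x) (active P x - weakly_active P x ?m) (weakly_active P x ?m)"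
      by (rule strongly_stable_imp_no_critical_direction[OF fin C2 x m stab])
    show "sig1 k * sig2 k \<noteq> 0" if "k \<in> beta P x" for k
      using strongly_stable_imp_biactive_multipliers_nonzero[OF fin C2 x licq m stab that] by simp
  next
    assume rhs: "(\<forall>k\<in>beta P x. sig1 k * sig2 k \<noteq> 0) \<and>
      no_critical_direction (Lagrangian_jac P x ?m)
      (\<lambda>c. grad (constr_fun P c) x) (active P x - weakly_active P x ?m) (weakly_active P x ?m)"
    have finA: "finite (active P x)" using finite_constrs[OF fin] by (simp add: active_def)
    note ind = LICQ_active[OF x licq]
    have "card (active P x) \<le> card (UNIV :: 'n set)"
      using independent_bound[OF ind(2)] card_image[OF ind(1)] by simp
    then obtain e :: "('i, 'j) constr \<Rightarrow> 'n" where e: "inj_on e (active P x)"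
      using card_le_inj[OF finA finite[of "UNIV :: 'n set"]] by blast
    interpret kojima_reduction P x ?m e
      by unfold_locales (use fin C2 x m ind e rhs in auto)
    show "strongly_stable P x" by (rule W_stationary_point_strongly_stable)
  qed
qed

end
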